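(* Let $\mathfrak g$ be a simple finite-dimensional complex Lie algebra with dual Coxeter number $g$. The $\mathfrak g$-boson algebra $\widehat{\mathfrak g}_+$ generates a vertex operator (super)algebra on $H=L(V_0,g)$, and also on $H=L(V_0,\ell)$ for any $\ell\in\mathbb N$, with Virasoro vector $\omega=\frac1{2(\ell+g)}\sum_a(X^a_{-1})^2\Omega$. Moreover, with $L(z)=V(\omega,z)=\sum_nL_nz^{-n-2}$, $$X^a(z)X^b(w)\sim\frac{[X^a,X^b](w)}{(z-w)}+\frac{\ell\,\delta_{ab}}{(z-w)^2},$$ $$X^a(z)L(w)\sim\frac{X^a(w)}{(z-w)^2}\quad\text{and}\quad[L_m,X^a_n]=-nX^a_{m+n}.$$
   Context: Lie algebra data. $\mathfrak g$ has a basis $(X_a)_{1\le a\le\dim\mathfrak g}$ with $[X_a,X_b]=i\sum_c\Gamma_{ab}^cX_c$, $\Gamma_{ab}^c\in\mathbb R$ totally antisymmetric, normalized so that $\sum_aX_a^2$ is exactly the Casimir (highest root of squared length 2); then $\sum_{a,c}\Gamma_{ac}^b\Gamma_{ac}^d=2g\,\delta_{bd}$. $\widehat{\mathfrak g}_+$ is spanned by $X^a_n$ ($n\in\mathbb Z$) and a central $\mathcal L$, with $[X_m^a,X_n^b]=i\sum_c\Gamma_{ab}^cX^c_{m+n}+m\,\delta_{ab}\delta_{m+n,0}\mathcal L$, $(X_n^a)^\star=X_{-n}^a$. $L(V_0,\ell)$ is its irreducible unitary highest weight representation with $\mathcal L=\ell$ and lowest energy subspace the trivial representation $V_0=\mathbb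 C\Omega$, $\|\Omega\|=1$, so $X^a_n\Omega=0$ for $n\ge0$. The boson fields are $X^a(z)=\sum_nX^a_nz^{-n-1}$, and $[X^a,X^b]=i\sum_c\Gamma_{ab}^cX^c$. Fields and locality. A field on a prehilbert space $H$ is $A(z)=\sum_{n\in\mathbb Z}A(n)z^{-n-1}\in(\mathrm{End}\,H)[[z,z^{-1}]]$. Two fields $A,B$ are local with sign $\varepsilon\in\mathbb Z_2$ if there is $N\in\mathbb N$ such that for all $c,d\in H$ there is $X\in(z-w)^{-N}\mathbb C[z^{\pm1},w^{\pm1}]$ with $X(z,w)=(A(z)B(w)c,d)$ for $|z|>|w|$ and $X(z,w)=(-1)^\varepsilon(B(w)A(z)c,d)$ for $|w|>|z|$. With $[X,Y]_\varepsilon=XY-(-1)^\varepsilon YX$, one defines $A_nB(w)=\sum_m(A_nB)(m)w^{-m-1}$ by $(A_nB)(m)=\sum_{p=0}^n(-1)^p\binom np[A(n-p),B(m+p)]_\varepsilon$ if $n\ge0$ and $(A_nB)(m)=\sum_{p\ge0}\binom{p-n-1}p\big(A(n-p)B(m+p)-(-1)^{\varepsilon+n}B(m+n-p)A(p)\big)$ if $n<0$. The notation $A(z)B(w)\sim\sum_{n=0}^{N-1}\frac{C_n(w)}{(z-w)^{n+1}}$ means $A_nB=C_n$ for $0\le n\le N-1$ and $A_nB=0$ for $n\ge N$, i.e. it gives the singular part of $X(z,w)$ at $z=w$ in all matrix coefficients. "Generates": $\mathcal S$ is the linear span of the smallest set of fields containing $\mathrm{Id}$ and the $X^a$ and stable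 under $(A,B)\mapsto A_nB$ ($n\in\mathbb Z$) and $A\mapsto A'$; $V:H\to\mathcal S$ is the inverse of the linear bijection $\mathcal S\to H$, $A\mapsto A(z)\Omega|_{z=0}$. A vertex operator superalgebra is $(H,V,\Omega,\omega)$ with $H=H_{\bar0}\oplus H_{\bar1}$ a prehilbert superspace, $V:H\to(\mathrm{End}\,H)[[z,z^{-1}]]$ linear ($V(a)(z)$ written $V(a,z)$), $\Omega,\omega\in H$, such that, with $\mathcal S_\varepsilon=V(H_\varepsilon)$, $\mathcal S=\mathcal S_{\bar0}\oplus\mathcal S_{\bar1}$: (1) for all $A\in\mathcal S$, $n\in\mathbb N$: $A(n)\Omega=0$; $V(a,z)\Omega|_{z=0}=a$; $V(\Omega,z)=\mathrm{Id}$. (2) $\{A(n):A\in\mathcal S,n\in\mathbb Z\}$ acts irreducibly on $H$. (3) for $A\in\mathcal S_{\varepsilon_1}$, $B\in\mathcal S_{\varepsilon_2}$: $A,B$ are local with sign $\varepsilon_1\varepsilon_2$, and $A_nB\in\mathcal S_{\varepsilon_1+\varepsilon_2}$. (4) $V(\omega,z)=\sum_nL_nz^{-n-2}$ with $L_0\Omega=L_{-1}\Omega=0$, $\omega=L_{-2}\Omega$, and $[L_m,L_n]=(m-n)L_{m+n}+\frac c{12}m(m^2-1)\delta_{m+n,0}$, $c=2\|\omega\|^2$. (5) $L_0$ decomposes $H$ into $\bigoplus_{n\in\frac12\mathbb N}H_n$ ($L_0=n$ on $H_n$), $\dim H_n<\infty$, $H_n\perp H_m$ for $n\ne m$, $H_\varepsilon=\bigoplus_{n\in\mathbb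 N+\varepsilon/2}H_n$, $\Omega\in H_0$, $\omega\in H_2$, and $[L_0,V(a,z)]=zV'(a,z)+\alpha V(a,z)$ for $a\in H_\alpha$. (6) $[L_{-1},V(a,z)]=V'(a,z)=V(L_{-1}a,z)\in\mathcal S$. *)

theory Defs
  imports "HOL-Analysis.Analysis" "HOL-Library.Groups_Big_Fun" "HOL-Library.Z2"
begin

section \<open>Complex vector spaces and prehilbert spaces\<close>

class complex_vector = ab_group_add +
  fixes scaleC :: "complex \<Rightarrow> 'a \<Rightarrow> 'a" (infixr "*\<^sub>C" 75)
  assumes scaleC_add_right: "c *\<^sub>C (x + y) = c *\<^sub>C x + c *\<^sub>C y"
    and scaleC_add_left: "(c + d) *\<^sub>C x = c *\<^sub>C x + d *\<^sub>C x"
    and scaleC_scaleC: "c *\<^sub>C d *\<^sub>C x = (c * d) *\<^sub>C x"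
    and scaleC_one: "1 *\<^sub>C x = x"

global_interpretation complex_vector: vector_space
  "scaleC :: complex \<Rightarrow> 'a \<Rightarrow> 'a::complex_vector"
  by unfold_locales
    (simp_all add: scaleC_add_right scaleC_add_left scaleC_scaleC scaleC_one)

abbreviation clinear :: "('a::complex_vector \<Rightarrow> 'b::complex_vector) \<Rightarrow> bool"
  where "clinear \<equiv> Vector_Spaces.linear scaleC scaleC"

definition cfinite_dim :: "'a::complex_vector set \<Rightarrow> bool" where
  "cfinite_dim W \<longleftrightarrow> (\<exists>B. finite B \<and> W \<subseteq> complex_vector.span B)"

text \<open>The inner product is linear in the first argument.\<close>

class prehilbert = complex_vector +
  fixes cinner :: "'a \<Rightarrow> 'a \<Rightarrow> complex"
  assumes cinner_commute: "cinner x y = cnj (cinner y x)"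
    and cinner_add_left: "cinner (x + y) z = cinner x z + cinner y z"
    and cinner_scaleC_left: "cinner (c *\<^sub>C x) y = c * cinner x y"
    and cinner_pos: "x \<noteq> 0 \<Longrightarrow> 0 < Re (cinner x x)"

definition acts_irreducibly :: "('h::complex_vector \<Rightarrow> 'h) set \<Rightarrow> bool" where
  "acts_irreducibly Ts \<longleftrightarrow> (\<exists>v::'h. v \<noteq> 0) \<and>
     (\<forall>W. complex_vector.subspace W \<and> (\<forall>T\<in>Ts. T ` W \<subseteq> W) \<longrightarrow> W = {0} \<or> W = UNIV)"


section \<open>Simple Lie algebras, roots, dual Coxeter number\<close>

locale complex_lie_algebra =
  fixes lie :: "'g::complex_vector \<Rightarrow> 'g \<Rightarrow> 'g"
  assumes linear_left: "clinear (\<lambda>x. lie x y)"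
    and linear_right: "clinear (\<lambda>y. lie x y)"
    and alternating: "lie x x = 0"
    and jacobi: "lie x (lie y z) + lie y (lie z x) + lie z (lie x y) = 0"

locale simple_lie_algebra = complex_lie_algebra +
  assumes nonabelian: "\<exists>x y. lie x y \<noteq> 0"
    and no_ideals: "complex_vector.subspace I \<Longrightarrow> (\<And>x y. y \<in> I \<Longrightarrow> lie x y \<in> I)
      \<Longrightarrow> I = {0} \<or> I = UNIV"

text \<open>A Cartan subalgebra, in the form appropriate to a semisimple Lie algebra: a maximal
  abelian subalgebra whose adjoint action is simultaneously diagonalizable.\<close>

definition cartan_subalgebra :: "('g::complex_vector \<Rightarrow> 'g \<Rightarrow> 'g) \<Rightarrow> 'g set \<Rightarrow> bool" where
  "cartan_subalgebra lie h \<longleftrightarrow>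
     complex_vector.subspace h \<and>
     (\<forall>s\<in>h. \<forall>t\<in>h. lie s t = 0) \<and>
     (\<forall>x. (\<forall>t\<in>h. lie t x = 0) \<longrightarrow> x \<in> h) \<and>
     complex_vector.span {x. \<exists>\<alpha>. \<forall>t\<in>h. lie t x = \<alpha> t *\<^sub>C x} = UNIV"

definition root_space ::
  "('g::complex_vector \<Rightarrow> 'g \<Rightarrow> 'g) \<Rightarrow> 'g set \<Rightarrow> ('g \<Rightarrow> complex) \<Rightarrow> 'g set" where
  "root_space lie h \<alpha> = {x. \<forall>t\<in>h. lie t x = \<alpha> t *\<^sub>C x}"

text \<open>Functionals on \<open>h\<close> are represented by functions that vanish outside \<open>h\<close>; linearity on
  \<open>h\<close> is automatic when the root space is nonzero.\<close>

definition roots :: "('g::complex_vector \<Rightarrow> 'g \<Rightarrow> 'g) \<Rightarrow> 'g set \<Rightarrow> ('g \<Rightarrow> complex) set" where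
  "roots lie h = {\<alpha>. (\<forall>t. t \<notin> h \<longrightarrow> \<alpha> t = 0) \<and> (\<exists>t\<in>h. \<alpha> t \<noteq> 0) \<and> root_space lie h \<alpha> \<noteq> {0}}"

definition positive_system ::
  "('g::complex_vector \<Rightarrow> 'g \<Rightarrow> 'g) \<Rightarrow> 'g set \<Rightarrow> ('g \<Rightarrow> complex) set \<Rightarrow> bool" where
  "positive_system lie h P \<longleftrightarrow>
     (\<exists>\<gamma>\<in>h. (\<forall>\<alpha>\<in>roots lie h. \<alpha> \<gamma> \<in> \<real> \<and> \<alpha> \<gamma> \<noteq> 0) \<and> P = {\<alpha>\<in>roots lie h. 0 < Re (\<alpha> \<gamma>)})"

text \<open>The highest root dominates every root: the difference is a sum of positive roots.\<close>

definition highest_root ::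
  "('g::complex_vector \<Rightarrow> 'g \<Rightarrow> 'g) \<Rightarrow> 'g set \<Rightarrow> ('g \<Rightarrow> complex) set \<Rightarrow> ('g \<Rightarrow> complex) \<Rightarrow> bool"
  where
  "highest_root lie h P \<theta> \<longleftrightarrow> \<theta> \<in> roots lie h \<and>
     (\<forall>\<alpha>\<in>roots lie h. \<exists>k :: ('g \<Rightarrow> complex) \<Rightarrow> nat.
        \<forall>t. \<theta> t - \<alpha> t = (\<Sum>\<beta>\<in>P. of_nat (k \<beta>) * \<beta> t))"

definition coroot ::
  "('g::complex_vector \<Rightarrow> 'g \<Rightarrow> 'g) \<Rightarrow> 'g set \<Rightarrow> ('g \<Rightarrow> complex) \<Rightarrow> 'g" where
  "coroot lie h \<alpha> = (THE t. t \<in> complex_vector.span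
       {lie x y | x y. x \<in> root_space lie h \<alpha> \<and> y \<in> root_space lie h (\<lambda>s. - \<alpha> s)} \<and> \<alpha> t = 2)"

text \<open>\<open>1 + \<rho>(\<theta>\<^sup>\<or>)\<close> with \<open>\<rho>\<close> the half sum of the positive roots.\<close>

definition dual_coxeter_number ::
  "('g::complex_vector \<Rightarrow> 'g \<Rightarrow> 'g) \<Rightarrow> 'g set \<Rightarrow> ('g \<Rightarrow> complex) set \<Rightarrow> ('g \<Rightarrow> complex) \<Rightarrow> complex"
  where
  "dual_coxeter_number lie h P \<theta> = 1 + (\<Sum>\<alpha>\<in>P. \<alpha> (coroot lie h \<theta>)) / 2"

definition invariant_form ::
  "('g::complex_vector \<Rightarrow> 'g \<Rightarrow> 'g) \<Rightarrow> ('g \<Rightarrow> 'g \<Rightarrow> complex) \<Rightarrow> bool" where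
  "invariant_form lie \<kappa> \<longleftrightarrow>
     (\<forall>y. Vector_Spaces.linear scaleC (*) (\<lambda>x. \<kappa> x y)) \<and>
     (\<forall>x y. \<kappa> x y = \<kappa> y x) \<and>
     (\<forall>x y z. \<kappa> (lie x y) z = \<kappa> x (lie y z))"

text \<open>The form induced by \<open>\<kappa>\<close> on the dual of \<open>h\<close> gives \<open>\<alpha>\<close> the squared length \<open>r\<close>:
  \<open>\<alpha>\<close> corresponds to \<open>t \<in> h\<close> via \<open>\<kappa>\<close>, and \<open>(\<alpha>,\<alpha>) = \<kappa>(t,t)\<close>.\<close>

definition has_sq_length ::
  "('g \<Rightarrow> 'g \<Rightarrow> complex) \<Rightarrow> 'g set \<Rightarrow> ('g \<Rightarrow> complex) \<Rightarrow> complex \<Rightarrow> bool" where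
  "has_sq_length \<kappa> h \<alpha> r \<longleftrightarrow> (\<exists>t\<in>h. (\<forall>s\<in>h. \<kappa> t s = \<alpha> s) \<and> \<kappa> t t = r)"

text \<open>A basis orthonormal for the invariant form in which the highest root has squared
  length 2 (equivalently, the sum of the squares of the basis is the Casimir element of that
  form), with real totally antisymmetric structure constants \<open>\<Gamma> a b c\<close>
  (upper index last).\<close>

definition normalized_basis ::
  "('g::complex_vector \<Rightarrow> 'g \<Rightarrow> 'g) \<Rightarrow> 'g set \<Rightarrow> ('g \<Rightarrow> complex) \<Rightarrow>
    ('i::finite \<Rightarrow> 'g) \<Rightarrow> ('i \<Rightarrow> 'i \<Rightarrow> 'i \<Rightarrow> real) \<Rightarrow> bool" where
  "normalized_basis lie h \<theta> X \<Gamma> \<longleftrightarrow>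
     inj X \<and> complex_vector.independent (range X) \<and> complex_vector.span (range X) = UNIV \<and>
     (\<exists>\<kappa>. invariant_form lie \<kappa> \<and> has_sq_length \<kappa> h \<theta> 2 \<and>
          (\<forall>a b. \<kappa> (X a) (X b) = (if a = b then 1 else 0))) \<and>
     (\<forall>a b. lie (X a) (X b) = \<i> *\<^sub>C (\<Sum>c\<in>UNIV. of_real (\<Gamma> a b c) *\<^sub>C X c)) \<and>
     (\<forall>a b c. \<Gamma> a b c = - \<Gamma> b a c \<and> \<Gamma> a b c = - \<Gamma> a c b)"


section \<open>The boson algebra and its vacuum representation\<close>

text \<open>\<open>J a n\<close> is the operator by which \<open>X\<^sup>a\<^sub>n\<close> acts and \<open>K\<close> the one by which the central
  element \<open>\<L>\<close> acts.\<close>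

definition boson_rep ::
  "('i::finite \<Rightarrow> 'i \<Rightarrow> 'i \<Rightarrow> real) \<Rightarrow> ('i \<Rightarrow> int \<Rightarrow> 'h \<Rightarrow> 'h) \<Rightarrow>
    ('h::complex_vector \<Rightarrow> 'h) \<Rightarrow> bool" where
  "boson_rep \<Gamma> J K \<longleftrightarrow>
     (\<forall>a n. clinear (J a n)) \<and> clinear K \<and>
     (\<forall>a b m n v. J a m (J b n v) - J b n (J a m v) =
        \<i> *\<^sub>C (\<Sum>c\<in>UNIV. of_real (\<Gamma> a b c) *\<^sub>C J c (m + n) v)
        + (if a = b \<and> m + n = 0 then of_int m *\<^sub>C K v else 0)) \<and>
     (\<forall>a n v. K (J a n v) = J a n (K v))"

text \<open>The representation \<open>L(V\<^sub>0, \<l>)\<close>: irreducible, unitary, of level \<open>\<l>\<close>, whose lowest energy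
  subspace (the vectors annihilated by the positive modes) is the trivial representation
  of the zero modes, spanned by the unit vector \<open>\<Omega>\<close>.\<close>

definition vacuum_rep ::
  "('i::finite \<Rightarrow> 'i \<Rightarrow> 'i \<Rightarrow> real) \<Rightarrow> complex \<Rightarrow> ('i \<Rightarrow> int \<Rightarrow> 'h \<Rightarrow> 'h) \<Rightarrow>
    ('h \<Rightarrow> 'h) \<Rightarrow> 'h::prehilbert \<Rightarrow> bool" where
  "vacuum_rep \<Gamma> \<l> J K \<Omega> \<longleftrightarrow>
     boson_rep \<Gamma> J K \<and>
     (\<forall>v. K v = \<l> *\<^sub>C v) \<and>
     (\<forall>a n u v. cinner (J a n u) v = cinner u (J a (- n) v)) \<and>
     acts_irreducibly (insert K {J a n | a n. True}) \<and>
     {v. \<forall>a n. n > 0 \<longrightarrow> J a n v = 0} = complex_vector.span {\<Omega>} \<and>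
     (\<forall>a. J a 0 \<Omega> = 0) \<and>
     cinner \<Omega> \<Omega> = 1"


section \<open>Fields\<close>

text \<open>A field \<open>A(z) = \<Sum>\<^sub>n A(n) z\<^sup>-\<^sup>n\<^sup>-\<^sup>1\<close> is given by its modes; that the modes are linear is
  imposed where needed.\<close>

type_synonym 'h modes = "int \<Rightarrow> 'h \<Rightarrow> 'h"

definition zero_field :: "'h::complex_vector modes" where
  "zero_field = (\<lambda>n v. 0)"

definition id_field :: "'h::complex_vector modes" where
  "id_field = (\<lambda>n v. if n = - 1 then v else 0)"

text \<open>\<open>A'(z) = \<Sum>\<^sub>n (- n - 1) A(n) z\<^sup>-\<^sup>n\<^sup>-\<^sup>2\<close>\<close>

definition deriv_field :: "'h::complex_vector modes \<Rightarrow> 'h modes" where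
  "deriv_field A = (\<lambda>n v. of_int (- n) *\<^sub>C A (n - 1) v)"

definition field_span :: "'h::complex_vector modes set \<Rightarrow> 'h modes set" where
  "field_span \<A> = {\<lambda>n v. \<Sum>A\<in>F. k A *\<^sub>C A n v | F k. finite F \<and> F \<subseteq> \<A>}"

definition eps_sign :: "bit \<Rightarrow> complex" where
  "eps_sign \<epsilon> = (if \<epsilon> = 1 then - 1 else 1)"

text \<open>\<open>X \<in> (z - w)\<^sup>-\<^sup>N \<complex>[z\<^sup>\<plusminus>\<^sup>1, w\<^sup>\<plusminus>\<^sup>1]\<close>, regarded as a function of two complex variables.\<close>

definition laurent_pole :: "nat \<Rightarrow> (complex \<Rightarrow> complex \<Rightarrow> complex) \<Rightarrow> bool" where
  "laurent_pole N X \<longleftrightarrow> (\<exists>F (k :: int \<times> int \<Rightarrow> complex). finite F \<and>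
     X = (\<lambda>z w. (\<Sum>(i, j)\<in>F. k (i, j) * z powi i * w powi j) / (z - w) ^ N))"

text \<open>The rational function \<open>X\<close> is the sum of the double series \<open>(A(z)B(w)c, d)\<close>, respectively
  \<open>(-1)\<^sup>\<epsilon> (B(w)A(z)c, d)\<close>, in the two domains.\<close>

definition local :: "bit \<Rightarrow> 'h::prehilbert modes \<Rightarrow> 'h modes \<Rightarrow> bool" where
  "local \<epsilon> A B \<longleftrightarrow> (\<exists>N. \<forall>c d. \<exists>X. laurent_pole N X \<and>
     (\<forall>z w. norm z > norm w \<and> w \<noteq> 0 \<longrightarrow>
        ((\<lambda>(m, n). cinner (A m (B n c)) d * z powi (- m - 1) * w powi (- n - 1))
           has_sum X z w) UNIV) \<and>
     (\<forall>z w. norm w > norm z \<and> z \<noteq> 0 \<longrightarrow>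
        ((\<lambda>(m, n). eps_sign \<epsilon> * cinner (B n (A m c)) d * z powi (- m - 1) * w powi (- n - 1))
           has_sum X z w) UNIV))"

text \<open>The field \<open>A\<^sub>nB\<close>. For \<open>n < 0\<close> the sum over \<open>p\<close> is taken vector by vector; it is a finite
  sum there as soon as \<open>A(p)\<close> and \<open>B(p)\<close> annihilate each vector for \<open>p\<close> large.\<close>

definition field_prod ::
  "bit \<Rightarrow> 'h::complex_vector modes \<Rightarrow> 'h modes \<Rightarrow> int \<Rightarrow> 'h modes" where
  "field_prod \<epsilon> A B n = (\<lambda>m v.
     if n \<ge> 0 then
       \<Sum>p\<le>nat n. ((- 1) ^ p * of_nat (nat n choose p)) *\<^sub>C
         (A (n - int p) (B (m + int p) v) - eps_sign \<epsilon> *\<^sub>C B (m + int p) (A (n - int p) v))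
     else
       Sum_any (\<lambda>p::nat. of_nat (nat (int p - n - 1) choose p) *\<^sub>C
         (A (n - int p) (B (m + int p) v)
          - (eps_sign \<epsilon> * (- 1) powi n) *\<^sub>C B (m + n - int p) (A (int p) v))))"

text \<open>\<open>A(z)B(w) \<sim> \<Sum>\<^sub>n C\<^sub>n(w) / (z - w)\<^sup>n\<^sup>+\<^sup>1\<close>, with \<open>Cs = [C\<^sub>0, \<dots>, C\<^sub>N\<^sub>-\<^sub>1]\<close>.\<close>

definition ope :: "bit \<Rightarrow> 'h::complex_vector modes \<Rightarrow> 'h modes \<Rightarrow> 'h modes list \<Rightarrow> bool" where
  "ope \<epsilon> A B Cs \<longleftrightarrow>
     (\<forall>n::nat. field_prod \<epsilon> A B (int n) = (if n < length Cs then Cs ! n else zero_field))"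


section \<open>Vertex operator superalgebras\<close>

text \<open>\<open>V(\<omega>, z) = \<Sum>\<^sub>n L\<^sub>n z\<^sup>-\<^sup>n\<^sup>-\<^sup>2\<close>\<close>

definition vir_mode :: "('h \<Rightarrow> 'h modes) \<Rightarrow> 'h \<Rightarrow> int \<Rightarrow> 'h \<Rightarrow> 'h" where
  "vir_mode V \<omega> n = V \<omega> (n + 1)"

definition energy_space ::
  "('h \<Rightarrow> 'h modes) \<Rightarrow> 'h \<Rightarrow> real \<Rightarrow> 'h::complex_vector set" where
  "energy_space V \<omega> q = {v. vir_mode V \<omega> 0 v = of_real q *\<^sub>C v}"

locale vertex_operator_superalgebra =
  fixes Hs :: "bit \<Rightarrow> 'h::prehilbert set"
    and V :: "'h \<Rightarrow> 'h modes"
    and \<Omega> \<omega> :: 'h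
  assumes superspace: "\<And>\<epsilon>. complex_vector.subspace (Hs \<epsilon>)"
      "Hs 0 \<inter> Hs 1 = {0}" "\<And>v. \<exists>a\<in>Hs 0. \<exists>b\<in>Hs 1. v = a + b"
    and V_modes_linear: "\<And>a n. clinear (V a n)"
    and V_linear: "\<And>n v. clinear (\<lambda>a. V a n v)"
    and vacuum: "\<And>a n. n \<ge> 0 \<Longrightarrow> V a n \<Omega> = 0"
      "\<And>a. V a (- 1) \<Omega> = a" "V \<Omega> = id_field"
    and irreducible: "acts_irreducibly {V a n | a n. True}"
    and locality: "\<And>\<epsilon>\<^sub>1 \<epsilon>\<^sub>2 A B. A \<in> V ` Hs \<epsilon>\<^sub>1 \<Longrightarrow> B \<in> V ` Hs \<epsilon>\<^sub>2 \<Longrightarrow> local (\<epsilon>\<^sub>1 * \<epsilon>\<^sub>2) A B"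
    and closed_prod: "\<And>\<epsilon>\<^sub>1 \<epsilon>\<^sub>2 A B n. A \<in> V ` Hs \<epsilon>\<^sub>1 \<Longrightarrow> B \<in> V ` Hs \<epsilon>\<^sub>2 \<Longrightarrow>
      field_prod (\<epsilon>\<^sub>1 * \<epsilon>\<^sub>2) A B n \<in> V ` Hs (\<epsilon>\<^sub>1 + \<epsilon>\<^sub>2)"
    and virasoro_vacuum: "vir_mode V \<omega> 0 \<Omega> = 0" "vir_mode V \<omega> (- 1) \<Omega> = 0"
      "\<omega> = vir_mode V \<omega> (- 2) \<Omega>"
    and virasoro: "\<And>m n v.
      vir_mode V \<omega> m (vir_mode V \<omega> n v) - vir_mode V \<omega> n (vir_mode V \<omega> m v) =
      of_int (m - n) *\<^sub>C vir_mode V \<omega> (m + n) v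
      + (if m + n = 0 then (2 * cinner \<omega> \<omega> / 12 * of_int (m * (m\<^sup>2 - 1))) *\<^sub>C v else 0)"
    and grading: "complex_vector.span (\<Union>k::nat. energy_space V \<omega> (real k / 2)) = UNIV"
      "\<And>k::nat. cfinite_dim (energy_space V \<omega> (real k / 2))"
      "\<And>(j::nat) (k::nat) u v. j \<noteq> k \<Longrightarrow> u \<in> energy_space V \<omega> (real j / 2) \<Longrightarrow>
        v \<in> energy_space V \<omega> (real k / 2) \<Longrightarrow> cinner u v = 0"
      "Hs 0 = complex_vector.span (\<Union>k::nat. energy_space V \<omega> (real k))"
      "Hs 1 = complex_vector.span (\<Union>k::nat. energy_space V \<omega> (real k + 1 / 2))"
      "\<Omega> \<in> energy_space V \<omega> 0" "\<omega> \<in> energy_space V \<omega> 2"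
    and energy: "\<And>(k::nat) a n v. a \<in> energy_space V \<omega> (real k / 2) \<Longrightarrow>
      vir_mode V \<omega> 0 (V a n v) - V a n (vir_mode V \<omega> 0 v) =
      deriv_field (V a) (n + 1) v + of_real (real k / 2) *\<^sub>C V a n v"
    and translation: "\<And>a n v.
      vir_mode V \<omega> (- 1) (V a n v) - V a n (vir_mode V \<omega> (- 1) v) = deriv_field (V a) n v"
      "\<And>a. deriv_field (V a) = V (vir_mode V \<omega> (- 1) a)"

text \<open>The space of fields of parity \<open>\<epsilon>\<close> is \<open>V ` Hs \<epsilon>\<close>, and \<open>range V\<close> is their sum.
  In \<open>energy\<close>, multiplication by \<open>z\<close> shifts the modes: \<open>(z A(z))(n) = A(n + 1)\<close>.
  In \<open>grading\<close>, the sum of the eigenspaces of \<open>L\<^sub>0\<close> is automatically direct.\<close>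

text \<open>The fields produced from the identity and a set of generating fields, each carrying a
  parity; \<open>G \<epsilon> A\<close> says that \<open>A\<close> is a generating field of parity \<open>\<epsilon>\<close>.\<close>

inductive generated :: "(bit \<Rightarrow> 'h::complex_vector modes \<Rightarrow> bool) \<Rightarrow> bit \<Rightarrow> 'h modes \<Rightarrow> bool"
  for G where
  generator: "G \<epsilon> A \<Longrightarrow> generated G \<epsilon> A"
| identity: "generated G 0 id_field"
| product: "generated G \<epsilon>\<^sub>1 A \<Longrightarrow> generated G \<epsilon>\<^sub>2 B \<Longrightarrow>
    generated G (\<epsilon>\<^sub>1 + \<epsilon>\<^sub>2) (field_prod (\<epsilon>\<^sub>1 * \<epsilon>\<^sub>2) A B n)"
| derivative: "generated G \<epsilon> A \<Longrightarrow> generated G \<epsilon> (deriv_field A)"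

definition generated_space :: "(bit \<Rightarrow> 'h::complex_vector modes \<Rightarrow> bool) \<Rightarrow> 'h modes set" where
  "generated_space G = field_span {A. \<exists>\<epsilon>. generated G \<epsilon> A}"

text \<open>\<open>A(z)\<Omega>|\<^bsub>z=0\<^esub>\<close>\<close>

definition state :: "'h \<Rightarrow> 'h modes \<Rightarrow> 'h" where
  "state \<Omega> A = A (- 1) \<Omega>"

definition state_field ::
  "(bit \<Rightarrow> 'h::complex_vector modes \<Rightarrow> bool) \<Rightarrow> 'h \<Rightarrow> 'h \<Rightarrow> 'h modes" where
  "state_field G \<Omega> = inv_into (generated_space G) (state \<Omega>)"

definition generates_vosa ::
  "(bit \<Rightarrow> 'h::prehilbert modes \<Rightarrow> bool) \<Rightarrow> 'h \<Rightarrow> 'h \<Rightarrow> bool" where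
  "generates_vosa G \<Omega> \<omega> \<longleftrightarrow>
     bij_betw (state \<Omega>) (generated_space G) UNIV \<and>
     vertex_operator_superalgebra (\<lambda>\<epsilon>. state \<Omega> ` field_span {A. generated G \<epsilon> A})
       (state_field G \<Omega>) \<Omega> \<omega>"

definition boson_fields :: "('i \<Rightarrow> 'h modes) \<Rightarrow> bit \<Rightarrow> 'h::complex_vector modes \<Rightarrow> bool" where
  "boson_fields J \<epsilon> A \<longleftrightarrow> \<epsilon> = 0 \<and> A \<in> range J"

definition sugawara_vector ::
  "complex \<Rightarrow> complex \<Rightarrow> ('i::finite \<Rightarrow> 'h modes) \<Rightarrow> 'h \<Rightarrow> 'h::complex_vector" where
  "sugawara_vector \<l> g J \<Omega> = (1 / (2 * (\<l> + g))) *\<^sub>C (\<Sum>a\<in>UNIV. J a (- 1) (J a (- 1) \<Omega>))"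

end

theory Submission
  imports Defs "HOL-Library.Function_Algebras"
begin

text \<open>The Casimir element acts on the adjoint representation by a scalar, which is read off the
  highest root vector: it is \<open>(\<theta>,\<theta>) + 2(\<rho>,\<theta>) = 2g\<close>. This gives the contraction of two structure
  constants, and with it the Sugawara operators \<open>L\<^sub>n\<close> satisfy \<open>[L\<^sub>m, X\<^sup>a\<^sub>n] = - n X\<^sup>a\<^sub>m\<^sub>+\<^sub>n\<close>. Hence
  \<open>[L\<^sub>m, L\<^sub>n] - (m - n) L\<^sub>m\<^sub>+\<^sub>n\<close> commutes with the boson algebra, so it is a scalar; the scalar is
  determined by the norms of the vectors \<open>L\<^sub>-\<^sub>k \<Omega>\<close>, which obey a recursion in \<open>k\<close>.

  Locality is treated algebraically, as \<open>(z - w)\<^sup>N [A(z), B(w)] = 0\<close>, and passes to products of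
  fields by Dong's lemma. Covariance under \<open>L\<^sub>-\<^sub>1\<close> and locality make a generated field determined by
  the vector it creates from \<open>\<Omega>\<close>. The rational functions of the analytic definition are
  recovered from the algebraic one because \<open>L\<^sub>0\<close> grades every matrix coefficient.\<close>

section \<open>The Casimir element of a simple Lie algebra\<close>

text \<open>The form for which the basis is orthonormal is invariant and nondegenerate; root
  strings, finiteness of the roots and one-dimensional root spaces are derived from it and from the
  absence of ideals. The contraction that equals \<open>2 * g\<close> is also a sum of squares of
  real structure constants. This makes \<open>g\<close> positive, so that dividing by
  \<open>2 * (\<l> + g)\<close> is legitimate. In the Sugawara commutator the normally ordered sum
  cannot be split into two infinite sums. It is therefore truncated and telescoped with finite
  cutoffs, and the shift from \<open>\<l>\<close> to \<open>\<l> + g\<close> is the boundary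
  contribution of this telescoping. The Virasoro cocycle is determined up to the norm of
  \<open>Lop (- 2) \<Omega>\<close>, which is the \<open>cinner \<omega> \<omega>\<close> in the
  required central charge. All generators are even, so the odd part is zero and every sign condition
  on odd fields concerns only the zero field.\<close>

lemma clinear_iff:
  "clinear f \<longleftrightarrow> (\<forall>x y. f (x + y) = f x + f y) \<and> (\<forall>c x. f (c *\<^sub>C x) = c *\<^sub>C f x)"
  by (simp add: Vector_Spaces.linear_def module_hom_def module_hom_axioms_def
      complex_vector.vector_space_axioms complex_vector.module_axioms)

lemma clinear_add: "clinear f \<Longrightarrow> f (x + y) = f x + f y"
  and clinear_scale: "clinear f \<Longrightarrow> f (c *\<^sub>C x) = c *\<^sub>C f x"
  by (simp_all add: clinear_iff)

lemma clinear_0: "clinear f \<Longrightarrow> f 0 = 0"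
  by (metis clinear_scale complex_vector.scale_zero_left)

lemma clinear_minus: "clinear f \<Longrightarrow> f (- x) = - f x"
  by (metis clinear_add clinear_0 add.right_inverse add_eq_0_iff)

lemma clinear_diff: "clinear f \<Longrightarrow> f (x - y) = f x - f y"
  by (metis clinear_add clinear_minus diff_conv_add_uminus)

lemma clinear_sum: "clinear f \<Longrightarrow> f (\<Sum>i\<in>I. x i) = (\<Sum>i\<in>I. f (x i))"
  by (induction I rule: infinite_finite_induct) (simp_all add: clinear_0 clinear_add)

lemmas scaleC_diff_right = complex_vector.scale_right_diff_distrib
lemmas scaleC_diff_left = complex_vector.scale_left_diff_distrib
lemmas scaleC_left_commute = complex_vector.scale_left_commute
lemmas scaleC_sum_right = complex_vector.scale_sum_right
lemmas scaleC_sum_left = complex_vector.scale_sum_left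

lemma span_UNIV_induct:
  assumes "complex_vector.span S = UNIV" "P 0"
    and "\<And>c x y. x \<in> S \<Longrightarrow> P y \<Longrightarrow> P (c *\<^sub>C x + y)"
  shows "P x"
  using complex_vector.span_induct_alt[of x S P] assms by auto

locale orthonormal_lie_algebra = simple_lie_algebra lie
  for lie :: "'g::complex_vector \<Rightarrow> 'g \<Rightarrow> 'g" +
  fixes X :: "'i::finite \<Rightarrow> 'g" and \<kappa> :: "'g \<Rightarrow> 'g \<Rightarrow> complex" and h :: "'g set"
  assumes span_X: "complex_vector.span (range X) = UNIV"
    and form: "invariant_form lie \<kappa>"
    and orthonormal: "\<kappa> (X a) (X b) = (if a = b then 1 else 0)"
    and cartan: "cartan_subalgebra lie h"
begin

lemmas lie_add_left = clinear_add[OF linear_left]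
lemmas lie_add_right = clinear_add[OF linear_right]
lemmas lie_scale_left = clinear_scale[OF linear_left]
lemmas lie_scale_right = clinear_scale[OF linear_right]
lemmas lie_0_left = clinear_0[OF linear_left]
lemmas lie_0_right = clinear_0[OF linear_right]
lemmas lie_minus_right = clinear_minus[OF linear_right]
lemmas lie_diff_right = clinear_diff[OF linear_right]
lemmas lie_sum_left = clinear_sum[OF linear_left]
lemmas lie_sum_right = clinear_sum[OF linear_right]

lemma lie_anti: "lie x y = - lie y x"
proof -
  have "lie (x + y) (x + y) = 0" by (rule alternating)
  then have "lie x x + lie y x + (lie x y + lie y y) = 0"
    unfolding lie_add_left lie_add_right .
  then have "lie x y + lie y x = 0"
    by (simp add: alternating add.commute)
  then show ?thesis by (simp add: eq_neg_iff_add_eq_0)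
qed

lemma lie_derivation: "lie x (lie y z) = lie (lie x y) z + lie y (lie x z)"
proof -
  have "lie x (lie y z) + lie y (lie z x) + lie z (lie x y) = 0" by (rule jacobi)
  moreover have "lie z (lie x y) = - lie (lie x y) z" by (rule lie_anti)
  moreover have "lie y (lie z x) = - lie y (lie x z)"
    by (subst lie_anti[of z x]) (rule lie_minus_right)
  ultimately show ?thesis by (simp add: algebra_simps eq_neg_iff_add_eq_0)
qed

lemma kappa_add_left: "\<kappa> (x + y) z = \<kappa> x z + \<kappa> y z"
  and kappa_scale_left: "\<kappa> (c *\<^sub>C x) z = c * \<kappa> x z"
  and kappa_sym: "\<kappa> x y = \<kappa> y x"
  and kappa_inv: "\<kappa> (lie x y) z = \<kappa> x (lie y z)"
  using form unfolding invariant_form_def Vector_Spaces.linear_def module_hom_def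
    module_hom_axioms_def by blast+

lemma kappa_add_right: "\<kappa> z (x + y) = \<kappa> z x + \<kappa> z y"
  by (metis kappa_add_left kappa_sym)
lemma kappa_scale_right: "\<kappa> z (c *\<^sub>C x) = c * \<kappa> z x"
  by (metis kappa_scale_left kappa_sym)
lemma kappa_0_left: "\<kappa> 0 z = 0"
  using kappa_scale_left[of 0 0 z] by simp
lemma kappa_0_right: "\<kappa> z 0 = 0"
  by (metis kappa_0_left kappa_sym)
lemma kappa_minus_left: "\<kappa> (- x) z = - \<kappa> x z"
  using kappa_add_left[of x "- x" z] by (simp add: kappa_0_left eq_neg_iff_add_eq_0 add.commute)
lemma kappa_minus_right: "\<kappa> z (- x) = - \<kappa> z x"
  by (metis kappa_minus_left kappa_sym)
lemma kappa_diff_left: "\<kappa> (x - y) z = \<kappa> x z - \<kappa> y z"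
  using kappa_add_left[of x "- y" z] by (simp add: kappa_minus_left)
lemma kappa_sum_left: "\<kappa> (\<Sum>i\<in>I. x i) z = (\<Sum>i\<in>I. \<kappa> (x i) z)"
  by (induction I rule: infinite_finite_induct) (simp_all add: kappa_0_left kappa_add_left)

lemma expand: "x = (\<Sum>a\<in>UNIV. \<kappa> x (X a) *\<^sub>C X a)"
proof (induction x rule: span_UNIV_induct[OF span_X])
  case 1
  then show ?case by (simp add: kappa_0_left)
next
  case (2 c x y)
  then obtain b where b: "x = X b" by auto
  have "(\<Sum>a\<in>UNIV. \<kappa> (c *\<^sub>C x + y) (X a) *\<^sub>C X a) =
     (\<Sum>a\<in>UNIV. (if b = a then c *\<^sub>C X a else 0)) + (\<Sum>a\<in>UNIV. \<kappa> y (X a) *\<^sub>C X a)"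
    unfolding sum.distrib[symmetric]
    by (rule sum.cong) (auto simp: b orthonormal kappa_add_left kappa_scale_left scaleC_add_left)
  also have "\<dots> = c *\<^sub>C x + y" using 2(2) b by simp
  finally show ?case by simp
qed

lemma nondegenerate: "(\<And>a. \<kappa> x (X a) = 0) \<Longrightarrow> x = 0"
  using expand[of x] by simp

section \<open>Weight vectors, opposite weights and finiteness of the roots\<close>

definition weight_vector :: "('g \<Rightarrow> complex) \<Rightarrow> 'g \<Rightarrow> bool" where
  "weight_vector \<alpha> x \<longleftrightarrow> (\<forall>t\<in>h. lie t x = \<alpha> t *\<^sub>C x)"

lemma span_weight: "complex_vector.span {x. \<exists>\<alpha>. weight_vector \<alpha> x} = UNIV"
  and h_abelian: "s \<in> h \<Longrightarrow> t \<in> h \<Longrightarrow> lie s t = 0"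
  and h_centralizer: "(\<And>t. t \<in> h \<Longrightarrow> lie t x = 0) \<Longrightarrow> x \<in> h"
  and h_subspace: "complex_vector.subspace h"
  using cartan unfolding cartan_subalgebra_def weight_vector_def by auto

lemma root_space_iff: "x \<in> root_space lie h \<alpha> \<longleftrightarrow> weight_vector \<alpha> x"
  by (simp add: root_space_def weight_vector_def)

lemma nondegenerate_weight: "(\<And>\<alpha> y. weight_vector \<alpha> y \<Longrightarrow> \<kappa> x y = 0) \<Longrightarrow> x = 0"
proof (rule nondegenerate)
  fix a assume *: "\<And>\<alpha> y. weight_vector \<alpha> y \<Longrightarrow> \<kappa> x y = 0"
  have "\<kappa> x y = 0" for y
    by (induction y rule: span_UNIV_induct[OF span_weight])
      (auto simp: kappa_0_right kappa_add_right kappa_scale_right *)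
  then show "\<kappa> x (X a) = 0" .
qed

lemma weight_vector_h: "t \<in> h \<Longrightarrow> weight_vector (\<lambda>_. 0) t"
  by (simp add: weight_vector_def h_abelian)

text \<open>Invariance moves \<open>t\<close> from one argument to the other, which gives
  \<open>\<beta> t * \<kappa> x y = - (\<alpha> t * \<kappa> x y)\<close>.\<close>

lemma weight_orthogonal:
  assumes "weight_vector \<alpha> x" "weight_vector \<beta> y" "t \<in> h" "\<alpha> t + \<beta> t \<noteq> 0"
  shows "\<kappa> x y = 0"
proof -
  have "\<kappa> (lie x t) y = \<kappa> x (lie t y)" by (rule kappa_inv)
  moreover have "lie x t = - \<alpha> t *\<^sub>C x"
    using assms(1,3) lie_anti[of x t] by (simp add: weight_vector_def)
  moreover have "lie t y = \<beta> t *\<^sub>C y" using assms(2,3) by (simp add: weight_vector_def)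
  ultimately have *: "\<beta> t * \<kappa> x y = - (\<alpha> t * \<kappa> x y)"
    by (simp add: kappa_scale_left kappa_scale_right kappa_minus_left)
  have "(\<alpha> t + \<beta> t) * \<kappa> x y = 0"
    unfolding distrib_right * by simp
  then show ?thesis using assms(4) by simp
qed

lemma weight_lie:
  assumes "weight_vector \<alpha> x" "weight_vector \<beta> y"
  shows "weight_vector (\<lambda>t. \<alpha> t + \<beta> t) (lie x y)"
  unfolding weight_vector_def
proof
  fix t assume "t \<in> h"
  then show "lie t (lie x y) = (\<alpha> t + \<beta> t) *\<^sub>C lie x y"
    using assms by (subst lie_derivation)
      (simp add: weight_vector_def lie_scale_left lie_scale_right scaleC_add_left)
qed

text \<open>A weight vector whose weight is nonzero somewhere on \<open>h\<close> is orthogonal to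
  \<open>h\<close>; every other one lies in \<open>h\<close>, because \<open>h\<close> is its own
  centralizer. Hence a vector of \<open>h\<close> orthogonal to \<open>h\<close> is orthogonal to
  all weight vectors, and these span.\<close>

lemma h_nondegenerate:
  assumes "s \<in> h" "\<And>t. t \<in> h \<Longrightarrow> \<kappa> s t = 0" shows "s = 0"
proof (rule nondegenerate_weight)
  fix \<alpha> y assume y: "weight_vector \<alpha> y"
  show "\<kappa> s y = 0"
  proof (cases "\<exists>t\<in>h. \<alpha> t \<noteq> 0")
    case True
    then show ?thesis
      using weight_orthogonal[OF weight_vector_h[OF assms(1)] y] by auto
  next
    case False
    then have "y \<in> h" using y by (intro h_centralizer) (auto simp: weight_vector_def)
    then show ?thesis using assms(2) by blast
  qed
qed

abbreviation "R \<equiv> roots lie h"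

lemma rootI:
  assumes "weight_vector \<alpha> x" "x \<noteq> 0" "t \<in> h" "\<alpha> t \<noteq> 0" "\<And>t. t \<notin> h \<Longrightarrow> \<alpha> t = 0"
  shows "\<alpha> \<in> R"
  using assms root_space_iff[of x \<alpha>] unfolding roots_def by auto

lemma weight_vector_0: "weight_vector \<alpha> 0"
  by (simp add: weight_vector_def lie_0_right)

lemma rootD:
  assumes "\<alpha> \<in> R"
  obtains x t where "weight_vector \<alpha> x" "x \<noteq> 0" "t \<in> h" "\<alpha> t \<noteq> 0"
proof -
  from assms have "root_space lie h \<alpha> \<noteq> {0}" and t: "\<exists>t\<in>h. \<alpha> t \<noteq> 0"
    by (auto simp: roots_def)
  moreover have "0 \<in> root_space lie h \<alpha>"
    by (simp add: root_space_iff weight_vector_0)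
  ultimately obtain x where "x \<in> root_space lie h \<alpha>" "x \<noteq> 0" by blast
  then show thesis using that t by (auto simp: root_space_iff)
qed

lemma root_outside: "\<alpha> \<in> R \<Longrightarrow> t \<notin> h \<Longrightarrow> \<alpha> t = 0"
  by (auto simp: roots_def)

text \<open>By nondegeneracy some weight vector is not orthogonal to \<open>x\<close>;
  \<open>weight_orthogonal\<close> forces its weight to be the opposite one, and rescaling
  normalizes the pairing.\<close>

lemma dual_weight_vector:
  assumes x: "weight_vector \<alpha> x" "x \<noteq> 0"
  obtains y where "weight_vector (\<lambda>t. - \<alpha> t) y" "\<kappa> x y = 1"
proof -
  obtain \<beta> y where y: "weight_vector \<beta> y" "\<kappa> x y \<noteq> 0"
    using nondegenerate_weight[of x] x by blast
  then have "\<forall>t\<in>h. \<alpha> t + \<beta> t = 0" using weight_orthogonal[OF x(1) y(1)] by blast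
  then have "\<forall>t\<in>h. \<beta> t = - \<alpha> t" by (simp add: eq_neg_iff_add_eq_0 add.commute)
  then have "weight_vector (\<lambda>t. - \<alpha> t) ((1 / \<kappa> x y) *\<^sub>C y)"
    using y(1) by (simp add: weight_vector_def lie_scale_right scaleC_scaleC mult.commute)
  moreover have "\<kappa> x ((1 / \<kappa> x y) *\<^sub>C y) = 1" using y by (simp add: kappa_scale_right)
  ultimately show thesis using that by blast
qed

text \<open>One vector of weight \<open>\<alpha>\<close> and one of the opposite weight, paired to
  1. Once root spaces are known to be one-dimensional, these vectors serve as dual bases of the root
  part, in which the Casimir operator is expanded.\<close>

definition dual_pair :: "('g \<Rightarrow> complex) \<Rightarrow> 'g \<times> 'g" where
  "dual_pair \<alpha> = (SOME (x, y). weight_vector \<alpha> x \<and> weight_vector (\<lambda>t. - \<alpha> t) y \<and> \<kappa> x y = 1)"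

definition "root_vec \<alpha> = fst (dual_pair \<alpha>)"
definition "dual_vec \<alpha> = snd (dual_pair \<alpha>)"
text \<open>This is the element of \<open>h\<close> that represents \<open>\<alpha>\<close> under
  \<open>\<kappa>\<close>, so \<open>\<alpha> (root_elt \<alpha>)\<close> is the squared length of
  \<open>\<alpha>\<close>.\<close>

definition "root_elt \<alpha> = lie (root_vec \<alpha>) (dual_vec \<alpha>)"

lemma dual_pair:
  assumes "\<alpha> \<in> R"
  shows "weight_vector \<alpha> (root_vec \<alpha>)" "weight_vector (\<lambda>t. - \<alpha> t) (dual_vec \<alpha>)" "\<kappa> (root_vec \<alpha>) (dual_vec \<alpha>) = 1"
proof -
  obtain x where "weight_vector \<alpha> x" "x \<noteq> 0" using rootD[OF assms] by blast
  then obtain y where "weight_vector (\<lambda>t. - \<alpha> t) y" "\<kappa> x y = 1"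
    using dual_weight_vector by blast
  with \<open>weight_vector \<alpha> x\<close>
  have "\<exists>p. case p of (x, y) \<Rightarrow> weight_vector \<alpha> x \<and> weight_vector (\<lambda>t. - \<alpha> t) y \<and> \<kappa> x y = 1"
    by blast
  from someI_ex[OF this]
  show "weight_vector \<alpha> (root_vec \<alpha>)" "weight_vector (\<lambda>t. - \<alpha> t) (dual_vec \<alpha>)" "\<kappa> (root_vec \<alpha>) (dual_vec \<alpha>) = 1"
    unfolding root_vec_def dual_vec_def dual_pair_def by (auto split: prod.splits)
qed

lemma lie_opposite_in_h:
  assumes "weight_vector \<alpha> x" "weight_vector (\<lambda>t. - \<alpha> t) y"
  shows "lie x y \<in> h"
  using weight_lie[OF assms] by (intro h_centralizer) (simp add: weight_vector_def)

lemma kappa_lie_opposite: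
  assumes "weight_vector (\<lambda>t. - \<alpha> t) y" "s \<in> h"
  shows "\<kappa> (lie x y) s = \<kappa> x y * \<alpha> s"
proof -
  have "lie y s = \<alpha> s *\<^sub>C y"
    using assms lie_anti[of y s] by (simp add: weight_vector_def)
  then show ?thesis by (simp add: kappa_inv kappa_scale_right)
qed

lemma root_elt:
  assumes "\<alpha> \<in> R"
  shows "root_elt \<alpha> \<in> h" "s \<in> h \<Longrightarrow> \<kappa> (root_elt \<alpha>) s = \<alpha> s"
  unfolding root_elt_def using dual_pair[OF assms] lie_opposite_in_h kappa_lie_opposite by auto

text \<open>Both sides lie in \<open>h\<close> and have the same pairing with every element of
  \<open>h\<close>.\<close>

lemma lie_opposite:
  assumes \<alpha>: "\<alpha> \<in> R" and "weight_vector \<alpha> x" "weight_vector (\<lambda>t. - \<alpha> t) y"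
  shows "lie x y = \<kappa> x y *\<^sub>C root_elt \<alpha>"
proof -
  have *: "lie x y - \<kappa> x y *\<^sub>C root_elt \<alpha> \<in> h"
    using lie_opposite_in_h[OF assms(2,3)] root_elt(1)[OF \<alpha>] h_subspace
    by (simp add: complex_vector.subspace_diff complex_vector.subspace_scale)
  have "lie x y - \<kappa> x y *\<^sub>C root_elt \<alpha> = 0"
    by (rule h_nondegenerate[OF *])
      (simp add: kappa_diff_left kappa_scale_left root_elt(2)[OF \<alpha>] kappa_lie_opposite[OF assms(3)])
  then show ?thesis by simp
qed

lemma root_vec_ne_0: "\<alpha> \<in> R \<Longrightarrow> root_vec \<alpha> \<noteq> 0"
  using dual_pair(3) kappa_0_left by fastforce

lemma kappa_root_dual:
  assumes "\<alpha> \<in> R" "\<beta> \<in> R" "\<alpha> \<noteq> \<beta>" "weight_vector \<alpha> x"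
  shows "\<kappa> x (dual_vec \<beta>) = 0"
proof -
  obtain t where "\<alpha> t \<noteq> \<beta> t" using assms(3) by blast
  then have "t \<in> h" using root_outside assms(1,2) by metis
  then show ?thesis
    using weight_orthogonal[OF assms(4) dual_pair(2)[OF assms(2)]] \<open>\<alpha> t \<noteq> \<beta> t\<close> by simp
qed

text \<open>The functionals \<open>\<lambda>x. \<kappa> x (dual_vec \<alpha>)\<close> separate the
  vectors \<open>root_vec \<alpha>\<close>, which are therefore distinct and linearly independent in
  a finite-dimensional space.\<close>

lemma finite_roots: "finite R"
proof -
  have inj: "inj_on root_vec R"
  proof (rule inj_onI, rule ccontr)
    fix \<alpha> \<beta> assume *: "\<alpha> \<in> R" "\<beta> \<in> R" "root_vec \<alpha> = root_vec \<beta>" "\<alpha> \<noteq> \<beta>"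
    have "\<kappa> (root_vec \<alpha>) (dual_vec \<beta>) = 0" using kappa_root_dual[OF *(1,2,4) dual_pair(1)[OF *(1)]] .
    then show False using dual_pair(3)[OF *(2)] *(3) by simp
  qed
  have "complex_vector.independent (root_vec ` R)"
    unfolding complex_vector.independent_explicit_module
  proof (intro allI impI)
    fix t u v
    assume t: "finite t" "t \<subseteq> root_vec ` R" "(\<Sum>v\<in>t. u v *\<^sub>C v) = 0" "v \<in> t"
    then obtain \<alpha> where \<alpha>: "\<alpha> \<in> R" "v = root_vec \<alpha>" by blast
    have "0 = \<kappa> (\<Sum>v\<in>t. u v *\<^sub>C v) (dual_vec \<alpha>)" by (simp add: t(3) kappa_0_left)
    also have "\<dots> = (\<Sum>w\<in>t. if w = v then u w else 0)"
      unfolding kappa_sum_left kappa_scale_left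
    proof (rule sum.cong)
      fix w assume "w \<in> t"
      then obtain \<beta> where "\<beta> \<in> R" "w = root_vec \<beta>" using t(2) by blast
      then show "u w * \<kappa> w (dual_vec \<alpha>) = (if w = v then u w else 0)"
        using \<alpha> kappa_root_dual[of \<beta> \<alpha> w] dual_pair(1,3) by auto
    qed simp
    finally show "u v = 0" using t(1,4) by simp
  qed
  then have "finite (root_vec ` R)"
    using complex_vector.independent_span_bound[of "range X"] span_X by auto
  then show ?thesis using inj by (rule finite_imageD)
qed

text \<open>The weights of the \<open>w n\<close> are pairwise distinct, since
  \<open>c * \<alpha> s\<close> is nonzero for some \<open>s\<close> in \<open>h\<close>. If no
  \<open>w n\<close> vanished, they would give infinitely many roots.\<close>

lemma string_breaks_off:
  assumes \<alpha>: "\<alpha> \<in> R" and c: "c \<noteq> 0"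
    and w: "\<And>n::nat. weight_vector (\<lambda>s. \<beta> s + of_nat n * (c * \<alpha> s)) (w n)"
  shows "\<exists>n. w n = 0"
proof (rule ccontr)
  assume wn: "\<not> ?thesis"
  obtain s where s: "s \<in> h" "\<alpha> s \<noteq> 0" using rootD[OF \<alpha>] by blast
  \<comment> \<open>Roots vanish outside \<open>h\<close>, so the weights are cut off there. One of
    them may vanish on all of \<open>h\<close> and is then no root, which is why zero is adjoined in
    the inclusion below.\<close>
  define f where "f n = (\<lambda>r. if r \<in> h then \<beta> r + of_nat n * (c * \<alpha> r) else 0)" for n :: nat
  have "inj f"
  proof (rule injI)
    fix m n assume "f m = f n"
    then have "f m s = f n s" by simp
    then show "m = n" using s c by (simp add: f_def)
  qed
  moreover have "range f \<subseteq> insert (\<lambda>_. 0) R"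
  proof (rule image_subsetI)
    fix n
    show "f n \<in> insert (\<lambda>_. 0) R"
    proof (cases "\<forall>r. f n r = 0")
      case True
      then show ?thesis by auto
    next
      case False
      then obtain r where r: "f n r \<noteq> 0" by blast
      then have "r \<in> h" by (auto simp: f_def split: if_splits)
      moreover have "weight_vector (f n) (w n)"
        using w[of n] by (simp add: weight_vector_def f_def)
      ultimately have "f n \<in> R" using r wn by (intro rootI[where x = "w n"]) (auto simp: f_def)
      then show ?thesis by simp
    qed
  qed
  ultimately show False
    using finite_roots by (meson finite_insert finite_subset range_inj_infinite)
qed

text \<open>The usual argument for a highest weight vector of a three-dimensional subalgebra:
  applying \<open>y\<close> repeatedly to \<open>u\<close> and then \<open>x\<close> returns the
  previous vector times the factor in \<open>ne\<close>. If no factor vanishes, the string never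
  ends, against \<open>string_breaks_off\<close>.\<close>

lemma root_string:
  assumes \<alpha>: "\<alpha> \<in> R" and x: "weight_vector \<alpha> x" and y: "weight_vector (\<lambda>t. - \<alpha> t) y"
    and \<beta>: "weight_vector \<beta> u" and u: "u \<noteq> 0" "lie x u = 0"
    and ne: "\<And>n::nat. of_nat (Suc n) * (\<beta> (lie x y) - of_nat n / 2 * \<alpha> (lie x y)) \<noteq> 0"
  shows False
proof -
  define t where "t = lie x y"
  have t: "t \<in> h" unfolding t_def using x y by (rule lie_opposite_in_h)
  define w where "w n = (lie y ^^ n) u" for n
  have w: "weight_vector (\<lambda>s. \<beta> s - of_nat n * \<alpha> s) (w n)" for n
  proof (induction n)
    case 0
    then show ?case using \<beta> by (simp add: w_def)
  next
    case (Suc n)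
    have "w (Suc n) = lie y (w n)" by (simp add: w_def)
    then show ?case using weight_lie[OF y Suc] by (simp add: algebra_simps)
  qed
  \<comment> \<open>The factor is the closed form of the sum of
    \<open>\<beta> t - k * \<alpha> t\<close> over \<open>k\<close> from 0 to \<open>n\<close>, one
    summand for each commutation of \<open>x\<close> past a \<open>y\<close>.\<close>
  have xw: "lie x (w (Suc n)) = (of_nat (Suc n) * (\<beta> t - of_nat n / 2 * \<alpha> t)) *\<^sub>C w n" for n
  proof (induction n)
    case 0
    have "lie x (lie y u) = lie t u"
      by (subst lie_derivation) (simp add: u lie_0_right t_def)
    then show ?case using \<beta> t by (simp add: w_def weight_vector_def)
  next
    case (Suc n)
    have S: "w (Suc n) = lie y (w n)" for n by (simp add: w_def)
    have "lie x (w (Suc (Suc n))) = lie t (w (Suc n)) + lie y (lie x (w (Suc n)))"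
      by (subst S, subst lie_derivation) (simp add: t_def)
    also have "lie t (w (Suc n)) = (\<beta> t - of_nat (Suc n) * \<alpha> t) *\<^sub>C w (Suc n)"
      using w[of "Suc n"] t by (simp add: weight_vector_def)
    also have "lie y (lie x (w (Suc n))) = (of_nat (Suc n) * (\<beta> t - of_nat n / 2 * \<alpha> t)) *\<^sub>C w (Suc n)"
      by (subst Suc) (simp only: lie_scale_right S)
    finally have "lie x (w (Suc (Suc n))) = ((\<beta> t - of_nat (Suc n) * \<alpha> t) +
        of_nat (Suc n) * (\<beta> t - of_nat n / 2 * \<alpha> t)) *\<^sub>C w (Suc n)"
      by (simp only: scaleC_add_left)
    also have "(\<beta> t - of_nat (Suc n) * \<alpha> t) + of_nat (Suc n) * (\<beta> t - of_nat n / 2 * \<alpha> t)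
        = of_nat (Suc (Suc n)) * (\<beta> t - of_nat (Suc n) / 2 * \<alpha> t)"
      unfolding of_nat_Suc by (simp add: field_simps)
    finally show ?case .
  qed
  have wn: "w n \<noteq> 0" for n
  proof (induction n)
    case 0
    then show ?case using u by (simp add: w_def)
  next
    case (Suc n)
    have "lie x (w (Suc n)) \<noteq> 0"
      unfolding xw using ne[of n] Suc by (simp add: t_def)
    then show ?case using lie_0_right by auto
  qed
  show False using string_breaks_off[OF \<alpha>, of "- 1" \<beta> w] w wn by (auto simp: algebra_simps)
qed

text \<open>The raising string breaks off; its last nonzero vector is taken.\<close>

lemma string_top:
  assumes x: "weight_vector \<alpha> x" and y: "weight_vector (\<lambda>t. - \<alpha> t) y" and \<alpha>: "\<alpha> \<in> R"
    and v: "weight_vector \<beta> v" "v \<noteq> 0"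
  obtains u n where "weight_vector (\<lambda>t. \<beta> t + of_nat n * \<alpha> t) u" "u \<noteq> 0" "lie x u = 0"
proof -
  define w where "w n = (lie x ^^ n) v" for n
  have w: "weight_vector (\<lambda>s. \<beta> s + of_nat n * \<alpha> s) (w n)" for n
  proof (induction n)
    case 0
    then show ?case using v by (simp add: w_def)
  next
    case (Suc n)
    have "w (Suc n) = lie x (w n)" by (simp add: w_def)
    then show ?case using weight_lie[OF x Suc] by (simp add: algebra_simps)
  qed
  have "\<exists>n. w n = 0" using string_breaks_off[OF \<alpha>, of 1 \<beta> w] w by simp
  then obtain m where m: "w m = 0" "\<And>k. k < m \<Longrightarrow> w k \<noteq> 0"
    using exists_least_iff[of "\<lambda>n. w n = 0"] by blast
  moreover have "w 0 \<noteq> 0" using v by (simp add: w_def)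
  ultimately obtain n where n: "w (Suc n) = 0" "w n \<noteq> 0"
    by (metis lessI not0_implies_Suc)
  then show thesis using that[OF w[of n]] by (simp add: w_def)
qed


text \<open>If \<open>\<alpha>\<close> vanished on \<open>root_elt \<alpha>\<close>, the factors in
  \<open>root_string\<close> would be nonzero multiples of
  \<open>\<beta> (root_elt \<alpha>)\<close>, so every weight \<open>\<beta>\<close> would have to
  vanish there and \<open>root_elt \<alpha>\<close> would be central. The centre is an ideal, and it
  is not everything because the algebra is not abelian.\<close>

lemma root_not_isotropic:
  assumes \<alpha>: "\<alpha> \<in> R" shows "\<alpha> (root_elt \<alpha>) \<noteq> 0"
proof
  assume 0: "\<alpha> (root_elt \<alpha>) = 0"
  note dp = dual_pair[OF \<alpha>]
  have weight: "lie (root_elt \<alpha>) v = 0" if v: "weight_vector \<beta> v" for \<beta> v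
  proof (rule ccontr)
    assume *: "lie (root_elt \<alpha>) v \<noteq> 0"
    then have v0: "v \<noteq> 0" using lie_0_right by auto
    have \<beta>: "\<beta> (root_elt \<alpha>) \<noteq> 0" using * v root_elt(1)[OF \<alpha>] by (auto simp: weight_vector_def)
    obtain u n where "weight_vector (\<lambda>t. \<beta> t + of_nat n * \<alpha> t) u" "u \<noteq> 0" "lie (root_vec \<alpha>) u = 0"
      by (rule string_top[OF dp(1,2) \<alpha> v v0])
    from root_string[OF \<alpha> dp(1,2) this] show False
      using 0 \<beta> unfolding root_elt_def[symmetric] by (simp add: of_nat_neq_0 del: of_nat_Suc)
  qed
  have central: "lie (root_elt \<alpha>) x = 0" for x
    by (induction x rule: span_UNIV_induct[OF span_weight])
      (auto simp: lie_0_right lie_add_right lie_scale_right weight)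
  obtain s where "s \<in> h" "\<alpha> s \<noteq> 0" using rootD[OF \<alpha>] by blast
  then have "root_elt \<alpha> \<noteq> 0" using root_elt(2)[OF \<alpha>, of s] by (auto simp: kappa_0_left)
  define I where "I = {t. \<forall>x. lie t x = 0}"
  have "I = {0} \<or> I = UNIV"
  proof (rule no_ideals)
    show "complex_vector.subspace I"
      by (rule complex_vector.subspaceI)
        (auto simp: I_def lie_add_left lie_scale_left lie_0_left)
    show "lie x y \<in> I" if "y \<in> I" for x y
      using that lie_anti[of x y] by (simp add: I_def lie_0_left)
  qed
  then have "I = UNIV" using central \<open>root_elt \<alpha> \<noteq> 0\<close> by (auto simp: I_def)
  then show False using nonabelian by (auto simp: I_def)
qed

section \<open>One-dimensional root spaces and the projection to the Cartan subalgebra\<close>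

lemma dual_vec_ne_0: "\<alpha> \<in> R \<Longrightarrow> dual_vec \<alpha> \<noteq> 0"
  using dual_pair(3) kappa_0_right by fastforce

lemma neg_root:
  assumes "\<alpha> \<in> R" shows "(\<lambda>t. - \<alpha> t) \<in> R"
proof -
  obtain s where "s \<in> h" "\<alpha> s \<noteq> 0" using rootD[OF assms] by blast
  then show ?thesis
    using rootI[OF dual_pair(2)[OF assms] dual_vec_ne_0[OF assms]] root_outside[OF assms] by simp
qed

text \<open>The part \<open>z'\<close> of \<open>z\<close> orthogonal to
  \<open>dual_vec \<alpha>\<close> is annihilated by \<open>dual_vec \<alpha>\<close>. Now
  \<open>root_string\<close> is applied to the root \<open>- \<alpha>\<close>, with
  \<open>root_vec \<alpha>\<close> as the lowering vector: the factors are
  \<open>- (n + 1) * (n + 2) / 2\<close> times the squared length of \<open>\<alpha>\<close>, so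
  there would be nonzero vectors of all weights that are positive multiples of
  \<open>\<alpha>\<close>.\<close>

lemma root_space_one_dim:
  assumes \<alpha>: "\<alpha> \<in> R" and z: "weight_vector \<alpha> z"
  shows "z = \<kappa> z (dual_vec \<alpha>) *\<^sub>C root_vec \<alpha>"
proof (rule ccontr)
  note dp = dual_pair[OF \<alpha>]
  define z' where "z' = z - \<kappa> z (dual_vec \<alpha>) *\<^sub>C root_vec \<alpha>"
  assume "z \<noteq> \<kappa> z (dual_vec \<alpha>) *\<^sub>C root_vec \<alpha>"
  then have z0: "z' \<noteq> 0" by (simp add: z'_def)
  have w: "weight_vector \<alpha> z'"
    using z dp(1) unfolding z'_def weight_vector_def
    by (simp add: lie_diff_right lie_scale_right scaleC_diff_right
        scaleC_scaleC mult.commute)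
  have "\<kappa> z' (dual_vec \<alpha>) = 0" by (simp add: z'_def kappa_diff_left kappa_scale_left dp(3))
  then have "lie z' (dual_vec \<alpha>) = 0" using lie_opposite[OF \<alpha> w dp(2)] by simp
  then have 0: "lie (dual_vec \<alpha>) z' = 0" using lie_anti[of "dual_vec \<alpha>" z'] by simp
  have root_elt': "lie (dual_vec \<alpha>) (root_vec \<alpha>) = - root_elt \<alpha>" unfolding root_elt_def by (rule lie_anti)
  have "- root_elt \<alpha> \<in> h" using root_elt(1)[OF \<alpha>] h_subspace by (simp add: complex_vector.subspace_neg)
  then have neg: "\<alpha> (- root_elt \<alpha>) = - \<alpha> (root_elt \<alpha>)"
    using root_elt[OF \<alpha>] kappa_minus_right by metis
  show False
  proof (rule root_string[OF neg_root[OF \<alpha>] dp(2) _ w z0 0])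
    show "weight_vector (\<lambda>t. - (- \<alpha> t)) (root_vec \<alpha>)" using dp(1) by simp
    fix n :: nat
    have "\<alpha> (lie (dual_vec \<alpha>) (root_vec \<alpha>)) - of_nat n / 2 * - \<alpha> (lie (dual_vec \<alpha>) (root_vec \<alpha>))
      = - (of_nat (n + 2) / 2 * \<alpha> (root_elt \<alpha>))"
      unfolding root_elt' neg by (simp add: field_simps)
    then show "of_nat (Suc n) * (\<alpha> (lie (dual_vec \<alpha>) (root_vec \<alpha>))
      - of_nat n / 2 * - \<alpha> (lie (dual_vec \<alpha>) (root_vec \<alpha>))) \<noteq> 0"
      using root_not_isotropic[OF \<alpha>]
      by (simp only: mult_eq_0_iff neg_equal_0_iff_equal divide_eq_0_iff of_nat_eq_0_iff) auto
  qed
qed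

text \<open>The orthogonal projection to \<open>h\<close> along the root spaces; that it takes
  values in \<open>h\<close> is the content of \<open>cartan_proj_in_h\<close>.\<close>

definition cartan_proj :: "'g \<Rightarrow> 'g" where
  "cartan_proj x = x - (\<Sum>\<alpha>\<in>R. \<kappa> x (dual_vec \<alpha>) *\<^sub>C root_vec \<alpha>)"

lemma clinear_cartan_proj: "clinear cartan_proj"
  unfolding clinear_iff cartan_proj_def
  by (auto simp: kappa_add_left kappa_scale_left scaleC_add_left sum.distrib algebra_simps
      scaleC_diff_right scaleC_sum_right scaleC_scaleC)

lemma cartan_proj_root:
  assumes \<alpha>: "\<alpha> \<in> R" and x: "weight_vector \<alpha> x"
  shows "cartan_proj x = 0"
proof -
  have "(\<Sum>\<beta>\<in>R. \<kappa> x (dual_vec \<beta>) *\<^sub>C root_vec \<beta>) = (\<Sum>\<beta>\<in>R. if \<beta> = \<alpha> then x else 0)"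
    by (rule sum.cong) (auto simp: root_space_one_dim[OF \<alpha> x, symmetric]
        kappa_root_dual[OF \<alpha> _ _ x])
  also have "\<dots> = x" using \<alpha> by (simp add: finite_roots)
  finally show ?thesis by (simp add: cartan_proj_def)
qed

lemma kappa_h_dual:
  assumes "\<alpha> \<in> R" "s \<in> h" shows "\<kappa> s (dual_vec \<alpha>) = 0" "\<kappa> (root_vec \<alpha>) s = 0"
proof -
  obtain t where t: "t \<in> h" "\<alpha> t \<noteq> 0" using rootD[OF assms(1)] by blast
  show "\<kappa> s (dual_vec \<alpha>) = 0" "\<kappa> (root_vec \<alpha>) s = 0"
    using weight_orthogonal[OF weight_vector_h[OF assms(2)] dual_pair(2)[OF assms(1)] t(1)]
      weight_orthogonal[OF dual_pair(1)[OF assms(1)] weight_vector_h[OF assms(2)] t(1)] t(2)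
    by simp_all
qed

lemma cartan_proj_in_h: "cartan_proj x \<in> h"
proof (induction x rule: span_UNIV_induct[OF span_weight])
  case 1
  then show ?case
    using clinear_0[OF clinear_cartan_proj] h_subspace by (simp add: complex_vector.subspace_0)
next
  case (2 c x y)
  then obtain \<alpha> where \<alpha>: "weight_vector \<alpha> x" by blast
  have "cartan_proj x \<in> h"
  proof (cases "(\<exists>t\<in>h. \<alpha> t \<noteq> 0) \<and> x \<noteq> 0")
    case True
    then obtain t where t: "t \<in> h" "\<alpha> t \<noteq> 0" "x \<noteq> 0" by blast
    \<comment> \<open>A root has to vanish outside \<open>h\<close>, while the weight of
      \<open>x\<close> is only determined on \<open>h\<close>.\<close>
    define \<beta> where "\<beta> = (\<lambda>s. if s \<in> h then \<alpha> s else 0)"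
    have \<beta>: "weight_vector \<beta> x" using \<alpha> by (simp add: weight_vector_def \<beta>_def)
    have "\<beta> \<in> R" by (rule rootI[OF \<beta> t(3,1)]) (simp_all add: \<beta>_def t)
    then have "cartan_proj x = 0" using \<beta> by (rule cartan_proj_root)
    then show ?thesis using h_subspace by (simp add: complex_vector.subspace_0)
  next
    case False
    then have "x \<in> h"
      using \<alpha> by (intro h_centralizer) (auto simp: weight_vector_def lie_0_right)
    then show ?thesis by (simp add: cartan_proj_def kappa_h_dual)
  qed
  then show ?case
    using 2 h_subspace
    by (simp add: clinear_add[OF clinear_cartan_proj] clinear_scale[OF clinear_cartan_proj]
        complex_vector.subspace_add complex_vector.subspace_scale)
qed

lemma kappa_cartan_proj:
  assumes "s \<in> h" shows "\<kappa> s (cartan_proj x) = \<kappa> s x"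
proof -
  have "\<kappa> (cartan_proj x) s = \<kappa> x s"
    using assms by (simp add: cartan_proj_def kappa_diff_left kappa_sum_left kappa_scale_left
        kappa_h_dual)
  then show ?thesis by (simp only: kappa_sym[of s])
qed

lemma cartan_proj_decomp: "x = cartan_proj x + (\<Sum>\<alpha>\<in>R. \<kappa> x (dual_vec \<alpha>) *\<^sub>C root_vec \<alpha>)"
  by (simp add: cartan_proj_def)

section \<open>The Casimir operator of the adjoint representation\<close>

definition casimir :: "'g \<Rightarrow> 'g" where
  "casimir x = (\<Sum>a\<in>UNIV. lie (X a) (lie (X a) x))"

text \<open>Contracting the orthonormal basis with \<open>y\<close> reproduces \<open>y\<close>.
  This turns a sum over the basis into one over dual root vectors.\<close>

lemma sum_kappa_clinear:
  assumes "clinear F" shows "(\<Sum>a\<in>UNIV. \<kappa> (X a) y *\<^sub>C F (X a)) = F y"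
proof -
  have "F y = F (\<Sum>a\<in>UNIV. \<kappa> y (X a) *\<^sub>C X a)" by (simp only: expand[symmetric])
  then show ?thesis
    by (simp add: clinear_sum[OF assms] clinear_scale[OF assms] kappa_sym[of y])
qed

lemma clinear_lie_lie: "clinear F \<Longrightarrow> clinear (\<lambda>y. lie (F y) z)"
  "clinear F \<Longrightarrow> clinear (\<lambda>y. lie z (F y))"
  by (auto simp: clinear_iff lie_add_left lie_add_right lie_scale_left lie_scale_right)

text \<open>Each factor \<open>X a\<close> is split into its Cartan part and its root parts. A root
  part in the first factor contracts with the second factor to a dual pair. A Cartan part followed
  by a root part contributes nothing. Two Cartan parts act on \<open>v\<close> by scalars whose
  squares sum to the squared length of \<open>\<theta>\<close>.\<close>

lemma casimir_weight:
  assumes \<theta>: "\<theta> \<in> R" and v: "weight_vector \<theta> v"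
  shows "casimir v = \<theta> (root_elt \<theta>) *\<^sub>C v + (\<Sum>\<alpha>\<in>R. lie (root_vec \<alpha>) (lie (dual_vec \<alpha>) v))"
proof -
  have "casimir v = (\<Sum>a\<in>UNIV. lie (cartan_proj (X a)) (lie (X a) v) +
      (\<Sum>\<alpha>\<in>R. \<kappa> (X a) (dual_vec \<alpha>) *\<^sub>C lie (root_vec \<alpha>) (lie (X a) v)))"
    unfolding casimir_def
  proof (rule sum.cong[OF refl])
    fix a
    show "lie (X a) (lie (X a) v) = lie (cartan_proj (X a)) (lie (X a) v) +
      (\<Sum>\<alpha>\<in>R. \<kappa> (X a) (dual_vec \<alpha>) *\<^sub>C lie (root_vec \<alpha>) (lie (X a) v))"
      by (subst (1) cartan_proj_decomp[of "X a"])
        (simp add: lie_add_left lie_sum_left lie_scale_left)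
  qed
  also have "\<dots> = (\<Sum>a\<in>UNIV. lie (cartan_proj (X a)) (lie (X a) v)) +
      (\<Sum>\<alpha>\<in>R. \<Sum>a\<in>UNIV. \<kappa> (X a) (dual_vec \<alpha>) *\<^sub>C lie (root_vec \<alpha>) (lie (X a) v))"
    unfolding sum.distrib by (subst sum.swap) simp
  also have "(\<Sum>\<alpha>\<in>R. \<Sum>a\<in>UNIV. \<kappa> (X a) (dual_vec \<alpha>) *\<^sub>C lie (root_vec \<alpha>) (lie (X a) v)) =
      (\<Sum>\<alpha>\<in>R. lie (root_vec \<alpha>) (lie (dual_vec \<alpha>) v))"
    by (rule sum.cong[OF refl], rule sum_kappa_clinear)
      (intro clinear_lie_lie linear_left)
  also have "(\<Sum>a\<in>UNIV. lie (cartan_proj (X a)) (lie (X a) v)) =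
     (\<Sum>a\<in>UNIV. lie (cartan_proj (X a)) (lie (cartan_proj (X a)) v) +
      (\<Sum>\<alpha>\<in>R. \<kappa> (X a) (dual_vec \<alpha>) *\<^sub>C lie (cartan_proj (X a)) (lie (root_vec \<alpha>) v)))"
  proof (rule sum.cong[OF refl])
    fix a
    have "lie (X a) v = lie (cartan_proj (X a)) v +
        (\<Sum>\<alpha>\<in>R. \<kappa> (X a) (dual_vec \<alpha>) *\<^sub>C lie (root_vec \<alpha>) v)"
      by (subst (1) cartan_proj_decomp[of "X a"])
        (simp add: lie_add_left lie_sum_left lie_scale_left)
    then show "lie (cartan_proj (X a)) (lie (X a) v) =
      lie (cartan_proj (X a)) (lie (cartan_proj (X a)) v) +
      (\<Sum>\<alpha>\<in>R. \<kappa> (X a) (dual_vec \<alpha>) *\<^sub>C lie (cartan_proj (X a)) (lie (root_vec \<alpha>) v))"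
      by (simp add: lie_add_right lie_sum_right lie_scale_right)
  qed
  also have "\<dots> = (\<Sum>a\<in>UNIV. lie (cartan_proj (X a)) (lie (cartan_proj (X a)) v)) +
      (\<Sum>\<alpha>\<in>R. \<Sum>a\<in>UNIV. \<kappa> (X a) (dual_vec \<alpha>) *\<^sub>C lie (cartan_proj (X a)) (lie (root_vec \<alpha>) v))"
    unfolding sum.distrib by (subst sum.swap) simp
  also have "(\<Sum>\<alpha>\<in>R. \<Sum>a\<in>UNIV. \<kappa> (X a) (dual_vec \<alpha>) *\<^sub>C lie (cartan_proj (X a)) (lie (root_vec \<alpha>) v)) =
      (\<Sum>\<alpha>\<in>R. lie (cartan_proj (dual_vec \<alpha>)) (lie (root_vec \<alpha>) v))"
    by (rule sum.cong[OF refl], rule sum_kappa_clinear)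
      (intro clinear_lie_lie clinear_cartan_proj)
  \<comment> \<open>The contraction has put \<open>dual_vec \<alpha>\<close> into
    \<open>cartan_proj\<close>, which kills it because it is a weight vector for the root
    \<open>- \<alpha>\<close>.\<close>
  also have "\<dots> = 0"
    by (rule sum.neutral)
      (metis cartan_proj_root dual_pair(2) lie_0_left neg_root)
  also have "(\<Sum>a\<in>UNIV. lie (cartan_proj (X a)) (lie (cartan_proj (X a)) v)) =
      (\<Sum>a\<in>UNIV. (\<kappa> (root_elt \<theta>) (X a) * \<kappa> (root_elt \<theta>) (X a)) *\<^sub>C v)"
  proof (rule sum.cong[OF refl])
    fix a
    have "lie (cartan_proj (X a)) v = \<kappa> (root_elt \<theta>) (X a) *\<^sub>C v"
      using v cartan_proj_in_h root_elt[OF \<theta>] kappa_cartan_proj[of "root_elt \<theta>" "X a"]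
      by (simp add: weight_vector_def)
    then show "lie (cartan_proj (X a)) (lie (cartan_proj (X a)) v) =
        (\<kappa> (root_elt \<theta>) (X a) * \<kappa> (root_elt \<theta>) (X a)) *\<^sub>C v"
      by (simp add: lie_scale_right scaleC_scaleC)
  qed
  also have "\<dots> = (\<Sum>a\<in>UNIV. \<kappa> (root_elt \<theta>) (X a) * \<kappa> (root_elt \<theta>) (X a)) *\<^sub>C v"
    by (simp add: scaleC_sum_left)
  also have "(\<Sum>a\<in>UNIV. \<kappa> (root_elt \<theta>) (X a) * \<kappa> (root_elt \<theta>) (X a)) = \<kappa> (root_elt \<theta>) (root_elt \<theta>)"
    by (subst (3) expand[of "root_elt \<theta>"])
      (simp add: kappa_sum_left kappa_scale_left kappa_sym[of "X _"])
  also have "\<kappa> (root_elt \<theta>) (root_elt \<theta>) = \<theta> (root_elt \<theta>)" using root_elt[OF \<theta>] by simp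
  finally show ?thesis by simp
qed

text \<open>By invariance, \<open>lie y\<close> acts on the orthonormal basis by an antisymmetric
  matrix \<open>k\<close>. The two sums in which it hits a factor \<open>X a\<close> therefore
  cancel.\<close>

lemma casimir_derivation: "lie y (casimir x) = casimir (lie y x)"
proof -
  define k where "k a b = \<kappa> (lie y (X a)) (X b)" for a b
  have anti: "k a b = - k b a" for a b
  proof -
    have "k a b = - \<kappa> (lie (X a) y) (X b)"
      unfolding k_def by (subst lie_anti) (rule kappa_minus_left)
    also have "\<kappa> (lie (X a) y) (X b) = k b a" unfolding k_def
      by (subst kappa_inv) (rule kappa_sym)
    finally show ?thesis .
  qed
  have yX: "lie y (X a) = (\<Sum>b\<in>UNIV. k a b *\<^sub>C X b)" for a
    unfolding k_def by (rule expand)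
  have "lie y (casimir x) = (\<Sum>a\<in>UNIV. lie (lie y (X a)) (lie (X a) x) +
      lie (X a) (lie (lie y (X a)) x) + lie (X a) (lie (X a) (lie y x)))"
    unfolding casimir_def lie_sum_right
    by (rule sum.cong[OF refl])
      (subst lie_derivation, subst (2) lie_derivation, simp add: lie_add_right add.assoc)
  also have "\<dots> = (\<Sum>a\<in>UNIV. \<Sum>b\<in>UNIV. k a b *\<^sub>C lie (X b) (lie (X a) x))
      + (\<Sum>a\<in>UNIV. \<Sum>b\<in>UNIV. k a b *\<^sub>C lie (X a) (lie (X b) x)) + casimir (lie y x)"
    unfolding sum.distrib casimir_def yX
    by (simp add: lie_sum_left lie_sum_right lie_scale_left lie_scale_right)
  also have "(\<Sum>a\<in>UNIV. \<Sum>b\<in>UNIV. k a b *\<^sub>C lie (X b) (lie (X a) x)) =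
      (\<Sum>a\<in>UNIV. \<Sum>b\<in>UNIV. k b a *\<^sub>C lie (X a) (lie (X b) x))"
    by (rule sum.swap)
  also have "\<dots> = - (\<Sum>a\<in>UNIV. \<Sum>b\<in>UNIV. k a b *\<^sub>C lie (X a) (lie (X b) x))"
    unfolding sum_negf[symmetric] by (intro sum.cong refl) (subst anti, simp)
  finally show ?thesis by simp
qed

text \<open>Since the Casimir operator commutes with the adjoint action, its eigenspace is an
  ideal.\<close>

lemma casimir_scalar:
  assumes v: "v \<noteq> 0" "casimir v = c *\<^sub>C v"
  shows "casimir x = c *\<^sub>C x"
proof -
  define I where "I = {x. casimir x = c *\<^sub>C x}"
  have "I = {0} \<or> I = UNIV"
  proof (rule no_ideals)
    show "complex_vector.subspace I"
      by (rule complex_vector.subspaceI)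
        (auto simp: I_def casimir_def lie_add_right lie_scale_right lie_0_right sum.distrib
          scaleC_add_right scaleC_sum_right[symmetric] scaleC_scaleC mult.commute)
    show "lie x y \<in> I" if "y \<in> I" for x y
      using that unfolding I_def mem_Collect_eq casimir_derivation[symmetric]
      by (simp add: lie_scale_right)
  qed
  then show ?thesis using v by (auto simp: I_def)
qed

section \<open>The Casimir operator at the highest root vector\<close>

context
  fixes P \<theta>
  assumes positive: "positive_system lie h P" and highest: "highest_root lie h P \<theta>"
begin

lemma highest_root_in_roots: "\<theta> \<in> R"
  using highest by (simp add: highest_root_def)

lemma positive_subset: "P \<subseteq> R"
  using positive by (auto simp: positive_system_def)

lemma positive_or_negative:
  assumes "\<alpha> \<in> R" "\<alpha> \<notin> P" shows "(\<lambda>t. - \<alpha> t) \<in> P"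
  using positive neg_root[OF assms(1)] assms
  unfolding positive_system_def by (auto simp: complex_is_Real_iff complex_eq_iff)

text \<open>Evaluated at the element \<open>\<gamma>\<close> that defines positivity, no root
  exceeds \<open>\<theta>\<close>, so \<open>\<alpha> + \<theta>\<close> is not a root. It cannot
  vanish on \<open>h\<close> either, because then \<open>\<theta> = - \<alpha>\<close> would lie
  below \<open>\<alpha>\<close> at \<open>\<gamma>\<close>.\<close>

lemma lie_positive_highest:
  assumes \<alpha>: "\<alpha> \<in> P" and x: "weight_vector \<alpha> x" and v: "weight_vector \<theta> v"
  shows "lie x v = 0"
proof (rule ccontr)
  assume ne: "lie x v \<noteq> 0"
  obtain \<gamma> where \<gamma>: "\<gamma> \<in> h" "\<And>\<beta>. \<beta> \<in> P \<Longrightarrow> 0 < Re (\<beta> \<gamma>)"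
    using positive unfolding positive_system_def by auto
  have nonneg: "0 \<le> Re (\<theta> \<gamma> - \<beta> \<gamma>)" if "\<beta> \<in> R" for \<beta>
  proof -
    from highest that have "\<exists>k :: ('g \<Rightarrow> complex) \<Rightarrow> nat.
        \<forall>t. \<theta> t - \<beta> t = (\<Sum>\<beta>\<in>P. of_nat (k \<beta>) * \<beta> t)"
      by (simp add: highest_root_def)
    then obtain k :: "('g \<Rightarrow> complex) \<Rightarrow> nat"
      where "\<forall>t. \<theta> t - \<beta> t = (\<Sum>\<beta>\<in>P. of_nat (k \<beta>) * \<beta> t)" ..
    then have "Re (\<theta> \<gamma> - \<beta> \<gamma>) = (\<Sum>\<beta>\<in>P. real (k \<beta>) * Re (\<beta> \<gamma>))" by (simp add: Re_sum)
    also have "\<dots> \<ge> 0" using \<gamma>(2) by (intro sum_nonneg mult_nonneg_nonneg) (auto intro: less_imp_le)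
    finally show ?thesis .
  qed
  have \<alpha>R: "\<alpha> \<in> R" using \<alpha> positive_subset by blast
  define \<beta> where "\<beta> = (\<lambda>t. \<alpha> t + \<theta> t)"
  have w: "weight_vector \<beta> (lie x v)" unfolding \<beta>_def using x v by (rule weight_lie)
  show False
  proof (cases "\<exists>t\<in>h. \<beta> t \<noteq> 0")
    case True
    then obtain t where t: "t \<in> h" "\<beta> t \<noteq> 0" by blast
    have "\<beta> \<in> R"
      by (rule rootI[OF w ne t])
        (simp add: \<beta>_def root_outside[OF \<alpha>R] root_outside[OF highest_root_in_roots])
    then show False using nonneg[of \<beta>] \<gamma>(2)[OF \<alpha>] by (simp add: \<beta>_def)
  next
    case False
    then have "\<theta> \<gamma> = - \<alpha> \<gamma>" using \<gamma>(1) by (auto simp: \<beta>_def eq_neg_iff_add_eq_0 add.commute)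
    then show False using nonneg[OF \<alpha>R] \<gamma>(2)[OF \<alpha>] by simp
  qed
qed

text \<open>At a highest root vector \<open>v\<close> only positive \<open>\<alpha>\<close>
  contribute: \<open>root_vec \<alpha>\<close> kills \<open>v\<close>, so just the commutator
  \<open>root_elt \<alpha>\<close> is left, while for negative \<open>\<alpha>\<close> already
  \<open>dual_vec \<alpha>\<close> kills \<open>v\<close>. As \<open>\<theta>\<close> has squared
  length 2, its coroot is \<open>root_elt \<theta>\<close>, and the total 2 plus the sum of the
  values of the positive roots at the coroot is twice the dual Coxeter number.\<close>

lemma casimir_dual_coxeter_number:
  assumes len: "has_sq_length \<kappa> h \<theta> 2"
  shows "casimir x = (2 * dual_coxeter_number lie h P \<theta>) *\<^sub>C x"
proof -
  note \<theta> = highest_root_in_roots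
  obtain t where t: "t \<in> h" "\<And>s. s \<in> h \<Longrightarrow> \<kappa> t s = \<theta> s" "\<kappa> t t = 2"
    using len unfolding has_sq_length_def by blast
  have "t - root_elt \<theta> = 0"
    using t root_elt[OF \<theta>] h_subspace
    by (intro h_nondegenerate) (simp_all add: complex_vector.subspace_diff kappa_diff_left)
  then have t_eq: "t = root_elt \<theta>" by simp
  then have \<theta>2: "\<theta> (root_elt \<theta>) = 2" using t by simp
  have coroot: "coroot lie h \<theta> = root_elt \<theta>"
    unfolding coroot_def
  proof (rule the_equality)
    show "root_elt \<theta> \<in> complex_vector.span {lie x y |x y. x \<in> root_space lie h \<theta> \<and>
        y \<in> root_space lie h (\<lambda>s. - \<theta> s)} \<and> \<theta> (root_elt \<theta>) = 2"
      using dual_pair[OF \<theta>] \<theta>2 unfolding root_space_iff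
      by (intro conjI complex_vector.span_base) (auto simp: root_elt_def)
    fix s
    assume s: "s \<in> complex_vector.span {lie x y |x y. x \<in> root_space lie h \<theta> \<and>
        y \<in> root_space lie h (\<lambda>s. - \<theta> s)} \<and> \<theta> s = 2"
    \<comment> \<open>By \<open>lie_opposite\<close> all brackets of opposite root vectors lie on
      this line; the condition \<open>\<theta> s = 2\<close> then selects one point of it.\<close>
    have "s \<in> complex_vector.span {root_elt \<theta>}"
    proof (rule set_mp[OF complex_vector.span_minimal conjunct1[OF s]])
      show "{lie x y |x y. x \<in> root_space lie h \<theta> \<and> y \<in> root_space lie h (\<lambda>s. - \<theta> s)}
        \<subseteq> complex_vector.span {root_elt \<theta>}"
        unfolding root_space_iff using lie_opposite[OF \<theta>]
        by (auto simp: complex_vector.span_scale complex_vector.span_base)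
    qed simp
    then obtain c where c: "s = c *\<^sub>C root_elt \<theta>"
      by (auto simp: complex_vector.span_singleton)
    have "c *\<^sub>C root_elt \<theta> \<in> h" using root_elt(1)[OF \<theta>] h_subspace by (simp add: complex_vector.subspace_scale)
    then have "\<theta> s = c * 2"
      using root_elt[OF \<theta>] \<theta>2 unfolding c by (metis kappa_scale_right)
    then show "s = root_elt \<theta>" using s c by (simp add: scaleC_one)
  qed
  define v where "v = root_vec \<theta>"
  have v: "weight_vector \<theta> v" "v \<noteq> 0"
    unfolding v_def using dual_pair[OF \<theta>] root_vec_ne_0[OF \<theta>] by auto
  have "(\<Sum>\<alpha>\<in>R. lie (root_vec \<alpha>) (lie (dual_vec \<alpha>) v)) = (\<Sum>\<alpha>\<in>R. if \<alpha> \<in> P then \<alpha> (root_elt \<theta>) *\<^sub>C v else 0)"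
  proof (rule sum.cong[OF refl])
    fix \<alpha> assume \<alpha>: "\<alpha> \<in> R"
    show "lie (root_vec \<alpha>) (lie (dual_vec \<alpha>) v) = (if \<alpha> \<in> P then \<alpha> (root_elt \<theta>) *\<^sub>C v else 0)"
    proof (cases "\<alpha> \<in> P")
      case True
      have "lie (root_vec \<alpha>) (lie (dual_vec \<alpha>) v) = lie (root_elt \<alpha>) v"
        unfolding root_elt_def
        by (subst lie_derivation)
          (simp add: lie_positive_highest[OF True dual_pair(1)[OF \<alpha>] v(1)] lie_0_right)
      also have "\<dots> = \<theta> (root_elt \<alpha>) *\<^sub>C v"
        using v root_elt(1)[OF \<alpha>] by (simp add: weight_vector_def)
      also have "\<theta> (root_elt \<alpha>) = \<alpha> (root_elt \<theta>)"
        using root_elt[OF \<alpha>] root_elt[OF \<theta>] kappa_sym by metis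
      finally show ?thesis using True by simp
    next
      case False
      then show ?thesis
        using lie_positive_highest[OF positive_or_negative[OF \<alpha> False] dual_pair(2)[OF \<alpha>] v(1)]
        by (simp add: lie_0_right)
    qed
  qed
  also have "\<dots> = (\<Sum>\<alpha>\<in>P. \<alpha> (root_elt \<theta>)) *\<^sub>C v"
    using positive_subset finite_roots
    by (simp add: sum.If_cases scaleC_sum_left Int_absorb1)
  finally have "casimir v = (2 * dual_coxeter_number lie h P \<theta>) *\<^sub>C v"
    unfolding casimir_weight[OF \<theta> v(1)] \<theta>2 dual_coxeter_number_def coroot
    by (simp add: scaleC_add_left[symmetric])
  then show ?thesis using casimir_scalar v by blast
qed

end

end

text \<open>The matrix coefficient \<open>\<kappa> (casimir (X b)) (X d)\<close> is computed from
  the scalar \<open>2 * g\<close> and from the structure constants. On the diagonal the second value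
  is a sum of squares, not all zero in a nonabelian algebra; this gives the positivity that later
  makes \<open>\<l> + g\<close> nonzero.\<close>

lemma structure_constants_dual_coxeter:
  fixes lie :: "'g::complex_vector \<Rightarrow> 'g \<Rightarrow> 'g" and X :: "'i::finite \<Rightarrow> 'g"
  assumes "simple_lie_algebra lie" and "cartan_subalgebra lie h" and "positive_system lie h P"
    and "highest_root lie h P \<theta>" and nb: "normalized_basis lie h \<theta> X \<Gamma>"
  shows "(\<Sum>a\<in>UNIV. \<Sum>c\<in>UNIV. complex_of_real (\<Gamma> b a c * \<Gamma> d a c)) =
      (if b = d then 2 * dual_coxeter_number lie h P \<theta> else 0)"
    and "\<exists>q>0. dual_coxeter_number lie h P \<theta> = complex_of_real q"
proof -
  note nb' = nb[unfolded normalized_basis_def]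
  have "\<exists>\<kappa>. invariant_form lie \<kappa> \<and> has_sq_length \<kappa> h \<theta> 2 \<and>
      (\<forall>a b. \<kappa> (X a) (X b) = (if a = b then 1 else 0))"
    using nb' by (elim conjE)
  then obtain \<kappa> where \<kappa>: "invariant_form lie \<kappa>" "has_sq_length \<kappa> h \<theta> 2"
      "\<And>a b. \<kappa> (X a) (X b) = (if a = b then 1 else 0)" by blast
  have "\<forall>a b. lie (X a) (X b) = \<i> *\<^sub>C (\<Sum>c\<in>UNIV. of_real (\<Gamma> a b c) *\<^sub>C X c)"
    using nb' by (elim conjE)
  then have lieX: "lie (X a) (X b) = \<i> *\<^sub>C (\<Sum>c\<in>UNIV. of_real (\<Gamma> a b c) *\<^sub>C X c)" for a b
    by simp
  have anti: "\<forall>a b c. \<Gamma> a b c = - \<Gamma> b a c \<and> \<Gamma> a b c = - \<Gamma> a c b"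
    using nb' by (elim conjE)
  have span: "complex_vector.span (range X) = UNIV"
    using nb' by (elim conjE)
  interpret orthonormal_lie_algebra lie X \<kappa> h
    using assms(1,2) \<kappa> span
    by (simp add: orthonormal_lie_algebra_def orthonormal_lie_algebra_axioms_def)
  let ?g = "dual_coxeter_number lie h P \<theta>"
  have main: "(\<Sum>a\<in>UNIV. \<Sum>c\<in>UNIV. complex_of_real (\<Gamma> b a c * \<Gamma> d a c)) = (if b = d then 2 * ?g else 0)"
    for b d
  proof -
    have "\<kappa> (casimir (X b)) (X d) = (if b = d then 2 * ?g else 0)"
      by (simp add: casimir_dual_coxeter_number[OF assms(3,4) \<kappa>(2)] kappa_scale_left \<kappa>(3))
    moreover have "\<kappa> (casimir (X b)) (X d) = (\<Sum>a\<in>UNIV. \<Sum>c\<in>UNIV. complex_of_real (\<Gamma> b a c * \<Gamma> d a c))"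
      unfolding casimir_def kappa_sum_left
    proof (rule sum.cong[OF refl])
      fix a
      have "lie (X a) (lie (X a) (X b)) =
          - (\<Sum>c\<in>UNIV. of_real (\<Gamma> a b c) *\<^sub>C (\<Sum>e\<in>UNIV. of_real (\<Gamma> a c e) *\<^sub>C X e))"
      proof -
        define S where "S c = (\<Sum>e\<in>UNIV. of_real (\<Gamma> a c e) *\<^sub>C X e)" for c
        have "lie (X a) (lie (X a) (X b)) =
            \<i> *\<^sub>C (\<Sum>c\<in>UNIV. of_real (\<Gamma> a b c) *\<^sub>C \<i> *\<^sub>C S c)"
          by (simp only: lieX lie_scale_right lie_sum_right S_def)
        also have "(\<Sum>c\<in>UNIV. of_real (\<Gamma> a b c) *\<^sub>C \<i> *\<^sub>C S c) =
            \<i> *\<^sub>C (\<Sum>c\<in>UNIV. of_real (\<Gamma> a b c) *\<^sub>C S c)"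
          unfolding scaleC_sum_right
          by (rule sum.cong[OF refl]) (rule scaleC_left_commute)
        finally show ?thesis
          by (simp only: S_def scaleC_scaleC i_squared complex_vector.scale_minus_left scaleC_one)
      qed
      then have "\<kappa> (lie (X a) (lie (X a) (X b))) (X d) =
          - (\<Sum>c\<in>UNIV. of_real (\<Gamma> a b c) * (\<Sum>e\<in>UNIV. of_real (\<Gamma> a c e) * (if e = d then 1 else 0)))"
        by (simp add: kappa_minus_left kappa_sum_left kappa_scale_left \<kappa>(3))
      also have "\<dots> = (\<Sum>c\<in>UNIV. complex_of_real (- \<Gamma> a b c * \<Gamma> a c d))"
        by (simp add: sum_negf if_distrib cong: if_cong)
      also have "\<dots> = (\<Sum>c\<in>UNIV. complex_of_real (\<Gamma> b a c * \<Gamma> d a c))"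
      proof (rule sum.cong[OF refl])
        fix c
        have "\<Gamma> a c d = \<Gamma> d a c" using anti by (metis minus_minus)
        moreover have "- \<Gamma> a b c = \<Gamma> b a c" using anti by (metis minus_minus)
        ultimately show "complex_of_real (- \<Gamma> a b c * \<Gamma> a c d) = complex_of_real (\<Gamma> b a c * \<Gamma> d a c)"
          by simp
      qed
      finally show "\<kappa> (lie (X a) (lie (X a) (X b))) (X d) =
        (\<Sum>c\<in>UNIV. complex_of_real (\<Gamma> b a c * \<Gamma> d a c))" .
    qed
    ultimately show ?thesis by simp
  qed
  then show "(\<Sum>a\<in>UNIV. \<Sum>c\<in>UNIV. complex_of_real (\<Gamma> b a c * \<Gamma> d a c)) = (if b = d then 2 * ?g else 0)" .
  have "\<exists>a b c. \<Gamma> a b c \<noteq> 0"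
  proof (rule ccontr)
    assume "\<not> ?thesis"
    then have XX: "lie (X a) (X b) = 0" for a b by (simp add: lieX)
    have "lie (X a) y = 0" for a y
      by (induction y rule: span_UNIV_induct[OF span])
        (auto simp: XX lie_0_right lie_add_right lie_scale_right)
    then have "lie x y = 0" for x y
      by (induction x rule: span_UNIV_induct[OF span])
        (auto simp: lie_0_left lie_add_left lie_scale_left)
    then show False using nonabelian by blast
  qed
  then obtain b a c where ne: "\<Gamma> b a c \<noteq> 0" by blast
  \<comment> \<open>The contraction has the same value for every \<open>b\<close>, so a single
    nonzero structure constant suffices.\<close>
  define q where "q = (\<Sum>a\<in>UNIV. \<Sum>c\<in>UNIV. \<Gamma> b a c * \<Gamma> b a c) / 2"
  have "0 < \<Gamma> b a c * \<Gamma> b a c" using ne by (metis not_real_square_gt_zero)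
  also have "\<dots> \<le> (\<Sum>c\<in>UNIV. \<Gamma> b a c * \<Gamma> b a c)" by (rule member_le_sum) auto
  also have "\<dots> \<le> (\<Sum>a\<in>UNIV. \<Sum>c\<in>UNIV. \<Gamma> b a c * \<Gamma> b a c)"
    by (rule member_le_sum[where f = "\<lambda>a. \<Sum>c\<in>UNIV. \<Gamma> b a c * \<Gamma> b a c"]) (auto intro: sum_nonneg)
  finally have "q > 0" by (simp add: q_def)
  moreover have "?g = complex_of_real q" using main[of b b] by (simp add: q_def)
  ultimately show "\<exists>q>0. ?g = complex_of_real q" by blast
qed

section \<open>Formal calculus of modes\<close>

text \<open>A function \<open>F\<close> of two integers stands for \<open>F(z,w) = \<Sum> F l m z\<^sup>-\<^sup>l\<^sup>-\<^sup>1 w\<^sup>-\<^sup>m\<^sup>-\<^sup>1\<close>; multiplication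
  by \<open>z - w\<close> is \<open>zw_mult\<close>, and \<open>zw_pow n\<close> is multiplication by the expansion
  of \<open>(z - w)\<^sup>n\<close> in the domain \<open>|z| > |w|\<close>.\<close>

definition zw_mult :: "(int \<Rightarrow> int \<Rightarrow> 'h::complex_vector) \<Rightarrow> int \<Rightarrow> int \<Rightarrow> 'h" where
  "zw_mult F = (\<lambda>l m. F (l + 1) m - F l (m + 1))"

text \<open>The coefficient of \<open>z^(n-p) w^p\<close> in the expansion of
  \<open>(z - w)^n\<close>. The generalized binomial covers both signs of \<open>n\<close>, for
  which \<open>field_prod\<close> has separate formulas.\<close>

definition pow_coeff :: "int \<Rightarrow> nat \<Rightarrow> complex" where
  "pow_coeff n p = (- 1) ^ p * (of_int n gchoose p)"

definition zw_pow :: "int \<Rightarrow> (int \<Rightarrow> int \<Rightarrow> 'h::complex_vector) \<Rightarrow> int \<Rightarrow> int \<Rightarrow> 'h" where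
  "zw_pow n F = (\<lambda>l m. Sum_any (\<lambda>p. pow_coeff n p *\<^sub>C F (l + n - int p) (m + int p)))"

text \<open>This makes \<open>zw_pow\<close> a finite sum in each coefficient even for negative
  \<open>n\<close>. The bound must be uniform in \<open>l\<close>, since both indices vary with
  \<open>p\<close>.\<close>

definition right_bounded :: "(int \<Rightarrow> int \<Rightarrow> 'h::complex_vector) \<Rightarrow> bool" where
  "right_bounded F \<longleftrightarrow> (\<exists>M. \<forall>m\<ge>M. \<forall>l. F l m = 0)"

lemma pow_coeff_0: "pow_coeff n 0 = 1"
  by (simp add: pow_coeff_def)

lemma pow_coeff_pascal: "pow_coeff (n + 1) (Suc p) = pow_coeff n (Suc p) - pow_coeff n p"
  using gbinomial_Suc_Suc[of "of_int n :: complex" p]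
  by (simp add: pow_coeff_def algebra_simps)

text \<open>In coefficients, the differential equation \<open>(1 - x) f' = - n f\<close> of
  \<open>f = (1 - x)^n\<close>.\<close>

lemma pow_coeff_Suc: "of_nat (Suc p) * pow_coeff n (Suc p) = - (of_int n - of_nat p) * pow_coeff n p"
proof -
  have "(of_int n gchoose p) * (of_int n - of_nat p) = of_nat (Suc p) * (of_int n gchoose Suc p :: complex)"
    using gbinomial_mult_1'[of "of_int n :: complex" p] by (simp add: algebra_simps)
  then have *: "of_nat (Suc p) * (of_int n gchoose Suc p :: complex) =
      (of_int n gchoose p) * (of_int n - of_nat p)" ..
  have "of_nat (Suc p) * pow_coeff n (Suc p) = - ((- 1) ^ p * (of_nat (Suc p) * (of_int n gchoose Suc p)))"
    unfolding pow_coeff_def power_Suc by (simp del: of_nat_Suc)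
  also have "\<dots> = - (of_int n - of_nat p) * pow_coeff n p"
    unfolding * pow_coeff_def by (simp add: algebra_simps)
  finally show ?thesis .
qed

lemma pow_coeff_nonneg: "pow_coeff (int n) p = (- 1) ^ p * of_nat (n choose p)"
  by (simp add: pow_coeff_def binomial_gbinomial)

lemma pow_coeff_neg:
  assumes "n < 0" shows "pow_coeff n p = of_nat (nat (int p - n - 1) choose p)"
proof -
  have "(of_int n :: complex) gchoose p = (- 1) ^ p * ((of_nat p - of_int n - 1) gchoose p)"
    by (rule gbinomial_negated_upper)
  moreover have "of_nat p - of_int n - 1 = (of_nat (nat (int p - n - 1)) :: complex)"
    using assms by (simp add: of_nat_nat)
  ultimately show ?thesis
    by (simp add: pow_coeff_def binomial_gbinomial mult.assoc[symmetric] power_add[symmetric])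
qed

lemma zw_pow_eq_sum:
  assumes "\<And>l m. m \<ge> M \<Longrightarrow> F l m = 0" "m + int K \<ge> M"
  shows "zw_pow n F l m = (\<Sum>p<K. pow_coeff n p *\<^sub>C F (l + n - int p) (m + int p))"
  unfolding zw_pow_def
proof (rule Sum_any.expand_superset)
  show "{p. pow_coeff n p *\<^sub>C F (l + n - int p) (m + int p) \<noteq> 0} \<subseteq> {..<K}"
  proof
    fix p assume "p \<in> {p. pow_coeff n p *\<^sub>C F (l + n - int p) (m + int p) \<noteq> 0}"
    then have "\<not> m + int p \<ge> M" using assms(1) by auto
    then show "p \<in> {..<K}" using assms(2) by simp
  qed
qed simp

lemma zw_pow_vanish:
  assumes "\<And>l m. m \<ge> M \<Longrightarrow> F l m = 0" "m \<ge> M"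
  shows "zw_pow n F l m = 0"
  using zw_pow_eq_sum[of M F m 0] assms by simp

lemma right_boundedE:
  assumes "right_bounded F"
  obtains M where "\<And>l m. m \<ge> M \<Longrightarrow> F l m = 0"
  using assms unfolding right_bounded_def by blast

lemma right_bounded_diff:
  assumes "right_bounded F" "right_bounded G" shows "right_bounded (\<lambda>l m. F l m - G l m)"
proof -
  obtain M where M: "\<And>l m. m \<ge> M \<Longrightarrow> F l m = 0"
    using right_boundedE[OF assms(1)] by blast
  obtain N where N: "\<And>l m. m \<ge> N \<Longrightarrow> G l m = 0"
    using right_boundedE[OF assms(2)] by blast
  have "\<forall>m\<ge>max M N. \<forall>l. F l m - G l m = 0" using M N by simp
  then show ?thesis unfolding right_bounded_def by blast
qed

lemma right_bounded_linear:
  assumes "right_bounded F" "clinear f" shows "right_bounded (\<lambda>l m. f (F l m))"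
proof -
  obtain M where M: "\<And>l m. m \<ge> M \<Longrightarrow> F l m = 0"
    using right_boundedE[OF assms(1)] by blast
  have "\<forall>m\<ge>M. \<forall>l. f (F l m) = 0" using M by (simp add: clinear_0[OF assms(2)])
  then show ?thesis unfolding right_bounded_def by blast
qed

lemma right_bounded_shift:
  assumes "right_bounded F"
  shows "right_bounded (\<lambda>l m. F (l + 1) m)" "right_bounded (\<lambda>l m. F l (m + 1))"
proof -
  obtain M where "\<And>l m. m \<ge> M \<Longrightarrow> F l m = 0" using right_boundedE[OF assms] by blast
  then have "\<forall>m\<ge>M. \<forall>l. F (l + 1) m = 0" "\<forall>m\<ge>M. \<forall>l. F l (m + 1) = 0" by auto
  then show "right_bounded (\<lambda>l m. F (l + 1) m)" "right_bounded (\<lambda>l m. F l (m + 1))"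
    unfolding right_bounded_def by blast+
qed

lemma zw_pow_shift:
  "zw_pow n (\<lambda>l m. F (l + 1) m) l m = zw_pow n F (l + 1) m"
  "zw_pow n (\<lambda>l m. F l (m + 1)) l m = zw_pow n F l (m + 1)"
  by (simp_all add: zw_pow_def algebra_simps)

lemma zw_pow_diff:
  assumes "right_bounded F" "right_bounded G"
  shows "zw_pow n (\<lambda>l m. F l m - G l m) l m = zw_pow n F l m - zw_pow n G l m"
proof -
  obtain M where M: "\<And>l m. m \<ge> M \<Longrightarrow> F l m = 0"
    using right_boundedE[OF assms(1)] by blast
  obtain N where N: "\<And>l m. m \<ge> N \<Longrightarrow> G l m = 0"
    using right_boundedE[OF assms(2)] by blast
  define K where "K = nat (max M N - m)"
  have "zw_pow n F l m = (\<Sum>p<K. pow_coeff n p *\<^sub>C F (l + n - int p) (m + int p))"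
    "zw_pow n G l m = (\<Sum>p<K. pow_coeff n p *\<^sub>C G (l + n - int p) (m + int p))"
    "zw_pow n (\<lambda>l m. F l m - G l m) l m =
      (\<Sum>p<K. pow_coeff n p *\<^sub>C (F (l + n - int p) (m + int p) - G (l + n - int p) (m + int p)))"
    using M N by (auto intro!: zw_pow_eq_sum[of "max M N"] simp: K_def)
  then show ?thesis
    by (simp add: scaleC_diff_right sum_subtractf)
qed

lemma zw_pow_linear:
  assumes "right_bounded F" "clinear f"
  shows "zw_pow n (\<lambda>l m. f (F l m)) l m = f (zw_pow n F l m)"
proof -
  obtain M where M: "\<And>l m. m \<ge> M \<Longrightarrow> F l m = 0"
    using right_boundedE[OF assms(1)] by blast
  define K where "K = nat (M - m)"
  have "zw_pow n F l m = (\<Sum>p<K. pow_coeff n p *\<^sub>C F (l + n - int p) (m + int p))"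
    "zw_pow n (\<lambda>l m. f (F l m)) l m = (\<Sum>p<K. pow_coeff n p *\<^sub>C f (F (l + n - int p) (m + int p)))"
    using M by (auto intro!: zw_pow_eq_sum[of M] simp: K_def clinear_0[OF assms(2)])
  then show ?thesis by (simp add: clinear_sum[OF assms(2)] clinear_scale[OF assms(2)])
qed

lemma zw_pow_0: "right_bounded F \<Longrightarrow> zw_pow 0 F = F"
proof (intro ext)
  fix l m assume "right_bounded F"
  then obtain M where M: "\<And>l m. m \<ge> M \<Longrightarrow> F l m = 0"
    using right_boundedE by blast
  have "zw_pow 0 F l m = (\<Sum>p<Suc (nat (M - m)). pow_coeff 0 p *\<^sub>C F (l + 0 - int p) (m + int p))"
    using M by (intro zw_pow_eq_sum[of M]) auto
  also have "\<dots> = (\<Sum>p<Suc (nat (M - m)). if p = 0 then F l m else 0)"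
    by (rule sum.cong) (auto simp: pow_coeff_def gbinomial_0 gr0_conv_Suc)
  finally show "zw_pow 0 F l m = F l m" by simp
qed

text \<open>Pascal's rule: raising \<open>m\<close> instead of \<open>l\<close> amounts to passing
  from \<open>p\<close> to \<open>Suc p\<close> in the summands \<open>G\<close>.\<close>

lemma zw_mult_zw_pow:
  assumes "right_bounded F" shows "zw_mult (zw_pow n F) = zw_pow (n + 1) F"
proof (intro ext)
  fix l m
  obtain M where M: "\<And>l m. m \<ge> M \<Longrightarrow> F l m = 0"
    using right_boundedE[OF assms(1)] by blast
  define K where "K = nat (M - m)"
  define G where "G p = F (l + 1 + n - int p) (m + int p)" for p
  have "zw_pow n F (l + 1) m = (\<Sum>p<Suc K. pow_coeff n p *\<^sub>C G p)"
    unfolding G_def using M by (intro zw_pow_eq_sum[of M]) (auto simp: K_def)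
  moreover have "zw_pow n F l (m + 1) = (\<Sum>p<K. pow_coeff n p *\<^sub>C F (l + n - int p) (m + 1 + int p))"
    using M by (intro zw_pow_eq_sum[of M]) (auto simp: K_def)
  then have "zw_pow n F l (m + 1) = (\<Sum>p<K. pow_coeff n p *\<^sub>C G (Suc p))"
    by (simp add: G_def algebra_simps)
  moreover have "zw_pow (n + 1) F l m = (\<Sum>p<Suc K. pow_coeff (n + 1) p *\<^sub>C F (l + (n + 1) - int p) (m + int p))"
    using M by (intro zw_pow_eq_sum[of M]) (auto simp: K_def)
  then have "zw_pow (n + 1) F l m = (\<Sum>p<Suc K. pow_coeff (n + 1) p *\<^sub>C G p)"
    by (simp add: G_def algebra_simps del: sum.lessThan_Suc)
  ultimately show "zw_mult (zw_pow n F) l m = zw_pow (n + 1) F l m"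
    by (simp add: zw_mult_def sum.lessThan_Suc_shift pow_coeff_0 pow_coeff_pascal
        scaleC_diff_left sum_subtractf del: sum.lessThan_Suc)
qed

lemma zw_mult_zero: "(zw_mult ^^ k) (\<lambda>l m. 0) = (\<lambda>l m. 0)"
  by (induction k) (simp_all add: zw_mult_def)

lemma zw_mult_diff:
  "(zw_mult ^^ k) (\<lambda>l m. F l m - G l m) = (\<lambda>l m. (zw_mult ^^ k) F l m - (zw_mult ^^ k) G l m)"
  by (induction k) (simp_all add: zw_mult_def fun_eq_iff)

lemma zw_mult_add:
  "(zw_mult ^^ k) (\<lambda>l m. F l m + G l m) = (\<lambda>l m. (zw_mult ^^ k) F l m + (zw_mult ^^ k) G l m)"
  by (induction k) (simp_all add: zw_mult_def fun_eq_iff)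

lemma zw_mult_linear:
  "clinear f \<Longrightarrow> (zw_mult ^^ k) (\<lambda>l m. f (F l m)) = (\<lambda>l m. f ((zw_mult ^^ k) F l m))"
  by (induction k) (simp_all add: zw_mult_def fun_eq_iff clinear_diff)

lemma zw_mult_swap:
  "(zw_mult ^^ k) (\<lambda>m l. F l m) = (\<lambda>m l. (- 1) ^ k *\<^sub>C (zw_mult ^^ k) F l m)"
  by (induction k) (simp_all add: zw_mult_def fun_eq_iff scaleC_diff_right)

lemma zw_mult_mono:
  assumes "(zw_mult ^^ k) F = (\<lambda>l m. 0)" "k \<le> j" shows "(zw_mult ^^ j) F = (\<lambda>l m. 0)"
proof -
  have "(zw_mult ^^ (j - k + k)) F = (\<lambda>l m. 0)"
    unfolding funpow_add using assms by (simp add: zw_mult_zero)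
  then show ?thesis using assms(2) by simp
qed

text \<open>If \<open>z - w\<close> annihilates \<open>F\<close>, then \<open>F\<close> is constant
  along the lines \<open>l + m = const\<close>, and right boundedness makes it vanish far out on
  each of them. The formal delta function shows what boundedness excludes.\<close>

lemma zw_mult_cancel:
  assumes "right_bounded F" "(zw_mult ^^ k) F = (\<lambda>l m. 0)" shows "F = (\<lambda>l m. 0)"
proof -
  obtain M where M: "\<And>l m. m \<ge> M \<Longrightarrow> F l m = 0"
    using right_boundedE[OF assms(1)] by blast
  show ?thesis using assms(2) M
  proof (induction k arbitrary: F)
    case (Suc k)
    have zw: "zw_mult F = (\<lambda>l m. 0)"
    proof (rule Suc.IH)
      show "(zw_mult ^^ k) (zw_mult F) = (\<lambda>l m. 0)"
        using Suc.prems(1) by (simp only: funpow_Suc_right o_apply)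
      show "zw_mult F l m = 0" if "m \<ge> M" for l m
        using that by (simp add: zw_mult_def Suc.prems(2))
    qed
    have step: "F l m = F (l - 1) (m + 1)" for l m
    proof -
      have "zw_mult F (l - 1) m = 0"
        by (simp only: zw)
      then show ?thesis by (simp add: zw_mult_def)
    qed
    have "F l m = F (l - int j) (m + int j)" for j l m
    proof (induction j)
      case (Suc j)
      then show ?case using step[of "l - int j" "m + int j"] by (simp add: algebra_simps)
    qed simp
    then have "F l m = F (l - int (nat (M - m))) (m + int (nat (M - m)))" for l m .
    moreover have "F (l - int (nat (M - m))) (m + int (nat (M - m))) = 0" for l m
      by (rule Suc.prems(2)) simp
    ultimately show ?case by (intro ext) simp
  qed simp
qed

text \<open>The operator \<open>d/dz + d/dw\<close> in terms of modes.\<close>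

definition zw_deriv :: "(int \<Rightarrow> int \<Rightarrow> 'h::complex_vector) \<Rightarrow> int \<Rightarrow> int \<Rightarrow> 'h" where
  "zw_deriv F = (\<lambda>l m. of_int (- l) *\<^sub>C F (l - 1) m + of_int (- m) *\<^sub>C F l (m - 1))"

text \<open>\<open>d/dz + d/dw\<close> annihilates \<open>z - w\<close>, so it commutes with
  multiplication by powers of it.\<close>

lemma zw_pow_zw_deriv:
  assumes "right_bounded F" shows "zw_pow n (zw_deriv F) = zw_deriv (zw_pow n F)"
proof (intro ext)
  fix l m
  obtain M where M: "\<And>l m. m \<ge> M \<Longrightarrow> F l m = 0"
    using right_boundedE[OF assms(1)] by blast
  \<comment> \<open>The extra 1 is due to \<open>d/dw\<close>, which lowers the second index by one
    and so moves the bound of \<open>F\<close> from \<open>M\<close> to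
    \<open>M + 1\<close>.\<close>
  define K where "K = nat (M + 1 - m)"
  define G where "G p = F (l + n - int p) (m + int p - 1)" for p
  define c where "c = pow_coeff n"
  have G0: "G p = 0" if "p \<ge> K" for p
    unfolding G_def by (rule M) (use that in \<open>simp add: K_def\<close>)
  have GS: "F (l + n - int p - 1) (m + int p) = G (Suc p)" for p
    by (simp add: G_def algebra_simps)
  have "zw_pow n (zw_deriv F) l m = (\<Sum>p<K. c p *\<^sub>C zw_deriv F (l + n - int p) (m + int p))"
    unfolding c_def using M by (intro zw_pow_eq_sum[of "M + 1"]) (auto simp: K_def zw_deriv_def)
  also have "\<dots> = (\<Sum>p<K. (c p * of_int (- (l + n - int p))) *\<^sub>C G (Suc p) + (c p * of_int (- (m + int p))) *\<^sub>C G p)"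
    by (simp only: zw_deriv_def GS G_def[symmetric] scaleC_add_right scaleC_scaleC)
  also have "\<dots> = (\<Sum>p<K. (of_int (- l) * c p) *\<^sub>C G (Suc p)) + (\<Sum>p<K. (of_int (- m) * c p) *\<^sub>C G p)
     + ((\<Sum>p<K. (- (of_int n - of_nat p) * c p) *\<^sub>C G (Suc p)) - (\<Sum>p<K. (of_nat p * c p) *\<^sub>C G p))"
    unfolding sum.distrib[symmetric] sum_subtractf[symmetric]
    by (rule sum.cong[OF refl])
      (simp add: algebra_simps scaleC_diff_left scaleC_add_left)
  \<comment> \<open>As \<open>G K = 0\<close>, one more term may be added; the shift by
    \<open>Suc\<close> and \<open>pow_coeff_Suc\<close> then turn this sum into the one from which
    it is subtracted.\<close>
  also have "(\<Sum>p<K. (of_nat p * c p) *\<^sub>C G p) = (\<Sum>p<Suc K. (of_nat p * c p) *\<^sub>C G p)"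
    by (simp add: G0)
  also have "\<dots> = (\<Sum>p<K. (- (of_int n - of_nat p) * c p) *\<^sub>C G (Suc p))"
    unfolding sum.lessThan_Suc_shift c_def pow_coeff_Suc by simp
  also have "(\<Sum>p<K. (of_int (- l) * c p) *\<^sub>C G (Suc p)) = of_int (- l) *\<^sub>C zw_pow n F (l - 1) m"
  proof -
    have "zw_pow n F (l - 1) m = (\<Sum>p<K. c p *\<^sub>C F (l - 1 + n - int p) (m + int p))"
      unfolding c_def using M by (intro zw_pow_eq_sum[of "M + 1"]) (auto simp: K_def)
    then show ?thesis
      by (simp only: scaleC_sum_right scaleC_scaleC GS[symmetric]) (simp add: algebra_simps)
  qed
  also have "(\<Sum>p<K. (of_int (- m) * c p) *\<^sub>C G p) = of_int (- m) *\<^sub>C zw_pow n F l (m - 1)"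
  proof -
    have "zw_pow n F l (m - 1) = (\<Sum>p<K. c p *\<^sub>C F (l + n - int p) (m - 1 + int p))"
      unfolding c_def using M by (intro zw_pow_eq_sum[of M]) (auto simp: K_def)
    then show ?thesis
      by (simp only: scaleC_sum_right scaleC_scaleC G_def) (simp add: algebra_simps)
  qed
  finally show "zw_pow n (zw_deriv F) l m = zw_deriv (zw_pow n F) l m"
    by (simp add: zw_deriv_def)
qed

lemma zw_pow_int:
  "zw_pow (int k) F l m = (\<Sum>p\<le>k. pow_coeff (int k) p *\<^sub>C F (l + int k - int p) (m + int p))"
  unfolding zw_pow_def
proof (rule Sum_any.expand_superset)
  show "{p. pow_coeff (int k) p *\<^sub>C F (l + int k - int p) (m + int p) \<noteq> 0} \<subseteq> {..k}"
    by (auto simp: pow_coeff_nonneg binomial_eq_0 not_le intro: ccontr)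
qed simp


section \<open>Products of fields\<close>

definition is_field :: "'h::complex_vector modes \<Rightarrow> bool" where
  "is_field A \<longleftrightarrow> (\<forall>n. clinear (A n)) \<and> (\<forall>v. \<exists>M. \<forall>m\<ge>M. A m v = 0)"

definition mutually_local :: "'h::complex_vector modes \<Rightarrow> 'h modes \<Rightarrow> bool" where
  "mutually_local A B \<longleftrightarrow>
     (\<exists>N. \<forall>v. (zw_mult ^^ N) (\<lambda>l m. A l (B m v) - B m (A l v)) = (\<lambda>l m. 0))"

text \<open>The series \<open>(z - w)^n A(z)B(w) - (z - w)^n B(w)A(z)\<close>, with the power
  expanded for large \<open>z\<close> in the first term and for large \<open>w\<close> in the
  second. The sign comes from \<open>(z - w)^n = (-1)^n (w - z)^n\<close>. Its coefficient at
  \<open>l = 0\<close>, the residue in \<open>z\<close>, is the field \<open>A_nB\<close>.\<close>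

definition prod_kernel :: "'h::complex_vector modes \<Rightarrow> 'h modes \<Rightarrow> int \<Rightarrow> 'h \<Rightarrow> int \<Rightarrow> int \<Rightarrow> 'h" where
  "prod_kernel A B n v l m = zw_pow n (\<lambda>l m. A l (B m v)) l m
     - ((- 1) powi n) *\<^sub>C zw_pow n (\<lambda>m l. B m (A l v)) m l"

lemma is_field_linear: "is_field A \<Longrightarrow> clinear (A n)"
  by (simp add: is_field_def)

lemmas field_0 = clinear_0[OF is_field_linear]
lemmas field_add = clinear_add[OF is_field_linear]
lemmas field_diff = clinear_diff[OF is_field_linear]
lemmas field_scale = clinear_scale[OF is_field_linear]
lemmas field_minus = clinear_minus[OF is_field_linear]

lemma is_field_vanish:
  assumes "is_field A" obtains M where "\<And>m. m \<ge> M \<Longrightarrow> A m v = 0"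
  using assms unfolding is_field_def by blast

lemma right_bounded_prod:
  assumes "is_field A" "is_field B" shows "right_bounded (\<lambda>l m. A l (B m v))"
proof -
  obtain M where "\<And>m. m \<ge> M \<Longrightarrow> B m v = 0" using is_field_vanish[OF assms(2), of v] by blast
  then have "\<forall>m\<ge>M. \<forall>l. A l (B m v) = 0"
    by (simp add: field_0[OF assms(1)])
  then show ?thesis unfolding right_bounded_def by blast
qed

lemma field_prod_eq:
  assumes "is_field A" "is_field B"
  shows "field_prod 0 A B n m v = prod_kernel A B n v 0 m"
proof (cases "n \<ge> 0")
  case True
  then obtain k where n: "n = int k" by (metis nonneg_int_cases)
  \<comment> \<open>For nonnegative \<open>n\<close> the definition of the product lets both
    orderings run through the same modes, whereas the kernel expands the second one in powers of
    \<open>z\<close>. Reversing the summation matches them, and the resulting sign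
    \<open>(-1)^k\<close> cancels the one in \<open>prod_kernel\<close>.\<close>
  have "zw_pow n (\<lambda>m l. B m (A l v)) m 0 =
      (\<Sum>p\<le>k. pow_coeff n (k - p) *\<^sub>C B (m + int k - int (k - p)) (A (0 + int (k - p)) v))"
    unfolding n zw_pow_int
    by (rule sum.atLeastAtMost_rev[of _ 0 k, unfolded atLeast0AtMost, THEN trans])
       (simp add: n)
  also have "\<dots> = (\<Sum>p\<le>k. ((- 1) ^ k * pow_coeff n p) *\<^sub>C B (m + int p) (A (n - int p) v))"
  proof (rule sum.cong[OF refl])
    fix p assume "p \<in> {..k}"
    then have p: "p \<le> k" by simp
    have "(- 1 :: complex) ^ (k - p) = (- 1) ^ k * (- 1) ^ p"
      using p by (simp add: power_diff uminus_power_if)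
    then have "pow_coeff n (k - p) = (- 1) ^ k * pow_coeff n p"
      unfolding n pow_coeff_nonneg using p by (simp add: binomial_symmetric[symmetric])
    then show "pow_coeff n (k - p) *\<^sub>C B (m + int k - int (k - p)) (A (0 + int (k - p)) v)
      = ((- 1) ^ k * pow_coeff n p) *\<^sub>C B (m + int p) (A (n - int p) v)"
      using p by (simp add: n of_nat_diff)
  qed
  finally have "((- 1) powi n) *\<^sub>C zw_pow n (\<lambda>m l. B m (A l v)) m 0 =
      (\<Sum>p\<le>k. pow_coeff n p *\<^sub>C B (m + int p) (A (n - int p) v))"
    by (simp add: n scaleC_sum_right scaleC_scaleC mult.assoc[symmetric]
        power_mult_distrib[symmetric])
  then show ?thesis
    by (simp add: field_prod_def prod_kernel_def n zw_pow_int eps_sign_def pow_coeff_nonneg[symmetric]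
        scaleC_diff_right sum_subtractf)
next
  case False
  then have n: "n < 0" by simp
  obtain M where M: "\<And>m. m \<ge> M \<Longrightarrow> B m v = 0" using is_field_vanish[OF assms(2), of v] by blast
  obtain N where N: "\<And>m. m \<ge> N \<Longrightarrow> A m v = 0" using is_field_vanish[OF assms(1), of v] by blast
  note A0 = field_0[OF assms(1)]
  note B0 = field_0[OF assms(2)]
  define K where "K = max (nat (M - m)) (nat N)"
  have "zw_pow n (\<lambda>l m. A l (B m v)) 0 m =
      (\<Sum>p<K. pow_coeff n p *\<^sub>C A (0 + n - int p) (B (m + int p) v))"
    by (rule zw_pow_eq_sum[of M]) (auto simp: M A0 K_def)
  moreover have "zw_pow n (\<lambda>m l. B m (A l v)) m 0 =
      (\<Sum>p<K. pow_coeff n p *\<^sub>C B (m + n - int p) (A (0 + int p) v))"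
    by (rule zw_pow_eq_sum[of N]) (auto simp: N B0 K_def)
  moreover have "field_prod 0 A B n m v = (\<Sum>p<K. pow_coeff n p *\<^sub>C
      (A (n - int p) (B (m + int p) v) - ((- 1) powi n) *\<^sub>C B (m + n - int p) (A (int p) v)))"
  proof -
    have "field_prod 0 A B n m v = Sum_any (\<lambda>p. pow_coeff n p *\<^sub>C
        (A (n - int p) (B (m + int p) v) - ((- 1) powi n) *\<^sub>C B (m + n - int p) (A (int p) v)))"
      using n by (simp add: field_prod_def eps_sign_def pow_coeff_neg)
    also have "\<dots> = (\<Sum>p<K. pow_coeff n p *\<^sub>C
      (A (n - int p) (B (m + int p) v) - ((- 1) powi n) *\<^sub>C B (m + n - int p) (A (int p) v)))"
    proof (rule Sum_any.expand_superset)
      show "{p. pow_coeff n p *\<^sub>C (A (n - int p) (B (m + int p) v) -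
          ((- 1) powi n) *\<^sub>C B (m + n - int p) (A (int p) v)) \<noteq> 0} \<subseteq> {..<K}"
      proof (rule subsetI, rule ccontr)
        fix p assume p: "p \<in> {p. pow_coeff n p *\<^sub>C (A (n - int p) (B (m + int p) v) -
          ((- 1) powi n) *\<^sub>C B (m + n - int p) (A (int p) v)) \<noteq> 0}" "p \<notin> {..<K}"
        then have "m + int p \<ge> M" "int p \<ge> N" by (auto simp: K_def)
        then show False using p(1) by (simp add: M N A0 B0)
      qed
    qed simp
    finally show ?thesis .
  qed
  ultimately show ?thesis
    by (simp add: prod_kernel_def scaleC_diff_right sum_subtractf
        scaleC_sum_right scaleC_scaleC mult.commute)
qed

lemma zw_mult_prod_kernel:
  assumes "is_field A" "is_field B"
  shows "zw_mult (prod_kernel A B n v) = prod_kernel A B (n + 1) v"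
proof (intro ext)
  fix l m
  note 1 = zw_mult_zw_pow[OF right_bounded_prod[OF assms], of n v, symmetric]
  note 2 = zw_mult_zw_pow[OF right_bounded_prod[OF assms(2,1)], of n v, symmetric]
  have sgn: "(- 1) powi (n + 1) = - ((- 1 :: complex) powi n)" by (simp add: power_int_add_1)
  show "zw_mult (prod_kernel A B n v) l m = prod_kernel A B (n + 1) v l m"
    unfolding prod_kernel_def 1 2 sgn unfolding zw_mult_def
    by (simp add: scaleC_diff_right algebra_simps)
qed

lemma zw_mult_funpow_prod_kernel:
  assumes "is_field A" "is_field B"
  shows "(zw_mult ^^ k) (prod_kernel A B n v) = prod_kernel A B (n + int k) v"
  by (induction k) (simp_all add: zw_mult_prod_kernel[OF assms] algebra_simps)

lemma prod_kernel_nonneg: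
  assumes "is_field A" "is_field B"
  shows "prod_kernel A B (int k) v = (zw_mult ^^ k) (\<lambda>l m. A l (B m v) - B m (A l v))"
proof -
  have "prod_kernel A B 0 v = (\<lambda>l m. A l (B m v) - B m (A l v))"
    by (simp add: prod_kernel_def fun_eq_iff zw_pow_0[OF right_bounded_prod[OF assms]]
        zw_pow_0[OF right_bounded_prod[OF assms(2,1)]])
  then show ?thesis using zw_mult_funpow_prod_kernel[OF assms, of k 0 v] by simp
qed

text \<open>Each factor \<open>z - w\<close> raises the exponent \<open>n\<close> by one. Once it is
  nonnegative and at least \<open>N\<close>, the kernel is that power of \<open>z - w\<close> times
  the commutator, hence zero.\<close>

lemma prod_kernel_nilpotent:
  assumes "is_field A" "is_field B" "mutually_local A B"
  obtains R where "\<And>v. (zw_mult ^^ R) (prod_kernel A B n v) = (\<lambda>l m. 0)"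
proof -
  obtain N where N: "\<And>v. (zw_mult ^^ N) (\<lambda>l m. A l (B m v) - B m (A l v)) = (\<lambda>l m. 0)"
    using assms(3) unfolding mutually_local_def by blast
  define N' where "N' = max N (nat n)"
  have "(zw_mult ^^ nat (int N' - n)) (prod_kernel A B n v) = (\<lambda>l m. 0)" for v
  proof -
    have "n \<le> int (nat n)" by simp
    also have "\<dots> \<le> int N'" by (simp only: N'_def of_nat_le_iff max.cobounded2)
    finally have "n + int (nat (int N' - n)) = int N'" by simp
    then show ?thesis
      unfolding zw_mult_funpow_prod_kernel[OF assms(1,2)]
      by (simp only: prod_kernel_nonneg[OF assms(1,2)])
        (rule zw_mult_mono[OF N], simp add: N'_def)
  qed
  then show thesis using that by blast
qed

lemma prod_kernel_clinear:
  assumes "is_field A" "is_field B" shows "clinear (\<lambda>v. prod_kernel A B n v l m)"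
proof -
  have *: "clinear (\<lambda>v. zw_pow n (\<lambda>l m. A l (B m v)) l m)"
    if AB: "is_field A" "is_field B" for A B :: "'a modes" and l m
    unfolding clinear_iff
  proof (intro conjI allI)
    fix x y c
    note lA = is_field_linear[OF AB(1)] and lB = is_field_linear[OF AB(2)]
    have "zw_pow n (\<lambda>l m. A l (B m x)) l m =
        zw_pow n (\<lambda>l m. A l (B m (x + y)) - A l (B m y)) l m"
      by (simp add: clinear_add[OF lA] clinear_add[OF lB])
    also have "\<dots> = zw_pow n (\<lambda>l m. A l (B m (x + y))) l m - zw_pow n (\<lambda>l m. A l (B m y)) l m"
      by (intro zw_pow_diff right_bounded_prod AB)
    finally show "zw_pow n (\<lambda>l m. A l (B m (x + y))) l m =
        zw_pow n (\<lambda>l m. A l (B m x)) l m + zw_pow n (\<lambda>l m. A l (B m y)) l m" by simp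
    have "clinear (\<lambda>v. c *\<^sub>C (v::'a))"
      by (simp add: clinear_iff scaleC_add_right scaleC_scaleC mult.commute)
    then show "zw_pow n (\<lambda>l m. A l (B m (c *\<^sub>C x))) l m = c *\<^sub>C zw_pow n (\<lambda>l m. A l (B m x)) l m"
      using zw_pow_linear[OF right_bounded_prod[OF AB, of x], of "\<lambda>v. c *\<^sub>C v" n l m]
      by (simp add: clinear_scale[OF lA] clinear_scale[OF lB])
  qed
  from *[OF assms, of l m] *[OF assms(2,1), of m l] show ?thesis
    unfolding prod_kernel_def clinear_iff
    by (simp add: scaleC_add_right scaleC_diff_right scaleC_scaleC mult.commute)
qed

lemma is_field_prod:
  assumes "is_field A" "is_field B" shows "is_field (field_prod 0 A B n)"
  unfolding is_field_def
proof (intro conjI allI)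
  fix m
  have "field_prod 0 A B n m = (\<lambda>v. prod_kernel A B n v 0 m)"
    by (simp add: fun_eq_iff field_prod_eq[OF assms])
  then show "clinear (field_prod 0 A B n m)"
    using prod_kernel_clinear[OF assms, of n 0 m] by simp
next
  fix v
  obtain M where M: "\<And>m. m \<ge> M \<Longrightarrow> B m v = 0" using is_field_vanish[OF assms(2), of v] by blast
  obtain N where N: "\<And>m. m \<ge> N \<Longrightarrow> A m v = 0" using is_field_vanish[OF assms(1), of v] by blast
  note A0 = field_0[OF assms(1)]
  note B0 = field_0[OF assms(2)]
  have "\<forall>p. \<exists>M. \<forall>m\<ge>M. B m (A (int p) v) = 0"
    using assms(2) by (simp add: is_field_def)
  then obtain M' where M': "\<And>p m. m \<ge> M' p \<Longrightarrow> B m (A (int p) v) = 0" by metis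
  define K where "K = nat N"
  \<comment> \<open>For large \<open>m\<close> only the finitely many vectors \<open>A p v\<close>
    with \<open>p < K\<close> matter. The maximum bounds all their cutoffs, and \<open>K - n\<close>
    absorbs the shift in \<open>m + n - p\<close>.\<close>
  define Q where "Q = Max (insert 0 (M' ` {..<K})) + int K - n"
  have "field_prod 0 A B n m v = 0" if m: "m \<ge> max M Q" for m
  proof -
    have "zw_pow n (\<lambda>l m. A l (B m v)) 0 m = 0"
      by (rule zw_pow_vanish[of M]) (use m in \<open>auto simp: M A0\<close>)
    moreover have "zw_pow n (\<lambda>m l. B m (A l v)) m 0 =
        (\<Sum>p<K. pow_coeff n p *\<^sub>C B (m + n - int p) (A (0 + int p) v))"
      by (rule zw_pow_eq_sum[of N]) (auto simp: N B0 K_def)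
    moreover have "B (m + n - int p) (A (0 + int p) v) = 0" if "p < K" for p
    proof -
      have "M' p \<le> Max (insert 0 (M' ` {..<K}))" using that by (intro Max_ge) auto
      then have "m + n - int p \<ge> M' p" using m that unfolding Q_def by linarith
      then show ?thesis by (simp add: M')
    qed
    ultimately show ?thesis
      by (simp add: field_prod_eq[OF assms] prod_kernel_def)
  qed
  then show "\<exists>M. \<forall>m\<ge>M. field_prod 0 A B n m v = 0" by blast
qed


subsection \<open>Dong's lemma\<close>

text \<open>In the binomial expansion of \<open>(a - d)^(R + N)\<close> every term contains
  \<open>d^R\<close> or \<open>a^N\<close>. The induction on \<open>R + N\<close> replaces the
  expansion.\<close>

lemma binomial_annihilation:
  fixes a b d :: "'a::ab_group_add \<Rightarrow> 'a"
  assumes b: "\<And>x. b x = a x - d x" and ad: "\<And>x. a (d x) = d (a x)"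
    and add: "\<And>x y. a (x - y) = a x - a y" "\<And>x y. d (x - y) = d x - d y"
  shows "(d ^^ R) x = 0 \<Longrightarrow> (a ^^ N) x = 0 \<Longrightarrow> (b ^^ (R + N)) x = 0"
proof (induction "R + N" arbitrary: R N x)
  case 0
  then show ?case by simp
next
  case (Suc k)
  have a0: "a 0 = 0" and d0: "d 0 = 0" using add[of 0 0] by simp_all
  have b_diff: "b (x - y) = b x - b y" for x y by (simp add: b add algebra_simps)
  have bk_diff: "(b ^^ j) (x - y) = (b ^^ j) x - (b ^^ j) y" for j x y
    by (induction j) (simp_all add: b_diff)
  have b0: "(b ^^ j) 0 = 0" for j using bk_diff[of j 0 0] by simp
  have comm: "(d ^^ j) (a x) = a ((d ^^ j) x)" "(a ^^ j) (d x) = d ((a ^^ j) x)" for j x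
    by (induction j) (simp_all add: ad)
  show ?case
  proof (cases "R = 0 \<or> N = 0")
    case True
    then show ?thesis using Suc.prems b0 by auto
  next
    case False
    then obtain R' N' where RN: "R = Suc R'" "N = Suc N'" by (meson not0_implies_Suc)
    have 1: "(b ^^ (R + N')) (a x) = 0"
    proof (rule Suc.hyps(1))
      show "k = R + N'" using Suc.hyps(2) RN by simp
      show "(d ^^ R) (a x) = 0" by (simp add: comm Suc.prems a0)
      show "(a ^^ N') (a x) = 0" using Suc.prems(2) RN by (simp add: funpow_swap1)
    qed
    have 2: "(b ^^ (R' + N)) (d x) = 0"
    proof (rule Suc.hyps(1))
      show "k = R' + N" using Suc.hyps(2) RN by simp
      show "(a ^^ N) (d x) = 0" by (simp add: comm Suc.prems d0)
      show "(d ^^ R') (d x) = 0" using Suc.prems(1) RN by (simp add: funpow_swap1)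
    qed
    have "(b ^^ (R + N)) x = (b ^^ (R + N')) (b x)"
      using RN by (simp add: funpow_swap1)
    also have "\<dots> = (b ^^ (R + N')) (a x) - (b ^^ (R' + N)) (d x)"
      unfolding b bk_diff using RN by simp
    finally show ?thesis using 1 2 by simp
  qed
qed

text \<open>With \<open>l\<close>, \<open>m\<close>, \<open>k\<close> the modes of \<open>z\<close>,
  \<open>w\<close>, \<open>u\<close>, the three operators multiply by \<open>z - w\<close>,
  \<open>z - u\<close> and \<open>w - u\<close>.\<close>

definition diff_lm :: "(int \<Rightarrow> int \<Rightarrow> int \<Rightarrow> 'h::complex_vector) \<Rightarrow> int \<Rightarrow> int \<Rightarrow> int \<Rightarrow> 'h" where
  "diff_lm Q = (\<lambda>l m k. Q (l + 1) m k - Q l (m + 1) k)"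
definition diff_lk :: "(int \<Rightarrow> int \<Rightarrow> int \<Rightarrow> 'h::complex_vector) \<Rightarrow> int \<Rightarrow> int \<Rightarrow> int \<Rightarrow> 'h" where
  "diff_lk Q = (\<lambda>l m k. Q (l + 1) m k - Q l m (k + 1))"
definition diff_mk :: "(int \<Rightarrow> int \<Rightarrow> int \<Rightarrow> 'h::complex_vector) \<Rightarrow> int \<Rightarrow> int \<Rightarrow> int \<Rightarrow> 'h" where
  "diff_mk Q = (\<lambda>l m k. Q l (m + 1) k - Q l m (k + 1))"

lemma diff_lm_funpow: "(diff_lm ^^ N) Q l m k = (zw_mult ^^ N) (\<lambda>l m. Q l m k) l m"
  by (induction N arbitrary: l m) (simp_all add: diff_lm_def zw_mult_def)
lemma diff_lk_funpow: "(diff_lk ^^ N) Q l m k = (zw_mult ^^ N) (\<lambda>l k. Q l m k) l k"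
  by (induction N arbitrary: l k) (simp_all add: diff_lk_def zw_mult_def)
lemma diff_mk_funpow: "(diff_mk ^^ N) Q l m k = (zw_mult ^^ N) (Q l) m k"
  by (induction N arbitrary: m k) (simp_all add: diff_mk_def zw_mult_def)

lemma diff_additive:
  "diff_lm (P - Q) = diff_lm P - diff_lm Q" "diff_lk (P - Q) = diff_lk P - diff_lk Q"
  "diff_mk (P - Q) = diff_mk P - diff_mk Q"
  by (simp_all add: diff_lm_def diff_lk_def diff_mk_def fun_eq_iff)

lemma diff_commute:
  "diff_lk (diff_lm Q) = diff_lm (diff_lk Q)" "diff_mk (diff_lm Q) = diff_lm (diff_mk Q)"
  "diff_mk (diff_lk Q) = diff_lk (diff_mk Q)"
  by (simp_all add: diff_lm_def diff_lk_def diff_mk_def fun_eq_iff)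

lemma funpow_commute: "(\<And>x. f (g x) = g (f x)) \<Longrightarrow> (f ^^ m) ((g ^^ n) x) = (g ^^ n) ((f ^^ m) x)"
proof (induction n)
  case (Suc n)
  have "(f ^^ m) (g y) = g ((f ^^ m) y)" for y by (induction m) (simp_all add: Suc.prems)
  then show ?case using Suc by simp
qed simp

lemma funpow_additive:
  fixes f :: "'a::ab_group_add \<Rightarrow> 'a"
  assumes "\<And>x y. f (x - y) = f x - f y" shows "(f ^^ n) (x - y) = (f ^^ n) x - (f ^^ n) y"
  by (induction n) (simp_all add: assms)

lemma funpow_zero:
  fixes f :: "'a::ab_group_add \<Rightarrow> 'a"
  assumes "\<And>x y. f (x - y) = f x - f y" shows "(f ^^ n) 0 = 0"
  using funpow_additive[of f n 0 0] assms by simp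

text \<open>\<open>(z - u)\<^sup>N (w - u)\<^sup>N\<close> annihilates the commutator of \<open>A(z)B(w)\<close> with \<open>C(u)\<close>.\<close>

lemma commutator_prod_annihilated:
  assumes A: "is_field A" and B: "is_field B" and C: "is_field C"
    and AC: "\<And>v. (zw_mult ^^ N) (\<lambda>l m. A l (C m v) - C m (A l v)) = (\<lambda>l m. 0)"
    and BC: "\<And>v. (zw_mult ^^ N) (\<lambda>l m. B l (C m v) - C m (B l v)) = (\<lambda>l m. 0)"
  shows "(diff_lk ^^ N) ((diff_mk ^^ N) (\<lambda>l m k. A l (B m (C k v)) - C k (A l (B m v)))) = 0"
proof -
  \<comment> \<open>The product \<open>A C B\<close> is inserted: \<open>S\<close> is annihilated
    through locality of \<open>B\<close> and \<open>C\<close>, and \<open>T\<close> through that of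
    \<open>A\<close> and \<open>C\<close>. Their sum is written with differences because additivity
    of the operators is available in that form.\<close>
  define S T where "S = (\<lambda>l m k. A l (B m (C k v) - C k (B m v)))"
    and "T = (\<lambda>l m k. A l (C k (B m v)) - C k (A l (B m v)))"
  have eq: "(\<lambda>l m k. A l (B m (C k v)) - C k (A l (B m v))) = S - (0 - T)"
    by (simp add: fun_eq_iff S_def T_def field_diff[OF A])
  have S: "(diff_mk ^^ N) S = 0"
    unfolding S_def
    by (simp add: fun_eq_iff diff_mk_funpow zw_mult_linear[OF is_field_linear[OF A]] BC
        field_0[OF A])
  have T: "(diff_lk ^^ N) T = 0"
    by (simp add: fun_eq_iff diff_lk_funpow T_def AC)
  have zero: "(diff_lk ^^ N) 0 = (0 :: int \<Rightarrow> int \<Rightarrow> int \<Rightarrow> 'a)" "(diff_mk ^^ N) 0 = (0 :: int \<Rightarrow> int \<Rightarrow> int \<Rightarrow> 'a)"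
    by (simp_all only: funpow_zero[of diff_lk, OF diff_additive(2)] funpow_zero[of diff_mk, OF diff_additive(3)])
  have "(diff_lk ^^ N) ((diff_mk ^^ N) T) = (diff_mk ^^ N) ((diff_lk ^^ N) T)"
    by (rule funpow_commute) (rule diff_commute(3)[symmetric])
  then show ?thesis
    unfolding eq funpow_additive[of diff_lk, OF diff_additive(2)]
      funpow_additive[of diff_mk, OF diff_additive(3)] S T zero by simp
qed

text \<open>Multiplication by \<open>(z - w)^n\<close> commutes with multiplication by
  \<open>z - u\<close> and \<open>w - u\<close>; for each fixed \<open>k\<close> the series is
  bounded in \<open>m\<close>, so that the expansion makes sense.\<close>

lemma commutator_zw_pow_annihilated:
  assumes A: "is_field A" and B: "is_field B" and C: "is_field C"
    and AC: "\<And>v. (zw_mult ^^ N) (\<lambda>l m. A l (C m v) - C m (A l v)) = (\<lambda>l m. 0)"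
    and BC: "\<And>v. (zw_mult ^^ N) (\<lambda>l m. B l (C m v) - C m (B l v)) = (\<lambda>l m. 0)"
  shows "(diff_lk ^^ N) ((diff_mk ^^ N) (\<lambda>l m k. zw_pow n (\<lambda>l m. A l (B m (C k v))) l m
      - C k (zw_pow n (\<lambda>l m. A l (B m v)) l m))) = 0"
proof -
  define T where "T = (\<lambda>l m k. A l (B m (C k v)) - C k (A l (B m v)))"
  define zp where "zp Q = (\<lambda>l m k. zw_pow n (\<lambda>l m. Q l m k) l m)"
    for Q :: "int \<Rightarrow> int \<Rightarrow> int \<Rightarrow> 'a"
  define rb where "rb Q \<longleftrightarrow> (\<forall>k. right_bounded (\<lambda>l m. Q l m k))" for Q :: "int \<Rightarrow> int \<Rightarrow> int \<Rightarrow> 'a"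
  have rbT: "rb T"
    unfolding rb_def T_def
    by (intro allI right_bounded_diff right_bounded_prod right_bounded_linear[where f = "C _"]
        is_field_linear A B C)
  have rb_diff: "rb (diff_lk Q)" "rb (diff_mk Q)" if "rb Q" for Q
    using that unfolding rb_def diff_lk_def diff_mk_def
    by (auto intro!: right_bounded_diff right_bounded_shift)
  have zp_diff: "diff_lk (zp Q) = zp (diff_lk Q)" "diff_mk (zp Q) = zp (diff_mk Q)" if "rb Q" for Q
  proof -
    have Q: "right_bounded (\<lambda>l m. Q l m k)" for k using that by (simp add: rb_def)
    show "diff_lk (zp Q) = zp (diff_lk Q)" "diff_mk (zp Q) = zp (diff_mk Q)"
      unfolding zp_def diff_lk_def diff_mk_def
      using zw_pow_diff[OF right_bounded_shift(1)[OF Q] Q] zw_pow_diff[OF right_bounded_shift(2)[OF Q] Q]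
        zw_pow_shift[of n "\<lambda>l m. Q l m _"]
      by (auto simp: fun_eq_iff)
  qed
  have mk: "(diff_mk ^^ j) (zp Q) = zp ((diff_mk ^^ j) Q) \<and> rb ((diff_mk ^^ j) Q)" if "rb Q" for j Q
    using that by (induction j) (simp_all add: zp_diff rb_diff)
  have lk: "(diff_lk ^^ j) (zp Q) = zp ((diff_lk ^^ j) Q) \<and> rb ((diff_lk ^^ j) Q)" if "rb Q" for j Q
    using that by (induction j) (simp_all add: zp_diff rb_diff)
  have "(\<lambda>l m k. zw_pow n (\<lambda>l m. A l (B m (C k v))) l m
      - C k (zw_pow n (\<lambda>l m. A l (B m v)) l m)) = zp T"
    unfolding zp_def T_def
    by (simp add: fun_eq_iff zw_pow_diff right_bounded_prod A B right_bounded_linear[where f = "C _"]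
        is_field_linear[OF C] zw_pow_linear[OF right_bounded_prod[OF A B] is_field_linear[OF C]])
  then have "(diff_lk ^^ N) ((diff_mk ^^ N) (\<lambda>l m k. zw_pow n (\<lambda>l m. A l (B m (C k v))) l m
      - C k (zw_pow n (\<lambda>l m. A l (B m v)) l m))) = zp ((diff_lk ^^ N) ((diff_mk ^^ N) T))"
    using mk[OF rbT] lk by simp
  also have "(diff_lk ^^ N) ((diff_mk ^^ N) T) = 0"
    unfolding T_def by (rule commutator_prod_annihilated[OF assms])
  also have "zp 0 = 0" by (simp add: zp_def fun_eq_iff zw_pow_def)
  finally show ?thesis .
qed

text \<open>Let \<open>Q(z,w,u)\<close> be the commutator of the kernel of \<open>A\<^sub>nB\<close> with \<open>C(u)\<close>. Powers of \<open>z - w\<close> and of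
  \<open>(z - u)(w - u)\<close> annihilate \<open>Q\<close>, hence so does a power of \<open>w - u = (z - u) - (z - w)\<close>.\<close>

lemma dong:
  assumes A: "is_field A" and B: "is_field B" and C: "is_field C"
    and AB: "mutually_local A B" and AC: "mutually_local A C" and BC: "mutually_local B C"
  shows "mutually_local (field_prod 0 A B n) C"
proof -
  obtain R where R: "\<And>v. (zw_mult ^^ R) (prod_kernel A B n v) = (\<lambda>l m. 0)"
    using prod_kernel_nilpotent[OF A B AB] by blast
  obtain N1 where N1: "\<And>v. (zw_mult ^^ N1) (\<lambda>l m. A l (C m v) - C m (A l v)) = (\<lambda>l m. 0)"
    using AC unfolding mutually_local_def by blast
  obtain N2 where N2: "\<And>v. (zw_mult ^^ N2) (\<lambda>l m. B l (C m v) - C m (B l v)) = (\<lambda>l m. 0)"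
    using BC unfolding mutually_local_def by blast
  define N where "N = max N1 N2"
  have NA: "(zw_mult ^^ N) (\<lambda>l m. A l (C m v) - C m (A l v)) = (\<lambda>l m. 0)" for v
    by (rule zw_mult_mono[OF N1]) (simp add: N_def)
  have NB: "(zw_mult ^^ N) (\<lambda>l m. B l (C m v) - C m (B l v)) = (\<lambda>l m. 0)" for v
    by (rule zw_mult_mono[OF N2]) (simp add: N_def)
  have "(zw_mult ^^ (R + N + N)) (\<lambda>m k. field_prod 0 A B n m (C k v) - C k (field_prod 0 A B n m v))
      = (\<lambda>l m. 0)" for v
  proof -
    define Q where "Q = (\<lambda>l m k. prod_kernel A B n (C k v) l m - C k (prod_kernel A B n v l m))"
    define Y where "Y A B = (\<lambda>l m k. zw_pow n (\<lambda>l m. A l (B m (C k v))) l m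
      - C k (zw_pow n (\<lambda>l m. A l (B m v)) l m))" for A B :: "'a modes"
    have dQ: "(diff_lm ^^ R) Q = 0"
      by (simp add: fun_eq_iff Q_def diff_lm_funpow zw_mult_diff R
          zw_mult_linear[OF is_field_linear[OF C]] field_0[OF C])
    have Q_eq: "Q = Y A B - (\<lambda>l m k. ((- 1) powi n) *\<^sub>C Y B A m l k)"
      unfolding Q_def Y_def prod_kernel_def
      by (simp add: fun_eq_iff field_diff[OF C]
          field_scale[OF C] scaleC_diff_right)
    \<comment> \<open>In the second half of the kernel \<open>z\<close> and \<open>w\<close> are
      exchanged, which exchanges the factors \<open>z - u\<close> and \<open>w - u\<close>; their
      product is symmetric.\<close>
    have swap: "(diff_mk ^^ j) (\<lambda>l m k. c *\<^sub>C F m l k) = (\<lambda>l m k. c *\<^sub>C (diff_lk ^^ j) F m l k)"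
      "(diff_lk ^^ j) (\<lambda>l m k. c *\<^sub>C F m l k) = (\<lambda>l m k. c *\<^sub>C (diff_mk ^^ j) F m l k)"
      for j c and F :: "int \<Rightarrow> int \<Rightarrow> int \<Rightarrow> 'a"
      by (induction j) (simp_all add: fun_eq_iff diff_mk_def diff_lk_def
          scaleC_diff_right)
    have "(diff_lk ^^ N) ((diff_mk ^^ N) (Y A B)) = 0"
      unfolding Y_def by (rule commutator_zw_pow_annihilated[OF A B C NA NB])
    moreover have "(diff_lk ^^ N) ((diff_mk ^^ N) (Y B A)) = 0"
      unfolding Y_def by (rule commutator_zw_pow_annihilated[OF B A C NB NA])
    then have "(diff_mk ^^ N) ((diff_lk ^^ N) (Y B A)) = 0"
      by (simp add: funpow_commute[of diff_mk diff_lk, OF diff_commute(3)])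
    then have "(diff_lk ^^ N) ((diff_mk ^^ N) (\<lambda>l m k. ((- 1) powi n) *\<^sub>C Y B A m l k)) = 0"
      unfolding swap by (simp add: fun_eq_iff)
    ultimately have "(diff_lk ^^ N) ((diff_mk ^^ N) Q) = 0"
      unfolding Q_eq by (simp add: funpow_additive diff_additive)
    moreover have "(diff_lm ^^ R) ((diff_mk ^^ N) Q) = (diff_mk ^^ N) ((diff_lm ^^ R) Q)"
      by (rule funpow_commute) (rule diff_commute(2)[symmetric])
    then have "(diff_lm ^^ R) ((diff_mk ^^ N) Q) = 0"
      unfolding dQ by (simp only: funpow_zero[of diff_mk, OF diff_additive(3)])
    ultimately have "(diff_mk ^^ (R + N)) ((diff_mk ^^ N) Q) = 0"
      by (intro binomial_annihilation[of diff_mk diff_lk diff_lm])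
        (auto simp: diff_additive diff_commute, simp add: fun_eq_iff diff_mk_def diff_lk_def diff_lm_def)
    then have "(diff_mk ^^ (R + N + N)) Q = 0"
      by (simp only: funpow_add o_apply)
    \<comment> \<open>Taking the residue in \<open>z\<close>, that is \<open>l = 0\<close>, turns
      the kernel into the product field.\<close>
    then have "(zw_mult ^^ (R + N + N)) (Q 0) m k = 0" for m k
      unfolding diff_mk_funpow[symmetric] by simp
    then show ?thesis
      by (simp add: fun_eq_iff field_prod_eq[OF A B] Q_def[symmetric])
        (simp add: Q_def)
  qed
  then show ?thesis unfolding mutually_local_def by blast
qed

lemma mutually_local_sym:
  assumes "mutually_local A B" shows "mutually_local B A"
proof -
  obtain N where N: "\<And>v. (zw_mult ^^ N) (\<lambda>l m. A l (B m v) - B m (A l v)) = (\<lambda>l m. 0)"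
    using assms unfolding mutually_local_def by blast
  have "(zw_mult ^^ N) (\<lambda>l m. B l (A m v) - A m (B l v)) = (\<lambda>l m. 0)" for v
  proof -
    have swap: "(zw_mult ^^ N) (\<lambda>l m. A m (B l v) - B l (A m v)) = (\<lambda>l m. 0)"
      using zw_mult_swap[of N "\<lambda>l m. A l (B m v) - B m (A l v)"] unfolding N by simp
    have "(\<lambda>l m. B l (A m v) - A m (B l v)) = (\<lambda>l m. 0 - (A m (B l v) - B l (A m v)))" by simp
    then show ?thesis
      using zw_mult_diff[of N "\<lambda>l m. 0" "\<lambda>l m. A m (B l v) - B l (A m v)"]
      unfolding swap zw_mult_zero by simp
  qed
  then show ?thesis unfolding mutually_local_def by blast
qed

lemma mutually_local_id: "is_field A \<Longrightarrow> mutually_local A id_field"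
  unfolding mutually_local_def
  by (rule exI[of _ 0]) (auto simp: id_field_def fun_eq_iff clinear_0 is_field_linear)

lemma mutually_local_deriv:
  assumes "mutually_local A B" "is_field B" shows "mutually_local (deriv_field A) B"
proof -
  obtain N where N: "\<And>v. (zw_mult ^^ N) (\<lambda>l m. A l (B m v) - B m (A l v)) = (\<lambda>l m. 0)"
    using assms unfolding mutually_local_def by blast
  \<comment> \<open>Differentiating in \<open>z\<close> costs one power:
    \<open>(z - w) dF/dz = d/dz ((z - w) F) - F\<close>, used once in each induction step.\<close>
  have *: "(zw_mult ^^ Suc N) (\<lambda>l m. of_int (- l) *\<^sub>C F (l - 1) m) = (\<lambda>l m. 0)"
    if "(zw_mult ^^ N) F = (\<lambda>l m. 0)" for F :: "int \<Rightarrow> int \<Rightarrow> 'a"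
    using that
  proof (induction N arbitrary: F)
    case (Suc N)
    have eq: "zw_mult (\<lambda>l m. of_int (- l) *\<^sub>C F (l - 1) m) =
        (\<lambda>l m. of_int (- l) *\<^sub>C zw_mult F (l - 1) m - F l m)"
      by (simp add: zw_mult_def fun_eq_iff scaleC_diff_left
          scaleC_diff_right scaleC_add_left)
    have "(zw_mult ^^ Suc N) (\<lambda>l m. of_int (- l) *\<^sub>C zw_mult F (l - 1) m) = (\<lambda>l m. 0)"
      by (rule Suc.IH) (use Suc.prems in \<open>simp only: funpow_Suc_right o_apply\<close>)
    then show ?case
      unfolding funpow_Suc_right[of "Suc N"] o_apply eq zw_mult_diff using Suc.prems by simp
  qed (simp add: zw_mult_def)
  have eq: "(\<lambda>l m. deriv_field A l (B m v) - B m (deriv_field A l v)) =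
      (\<lambda>l m. of_int (- l) *\<^sub>C (A (l - 1) (B m v) - B m (A (l - 1) v)))" for v
    by (simp add: deriv_field_def fun_eq_iff field_scale[OF assms(2)]
        field_minus[OF assms(2)] algebra_simps
        scaleC_diff_right)
  show ?thesis
    unfolding mutually_local_def eq using *[OF N] by blast
qed


subsection \<open>Covariance and vacuum properties of products\<close>

lemma zw_pow_lincomb:
  assumes "right_bounded F" "right_bounded G"
  shows "zw_pow n (\<lambda>l m. c *\<^sub>C F l m + G l m) l m = c *\<^sub>C zw_pow n F l m + zw_pow n G l m"
proof -
  have c: "clinear (\<lambda>v. (- c) *\<^sub>C (v::'a))"
    by (simp add: clinear_iff scaleC_add_right scaleC_scaleC mult.commute)
  have "zw_pow n (\<lambda>l m. G l m - (- c) *\<^sub>C F l m) l m = zw_pow n G l m - (- c) *\<^sub>C zw_pow n F l m"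
    using zw_pow_diff[OF assms(2) right_bounded_linear[OF assms(1) c]] zw_pow_linear[OF assms(1) c]
    by simp
  then show ?thesis by (simp add: add.commute)
qed

definition lincomb :: "complex \<Rightarrow> 'h::complex_vector modes \<Rightarrow> 'h modes \<Rightarrow> 'h modes" where
  "lincomb c A B = (\<lambda>n v. c *\<^sub>C A n v + B n v)"

lemma is_field_lincomb:
  assumes "is_field A" "is_field B" shows "is_field (lincomb c A B)"
  unfolding is_field_def
proof (intro conjI allI)
  show "clinear (lincomb c A B n)" for n
    using is_field_linear[OF assms(1), of n] is_field_linear[OF assms(2), of n]
    by (simp add: clinear_iff lincomb_def scaleC_add_right scaleC_scaleC mult.commute)
  fix v
  obtain M where M: "\<And>m. m \<ge> M \<Longrightarrow> A m v = 0" using is_field_vanish[OF assms(1), of v] by blast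
  obtain N where N: "\<And>m. m \<ge> N \<Longrightarrow> B m v = 0" using is_field_vanish[OF assms(2), of v] by blast
  have "\<forall>m\<ge>max M N. lincomb c A B m v = 0" using M N by (simp add: lincomb_def)
  then show "\<exists>M. \<forall>m\<ge>M. lincomb c A B m v = 0" by blast
qed

lemma field_prod_lincomb_left:
  assumes "is_field A" "is_field A'" "is_field B"
  shows "field_prod 0 (lincomb c A A') B n = lincomb c (field_prod 0 A B n) (field_prod 0 A' B n)"
proof (intro ext)
  fix m v
  have "zw_pow n (\<lambda>m l. B m (lincomb c A A' l v)) m 0 =
      c *\<^sub>C zw_pow n (\<lambda>m l. B m (A l v)) m 0 + zw_pow n (\<lambda>m l. B m (A' l v)) m 0"
    using zw_pow_lincomb[OF right_bounded_prod[OF assms(3,1)] right_bounded_prod[OF assms(3,2)]]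
    by (simp add: lincomb_def field_add[OF assms(3)]
        field_scale[OF assms(3)])
  moreover have "zw_pow n (\<lambda>l m. lincomb c A A' l (B m v)) 0 m =
      c *\<^sub>C zw_pow n (\<lambda>l m. A l (B m v)) 0 m + zw_pow n (\<lambda>l m. A' l (B m v)) 0 m"
    unfolding lincomb_def
    by (rule zw_pow_lincomb[OF right_bounded_prod[OF assms(1,3)] right_bounded_prod[OF assms(2,3)]])
  ultimately show "field_prod 0 (lincomb c A A') B n m v =
      lincomb c (field_prod 0 A B n) (field_prod 0 A' B n) m v"
    unfolding field_prod_eq[OF is_field_lincomb[OF assms(1,2)] assms(3)] prod_kernel_def
      lincomb_def[of c "field_prod 0 A B n"] field_prod_eq[OF assms(1,3)] field_prod_eq[OF assms(2,3)]
    by (simp add: scaleC_add_right scaleC_diff_right scaleC_scaleC mult.commute)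
qed

lemma field_prod_lincomb_right:
  assumes "is_field A" "is_field B" "is_field B'"
  shows "field_prod 0 A (lincomb c B B') n = lincomb c (field_prod 0 A B n) (field_prod 0 A B' n)"
proof (intro ext)
  fix m v
  have "zw_pow n (\<lambda>l m. A l (lincomb c B B' m v)) 0 m =
      c *\<^sub>C zw_pow n (\<lambda>l m. A l (B m v)) 0 m + zw_pow n (\<lambda>l m. A l (B' m v)) 0 m"
    using zw_pow_lincomb[OF right_bounded_prod[OF assms(1,2)] right_bounded_prod[OF assms(1,3)]]
    by (simp add: lincomb_def field_add[OF assms(1)]
        field_scale[OF assms(1)])
  moreover have "zw_pow n (\<lambda>m l. lincomb c B B' m (A l v)) m 0 =
      c *\<^sub>C zw_pow n (\<lambda>m l. B m (A l v)) m 0 + zw_pow n (\<lambda>m l. B' m (A l v)) m 0"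
    unfolding lincomb_def
    by (rule zw_pow_lincomb[OF right_bounded_prod[OF assms(2,1)] right_bounded_prod[OF assms(3,1)]])
  ultimately show "field_prod 0 A (lincomb c B B') n m v =
      lincomb c (field_prod 0 A B n) (field_prod 0 A B' n) m v"
    unfolding field_prod_eq[OF assms(1) is_field_lincomb[OF assms(2,3)]] prod_kernel_def
      lincomb_def[of c "field_prod 0 A B n"] field_prod_eq[OF assms(1,2)] field_prod_eq[OF assms(1,3)]
    by (simp add: scaleC_add_right scaleC_diff_right scaleC_scaleC mult.commute)
qed

lemma mutually_local_lincomb:
  assumes "mutually_local A B" "mutually_local A' B" "is_field B"
  shows "mutually_local (lincomb c A A') B"
proof -
  obtain N1 where N1: "\<And>v. (zw_mult ^^ N1) (\<lambda>l m. A l (B m v) - B m (A l v)) = (\<lambda>l m. 0)"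
    using assms(1) unfolding mutually_local_def by blast
  obtain N2 where N2: "\<And>v. (zw_mult ^^ N2) (\<lambda>l m. A' l (B m v) - B m (A' l v)) = (\<lambda>l m. 0)"
    using assms(2) unfolding mutually_local_def by blast
  define N where "N = max N1 N2"
  have 1: "(zw_mult ^^ N) (\<lambda>l m. A l (B m v) - B m (A l v)) = (\<lambda>l m. 0)" for v
    by (rule zw_mult_mono[OF N1]) (simp add: N_def)
  have 2: "(zw_mult ^^ N) (\<lambda>l m. A' l (B m v) - B m (A' l v)) = (\<lambda>l m. 0)" for v
    by (rule zw_mult_mono[OF N2]) (simp add: N_def)
  have c: "clinear (\<lambda>v. c *\<^sub>C (v::'a))"
    by (simp add: clinear_iff scaleC_add_right scaleC_scaleC mult.commute)
  have "(zw_mult ^^ N) (\<lambda>l m. lincomb c A A' l (B m v) - B m (lincomb c A A' l v)) = (\<lambda>l m. 0)" for v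
  proof -
    have eq: "(\<lambda>l m. lincomb c A A' l (B m v) - B m (lincomb c A A' l v)) =
      (\<lambda>l m. c *\<^sub>C (A l (B m v) - B m (A l v)) + (A' l (B m v) - B m (A' l v)))"
      by (simp add: lincomb_def fun_eq_iff field_add[OF assms(3)]
          field_scale[OF assms(3)] scaleC_diff_right)
    show ?thesis unfolding eq zw_mult_add zw_mult_linear[OF c] 1 2 by simp
  qed
  then show ?thesis unfolding mutually_local_def by blast
qed

definition translation_covariant :: "('h::complex_vector \<Rightarrow> 'h) \<Rightarrow> 'h modes \<Rightarrow> bool" where
  "translation_covariant T A \<longleftrightarrow> (\<forall>n v. T (A n v) - A n (T v) = of_int (- n) *\<^sub>C A (n - 1) v)"

definition homogeneous :: "('h::complex_vector \<Rightarrow> 'h) \<Rightarrow> int \<Rightarrow> 'h modes \<Rightarrow> bool" where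
  "homogeneous D \<alpha> A \<longleftrightarrow> (\<forall>n v. D (A n v) - A n (D v) = of_int (\<alpha> - n - 1) *\<^sub>C A n v)"

definition creative :: "'h::complex_vector \<Rightarrow> 'h modes \<Rightarrow> bool" where
  "creative \<Omega> A \<longleftrightarrow> (\<forall>n\<ge>0. A n \<Omega> = 0)"

lemma commutator_zw_pow:
  assumes A: "is_field A" and B: "is_field B" and T: "clinear T"
  shows "T (zw_pow n (\<lambda>l m. A l (B m v)) l m) - zw_pow n (\<lambda>l m. A l (B m (T v))) l m =
    zw_pow n (\<lambda>l m. (T (A l (B m v)) - A l (T (B m v))) + A l (T (B m v) - B m (T v))) l m"
  unfolding zw_pow_linear[OF right_bounded_prod[OF A B] T, symmetric]
    zw_pow_diff[OF right_bounded_linear[OF right_bounded_prod[OF A B] T] right_bounded_prod[OF A B], symmetric]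
  by (simp add: field_diff[OF A])

text \<open>\<open>T\<close> acts on each half of the kernel as \<open>d/dz + d/dw\<close>, which
  commutes with powers of \<open>z - w\<close>. At \<open>l = 0\<close> the \<open>d/dz\<close> part
  has coefficient 0, leaving the derivative in \<open>w\<close>.\<close>

lemma translation_covariant_prod:
  assumes A: "is_field A" and B: "is_field B" and T: "clinear T"
    and "translation_covariant T A" "translation_covariant T B"
  shows "translation_covariant T (field_prod 0 A B n)"
proof -
  have main: "T (zw_pow n (\<lambda>l m. A l (B m v)) l m) - zw_pow n (\<lambda>l m. A l (B m (T v))) l m =
      zw_deriv (zw_pow n (\<lambda>l m. A l (B m v))) l m"
    if A: "is_field A" and B: "is_field B" and "translation_covariant T A" "translation_covariant T B"
    for A B :: "'a modes" and v l m
  proof -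
    have "(\<lambda>l m. (T (A l (B m v)) - A l (T (B m v))) + A l (T (B m v) - B m (T v))) =
        zw_deriv (\<lambda>l m. A l (B m v))"
      using that(3,4) unfolding translation_covariant_def zw_deriv_def
      by (simp add: fun_eq_iff field_scale[OF A] field_minus[OF A])
    then show ?thesis
      unfolding commutator_zw_pow[OF A B T] by (simp add: zw_pow_zw_deriv[OF right_bounded_prod[OF A B]])
  qed
  show ?thesis
    unfolding translation_covariant_def
  proof (intro allI)
    fix m v
    have "T (field_prod 0 A B n m v) - field_prod 0 A B n m (T v) =
       (T (zw_pow n (\<lambda>l m. A l (B m v)) 0 m) - zw_pow n (\<lambda>l m. A l (B m (T v))) 0 m)
       - ((- 1) powi n) *\<^sub>C (T (zw_pow n (\<lambda>m l. B m (A l v)) m 0) - zw_pow n (\<lambda>m l. B m (A l (T v))) m 0)"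
      unfolding field_prod_eq[OF A B] prod_kernel_def clinear_diff[OF T] clinear_scale[OF T]
      by (simp add: scaleC_diff_right algebra_simps)
    also have "\<dots> = of_int (- m) *\<^sub>C field_prod 0 A B n (m - 1) v"
      unfolding main[OF A B assms(4,5)] main[OF B A assms(5,4)] field_prod_eq[OF A B] prod_kernel_def zw_deriv_def
      by (simp add: scaleC_diff_right scaleC_left_commute)
    finally show "T (field_prod 0 A B n m v) - field_prod 0 A B n m (T v) =
      of_int (- m) *\<^sub>C field_prod 0 A B n (m - 1) v" .
  qed
qed

text \<open>All terms of the expansion have the same total mode \<open>l + n + m\<close>, so a
  factor depending on the total can be taken out.\<close>

lemma zw_pow_weight:
  assumes "right_bounded F"
  shows "zw_pow n (\<lambda>l m. \<phi> (l + m) *\<^sub>C F l m) l m = \<phi> (l + n + m) *\<^sub>C zw_pow n F l m"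
proof -
  obtain M where M: "\<And>l m. m \<ge> M \<Longrightarrow> F l m = 0" using right_boundedE[OF assms] by blast
  define K where "K = nat (M - m)"
  have "zw_pow n F l m = (\<Sum>p<K. pow_coeff n p *\<^sub>C F (l + n - int p) (m + int p))"
    by (rule zw_pow_eq_sum[of M]) (auto simp: M K_def)
  moreover have "zw_pow n (\<lambda>l m. \<phi> (l + m) *\<^sub>C F l m) l m =
     (\<Sum>p<K. pow_coeff n p *\<^sub>C \<phi> (l + n - int p + (m + int p)) *\<^sub>C F (l + n - int p) (m + int p))"
    by (rule zw_pow_eq_sum[of M]) (auto simp: M K_def)
  ultimately show ?thesis
    by (simp add: scaleC_sum_right mult.commute add.assoc)
qed

lemma homogeneous_prod:
  assumes A: "is_field A" and B: "is_field B" and D: "clinear D"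
    and "homogeneous D \<alpha> A" "homogeneous D \<beta> B"
  shows "homogeneous D (\<alpha> + \<beta> - n - 1) (field_prod 0 A B n)"
proof -
  have main: "D (zw_pow n (\<lambda>l m. A l (B m v)) l m) - zw_pow n (\<lambda>l m. A l (B m (D v))) l m =
      of_int (\<alpha> + \<beta> - (l + n + m) - 2) *\<^sub>C zw_pow n (\<lambda>l m. A l (B m v)) l m"
    if A: "is_field A" and B: "is_field B" and "homogeneous D \<alpha> A" "homogeneous D \<beta> B"
    for A B :: "'a modes" and v l m \<alpha> \<beta>
  proof -
    have "(\<lambda>l m. (D (A l (B m v)) - A l (D (B m v))) + A l (D (B m v) - B m (D v))) =
        (\<lambda>l m. of_int (\<alpha> + \<beta> - (l + m) - 2) *\<^sub>C A l (B m v))"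
      using that(3,4) unfolding homogeneous_def
      by (simp add: fun_eq_iff field_scale[OF A] scaleC_add_left[symmetric])
    then show ?thesis
      unfolding commutator_zw_pow[OF A B D]
      by (simp only: zw_pow_weight[OF right_bounded_prod[OF A B], where \<phi> = "\<lambda>k. of_int (\<alpha> + \<beta> - k - 2)"])
  qed
  show ?thesis
    unfolding homogeneous_def
  proof (intro allI)
    fix m v
    have "D (field_prod 0 A B n m v) - field_prod 0 A B n m (D v) =
       (D (zw_pow n (\<lambda>l m. A l (B m v)) 0 m) - zw_pow n (\<lambda>l m. A l (B m (D v))) 0 m)
       - ((- 1) powi n) *\<^sub>C (D (zw_pow n (\<lambda>m l. B m (A l v)) m 0) - zw_pow n (\<lambda>m l. B m (A l (D v))) m 0)"
      unfolding field_prod_eq[OF A B] prod_kernel_def clinear_diff[OF D] clinear_scale[OF D]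
      by (simp add: scaleC_diff_right algebra_simps)
    also have "\<dots> = of_int (\<alpha> + \<beta> - n - 1 - m - 1) *\<^sub>C field_prod 0 A B n m v"
    proof -
      have *: "\<alpha> + \<beta> - (0 + n + m) - 2 = \<alpha> + \<beta> - n - 1 - m - 1" "\<beta> + \<alpha> - (m + n + 0) - 2 = \<alpha> + \<beta> - n - 1 - m - 1"
        by simp_all
      show ?thesis
        unfolding main[OF A B assms(4,5)] main[OF B A assms(5,4)] field_prod_eq[OF A B] prod_kernel_def *
        by (simp only: scaleC_diff_right scaleC_left_commute)
    qed
    finally show "D (field_prod 0 A B n m v) - field_prod 0 A B n m (D v) =
      of_int (\<alpha> + \<beta> - n - 1 - m - 1) *\<^sub>C field_prod 0 A B n m v" .
  qed
qed

text \<open>On \<open>\<Omega>\<close> the half with \<open>A\<close> to the right vanishes, and in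
  the other half only the term \<open>p = 0\<close> survives at mode -1. The second part thus tells
  which vector a product creates.\<close>

lemma creative_prod:
  assumes A: "is_field A" and B: "is_field B" and "creative \<Omega> A" "creative \<Omega> B"
  shows "creative \<Omega> (field_prod 0 A B n)"
    and "field_prod 0 A B n (- 1) \<Omega> = A n (B (- 1) \<Omega>)"
proof -
  have A0: "A m \<Omega> = 0" and B0: "B m \<Omega> = 0" if "m \<ge> 0" for m
    using assms(3,4) that by (simp_all add: creative_def)
  have *: "zw_pow n (\<lambda>m l. B m (A l \<Omega>)) m 0 = 0" for m
    by (rule zw_pow_vanish[of 0]) (simp_all add: A0 field_0[OF B])
  show "creative \<Omega> (field_prod 0 A B n)"
    unfolding creative_def field_prod_eq[OF A B] prod_kernel_def *
    using zw_pow_vanish[of 0 "\<lambda>l m. A l (B m \<Omega>)"] by (simp add: B0 field_0[OF A])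
  have "zw_pow n (\<lambda>l m. A l (B m \<Omega>)) 0 (- 1) =
      (\<Sum>p<1. pow_coeff n p *\<^sub>C A (0 + n - int p) (B (- 1 + int p) \<Omega>))"
    by (rule zw_pow_eq_sum[of 0]) (simp_all add: B0 field_0[OF A])
  then show "field_prod 0 A B n (- 1) \<Omega> = A n (B (- 1) \<Omega>)"
    unfolding field_prod_eq[OF A B] prod_kernel_def * by (simp add: pow_coeff_0 scaleC_one)
qed

lemma is_field_deriv:
  assumes "is_field A" shows "is_field (deriv_field A)"
  unfolding is_field_def
proof (intro conjI allI)
  show "clinear (deriv_field A n)" for n
    using is_field_linear[OF assms, of "n - 1"]
    by (simp add: clinear_iff deriv_field_def scaleC_add_right scaleC_left_commute
        scaleC_diff_right)
  fix v
  obtain M where M: "\<And>m. m \<ge> M \<Longrightarrow> A m v = 0" using is_field_vanish[OF assms, of v] by blast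
  then have "\<forall>m\<ge>M + 1. deriv_field A m v = 0" by (simp add: deriv_field_def)
  then show "\<exists>M. \<forall>m\<ge>M. deriv_field A m v = 0" by blast
qed

lemma translation_covariant_deriv:
  assumes T: "clinear T" and A: "translation_covariant T A" and "is_field A"
  shows "translation_covariant T (deriv_field A)"
  unfolding translation_covariant_def
proof (intro allI)
  fix n v
  have "T (deriv_field A n v) - deriv_field A n (T v) = of_int (- n) *\<^sub>C (T (A (n - 1) v) - A (n - 1) (T v))"
    unfolding deriv_field_def clinear_scale[OF T] by (simp only: scaleC_diff_right)
  also have "T (A (n - 1) v) - A (n - 1) (T v) = deriv_field A (n - 1) v"
    using A by (simp add: translation_covariant_def deriv_field_def)
  finally show "T (deriv_field A n v) - deriv_field A n (T v) = of_int (- n) *\<^sub>C deriv_field A (n - 1) v" .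
qed

lemma homogeneous_deriv:
  assumes D: "clinear D" and A: "homogeneous D \<alpha> A" shows "homogeneous D (\<alpha> + 1) (deriv_field A)"
  unfolding homogeneous_def
proof (intro allI)
  fix n v
  have "D (deriv_field A n v) - deriv_field A n (D v) = of_int (- n) *\<^sub>C (D (A (n - 1) v) - A (n - 1) (D v))"
    unfolding deriv_field_def clinear_scale[OF D] by (simp only: scaleC_diff_right)
  also have "D (A (n - 1) v) - A (n - 1) (D v) = of_int (\<alpha> - (n - 1) - 1) *\<^sub>C A (n - 1) v"
    using A unfolding homogeneous_def by blast
  also have "of_int (- n) *\<^sub>C of_int (\<alpha> - (n - 1) - 1) *\<^sub>C A (n - 1) v =
      of_int (\<alpha> + 1 - n - 1) *\<^sub>C deriv_field A n v"
    unfolding deriv_field_def by (subst scaleC_left_commute) (simp add: algebra_simps)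
  finally show "D (deriv_field A n v) - deriv_field A n (D v) = of_int (\<alpha> + 1 - n - 1) *\<^sub>C deriv_field A n v" .
qed

lemma creative_deriv: "creative \<Omega> A \<Longrightarrow> creative \<Omega> (deriv_field A)"
  unfolding creative_def deriv_field_def
proof (intro allI impI)
  fix n :: int assume "\<forall>n\<ge>0. A n \<Omega> = 0" "n \<ge> 0"
  \<comment> \<open>At \<open>n = 0\<close> the factor \<open>- n\<close> removes
    \<open>A (- 1) \<Omega>\<close>, which need not vanish.\<close>
  then show "of_int (- n) *\<^sub>C A (n - 1) \<Omega> = 0" by (cases "n = 0") auto
qed

section \<open>Analytic locality\<close>

lemma cinner_0_left: "cinner 0 (y::'h::prehilbert) = 0"
  using cinner_add_left[of 0 0 y] by simp

lemma cinner_minus_left: "cinner (- x) (y::'h::prehilbert) = - cinner x y"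
  using cinner_add_left[of x "- x" y] by (simp add: cinner_0_left eq_neg_iff_add_eq_0 add.commute)

lemma cinner_diff_left: "cinner (x - x') (y::'h::prehilbert) = cinner x y - cinner x' y"
  using cinner_add_left[of x "- x'" y] by (simp add: cinner_minus_left)

section \<open>Expansion of rational functions of two variables\<close>

lemma has_sum_complex_product:
  fixes f g :: "_ \<Rightarrow> complex"
  assumes "(f has_sum a) A" "(g has_sum b) B"
  shows "((\<lambda>(x, y). f x * g y) has_sum a * b) (A \<times> B)"
proof (rule has_sum_SigmaI)
  show "((\<lambda>y. case (x, y) of (x, y) \<Rightarrow> f x * g y) has_sum f x * b) B" for x
    using has_sum_cmult_right[OF assms(2), of "f x"] by simp
  show "((\<lambda>x. f x * b) has_sum a * b) A" by (rule has_sum_cmult_left[OF assms(1)])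
  have f: "(\<lambda>x. norm (f x)) summable_on A" and g: "(\<lambda>x. norm (g x)) summable_on B"
    using assms[THEN has_sum_imp_summable] by (simp_all add: summable_on_iff_abs_summable_on_complex)
  have "(\<lambda>p. norm (case p of (x, y) \<Rightarrow> f x * g y)) summable_on A \<times> B"
    unfolding Infinite_Sum.abs_summable_on_Sigma_iff
  proof (intro conjI ballI)
    show "(\<lambda>y. norm (case (x, y) of (x, y) \<Rightarrow> f x * g y)) summable_on B" for x
      using summable_on_cmult_right[OF g, of "norm (f x)"] by (simp add: norm_mult)
    show "(\<lambda>x. norm (\<Sum>\<^sub>\<infinity>y\<in>B. norm (case (x, y) of (x, y) \<Rightarrow> f x * g y))) summable_on A"
      using summable_on_cmult_left[OF f, of "norm (\<Sum>\<^sub>\<infinity>y\<in>B. norm (g y))"]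
      by (simp add: norm_mult infsum_cmult_right' abs_mult)
  qed
  then show "(\<lambda>(x, y). f x * g y) summable_on A \<times> B"
    by (simp add: summable_on_iff_abs_summable_on_complex)
qed

text \<open>The scalar counterpart of \<open>zw_mult\<close>, for matrix coefficients.\<close>

definition cdiff :: "(int \<Rightarrow> int \<Rightarrow> complex) \<Rightarrow> int \<Rightarrow> int \<Rightarrow> complex" where
  "cdiff f = (\<lambda>l m. f (l + 1) m - f l (m + 1))"

lemma cdiff_apply: "cdiff f l m = f (l + 1) m - f l (m + 1)"
  by (simp only: cdiff_def)

definition monomial :: "(int \<Rightarrow> int \<Rightarrow> complex) \<Rightarrow> complex \<Rightarrow> complex \<Rightarrow> int \<times> int \<Rightarrow> complex" where
  "monomial f z w = (\<lambda>(l, m). f l m * z powi (- l - 1) * w powi (- m - 1))"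

text \<open>Division by \<open>z - w\<close> through the geometric series in \<open>w / z\<close>;
  the bound on \<open>m\<close> makes it a finite sum in each coefficient.\<close>

lemma cdiff_telescope:
  assumes "\<And>l m. m \<ge> M \<Longrightarrow> f l m = 0" "m + int K \<ge> M"
  shows "f l m = (\<Sum>k<K. cdiff f (l - 1 - int k) (m + int k))"
  using assms(2)
proof (induction K arbitrary: l m)
  case 0
  then show ?case using assms(1) by simp
next
  case (Suc K)
  have "f l m = cdiff f (l - 1) m + f (l - 1) (m + 1)" by (simp add: cdiff_apply)
  also have "f (l - 1) (m + 1) = (\<Sum>k<K. cdiff f (l - 1 - 1 - int k) (m + 1 + int k))"
    by (rule Suc.IH) (use Suc.prems in simp)
  finally show ?case
    by (simp add: sum.lessThan_Suc_shift algebra_simps del: sum.lessThan_Suc)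
qed

text \<open>The given series is multiplied by the geometric series of \<open>1 / (z - w)\<close>,
  which converges absolutely. The double sum is then regrouped by total exponent, and
  \<open>cdiff_telescope\<close> identifies each group with one term of the series of
  \<open>f\<close>.\<close>

lemma has_sum_divide_diff:
  assumes f: "\<And>l m. m \<ge> M \<Longrightarrow> f l m = 0"
    and sum: "(monomial (cdiff f) z w has_sum Y) UNIV" and zw: "norm w < norm z" "w \<noteq> 0"
  shows "(monomial f z w has_sum Y / (z - w)) UNIV"
proof -
  have z: "z \<noteq> 0" using zw by auto
  define q where "q = w / z"
  have q: "norm q < 1" using zw z by (simp add: q_def norm_divide)
  have "((\<lambda>k. q ^ k) has_sum 1 / (1 - q)) UNIV"
  proof (rule norm_summable_imp_has_sum)
    show "summable (\<lambda>n. norm (q ^ n))" using q by (simp add: norm_power summable_geometric)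
    show "(\<lambda>n. q ^ n) sums (1 / (1 - q))" by (rule geometric_sums[OF q])
  qed
  from has_sum_complex_product[OF sum has_sum_cmult_right[OF this, of "1 / z"]]
  have prod: "((\<lambda>(p, k). monomial (cdiff f) z w p * (1 / z * q ^ k)) has_sum Y * (1 / z * (1 / (1 - q))))
    (UNIV \<times> UNIV)" .
  have Y: "Y * (1 / z * (1 / (1 - q))) = Y / (z - w)"
    using z zw by (simp add: q_def field_simps)
  \<comment> \<open>The \<open>k\<close>-th geometric term is \<open>z^(-1-k) w^k\<close>; it
    carries the coefficient at \<open>(l - 1 - k, m + k)\<close> to the monomial of
    \<open>(l, m)\<close>.\<close>
  define \<phi> where "\<phi> = (\<lambda>((l, m), k). ((l - 1 - int k, m + int k), k))"
  have "bij_betw \<phi> (UNIV \<times> UNIV) (UNIV \<times> UNIV)"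
    by (rule bij_betwI[where g = "\<lambda>((l, m), k). ((l + 1 + int k, m - int k), k)"])
      (auto simp: \<phi>_def)
  from has_sum_reindex_bij_betw[OF this] prod
  have "((\<lambda>x. case \<phi> x of (p, k) \<Rightarrow> monomial (cdiff f) z w p * (1 / z * q ^ k))
      has_sum Y / (z - w)) (UNIV \<times> (UNIV :: nat set))"
    unfolding Y by blast
  then have all: "((\<lambda>(p, k). case p of (l, m) \<Rightarrow> monomial (cdiff f) z w (l - 1 - int k, m + int k) * (1 / z * q ^ k))
      has_sum Y / (z - w)) (UNIV \<times> (UNIV :: nat set))"
    by (simp add: case_prod_unfold \<phi>_def)
  show ?thesis
  proof (rule has_sum_SigmaD[OF all])
    fix p :: "int \<times> int"
    obtain l m where p: "p = (l, m)" by (cases p)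
    define K where "K = nat (M - m)"
    have "m + int K \<ge> M" unfolding K_def by linarith
    with f have fl: "f l m = (\<Sum>k<K. cdiff f (l - 1 - int k) (m + int k))"
      by (rule cdiff_telescope)
    have trm: "monomial (cdiff f) z w (l - 1 - int k, m + int k) * (1 / z * q ^ k) =
        cdiff f (l - 1 - int k) (m + int k) * z powi (- l - 1) * w powi (- m - 1)" for k
    proof -
      have "z powi (- (l - 1 - int k) - 1) = z powi (- l - 1) * z * z ^ k"
      proof -
        have "z powi (- (l - 1 - int k) - 1) = z powi ((- l - 1) + (1 + int k))"
          by (simp add: algebra_simps)
        also have "\<dots> = z powi (- l - 1) * z powi (1 + int k)"
          using z by (intro power_int_add) simp
        also have "z powi (1 + int k) = z * z ^ k"
          using z by (subst power_int_add) auto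
        finally show ?thesis by (simp only: mult.assoc)
      qed
      moreover have "w powi (- m - 1) = w powi (- (m + int k) - 1) * w ^ k"
      proof -
        have "- m - 1 = (- (m + int k) - 1) + int k" by simp
        then have "w powi (- m - 1) = w powi ((- (m + int k) - 1) + int k)" by (rule arg_cong)
        also have "\<dots> = w powi (- (m + int k) - 1) * w powi (int k)"
          using zw by (intro power_int_add) simp
        finally show ?thesis by simp
      qed
      ultimately show ?thesis using z by (simp add: monomial_def q_def field_simps)
    qed
    show "((\<lambda>k. case (p, k) of (p, k) \<Rightarrow> case p of (l, m) \<Rightarrow>
        monomial (cdiff f) z w (l - 1 - int k, m + int k) * (1 / z * q ^ k)) has_sum monomial f z w p) UNIV"
    proof (rule has_sum_finite_neutralI[of "{..<K}"])
      show "monomial f z w p = (\<Sum>k<K. case (p, k) of (p, k) \<Rightarrow> case p of (l, m) \<Rightarrow>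
        monomial (cdiff f) z w (l - 1 - int k, m + int k) * (1 / z * q ^ k))"
        unfolding p prod.case trm
        unfolding monomial_def prod.case sum_distrib_right[symmetric]
        by (simp only: fl)
      fix k assume "k \<in> UNIV - {..<K}"
      then have "cdiff f (l - 1 - int k) (m + int k) = 0"
        by (auto simp: K_def cdiff_apply intro!: f simp: f)
      then show "(case (p, k) of (p, k) \<Rightarrow> case p of (l, m) \<Rightarrow>
        monomial (cdiff f) z w (l - 1 - int k, m + int k) * (1 / z * q ^ k)) = 0"
        unfolding p prod.case trm by simp
    qed auto
  qed
qed

lemma has_sum_rational:
  assumes "\<And>l m. m \<ge> M \<Longrightarrow> f l m = 0" and "finite S"
    and "\<And>l m. (l, m) \<notin> S \<Longrightarrow> (cdiff ^^ N) f l m = 0" and "norm w < norm z" "w \<noteq> 0"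
  shows "(monomial f z w has_sum (\<Sum>p\<in>S. monomial ((cdiff ^^ N) f) z w p) / (z - w) ^ N) UNIV"
  using assms(1,3)
proof (induction N arbitrary: f)
  case 0
  then show ?case
    by (intro has_sum_finite_neutralI[OF \<open>finite S\<close>]) (auto simp: monomial_def)
next
  case (Suc N)
  have "(monomial (cdiff f) z w has_sum
      (\<Sum>p\<in>S. monomial ((cdiff ^^ N) (cdiff f)) z w p) / (z - w) ^ N) UNIV"
  proof (rule Suc.IH)
    show "cdiff f l m = 0" if "m \<ge> M" for l m using that by (simp add: cdiff_apply Suc.prems(1))
    show "(cdiff ^^ N) (cdiff f) l m = 0" if "(l, m) \<notin> S" for l m
      using Suc.prems(2)[OF that] by (simp only: funpow_Suc_right o_apply)
  qed
  from has_sum_divide_diff[OF Suc.prems(1) this assms(4,5)]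
  show ?case by (simp only: funpow_Suc_right o_apply power_Suc2 divide_divide_eq_left)
qed

lemma cdiff_swap: "(cdiff ^^ N) (\<lambda>m l. f l m) m l = (- 1) ^ N * (cdiff ^^ N) f l m"
proof (induction N arbitrary: l m)
  case (Suc N)
  have "(cdiff ^^ Suc N) g l m = (cdiff ^^ N) g (l + 1) m - (cdiff ^^ N) g l (m + 1)" for g l m
    by (simp add: cdiff_apply)
  then show ?case by (simp only: Suc) (simp add: algebra_simps)
qed simp

lemma cdiff_cinner: "(cdiff ^^ N) (\<lambda>l m. cinner (F l m) d) l m = cinner ((zw_mult ^^ N) F l m) d"
  by (induction N arbitrary: l m) (simp_all add: cdiff_apply zw_mult_def cinner_diff_left)

lemma cdiff_support:
  assumes "\<And>l m. R < \<bar>l + m\<bar> \<Longrightarrow> f l m = 0" "R + int N < \<bar>l + m\<bar>"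
  shows "(cdiff ^^ N) f l m = 0"
  using assms(2)
proof (induction N arbitrary: l m)
  case (Suc N)
  have "(cdiff ^^ N) f (l + 1) m = 0" "(cdiff ^^ N) f l (m + 1) = 0"
    by (rule Suc.IH, use Suc.prems in simp)+
  moreover have "(cdiff ^^ Suc N) f l m = (cdiff ^^ N) f (l + 1) m - (cdiff ^^ N) f l (m + 1)"
    by (simp add: cdiff_apply)
  ultimately show ?case by simp
qed (simp add: assms(1))

lemma cdiff_vanish:
  assumes "\<And>l m. m \<ge> M \<Longrightarrow> f l m = 0" "m \<ge> M" shows "(cdiff ^^ N) f l m = 0"
  using assms(2) by (induction N arbitrary: l m) (simp_all add: cdiff_apply assms(1))

text \<open>After multiplication by \<open>(z - w)^N\<close> both orderings have the same
  coefficients. These vanish for large \<open>m\<close> by the first ordering, for large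
  \<open>l\<close> by the second, and for large \<open>l + m\<close> in absolute value by
  \<open>bounded\<close>; what remains is a Laurent polynomial. It depends on \<open>c\<close> and
  \<open>d\<close>, but \<open>N\<close> does not.\<close>

lemma local_if_mutually_local:
  fixes A B :: "'h::prehilbert modes"
  assumes A: "is_field A" and B: "is_field B" and AB: "mutually_local A B"
    and bounded: "\<And>c d. \<exists>R. \<forall>l m. R < \<bar>l + m\<bar> \<longrightarrow>
       cinner (A l (B m c)) d = 0 \<and> cinner (B m (A l c)) d = 0"
  shows "local 0 A B"
proof -
  obtain N where N: "\<And>v. (zw_mult ^^ N) (\<lambda>l m. A l (B m v) - B m (A l v)) = (\<lambda>l m. 0)"
    using AB unfolding mutually_local_def by blast
  note A0 = field_0[OF A]
  note B0 = field_0[OF B]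
  show ?thesis
    unfolding local_def
  proof (intro exI[of _ N] allI)
    fix c d
    obtain R where R: "\<And>l m. R < \<bar>l + m\<bar> \<Longrightarrow> cinner (A l (B m c)) d = 0"
        "\<And>l m. R < \<bar>l + m\<bar> \<Longrightarrow> cinner (B m (A l c)) d = 0"
      using bounded[of c d] by blast
    obtain M where M: "\<And>m. m \<ge> M \<Longrightarrow> B m c = 0" using is_field_vanish[OF B, of c] by blast
    obtain M' where M': "\<And>l. l \<ge> M' \<Longrightarrow> A l c = 0" using is_field_vanish[OF A, of c] by blast
    define f g where "f l m = cinner (A l (B m c)) d" and "g m l = cinner (B m (A l c)) d" for l m
    have fg: "(cdiff ^^ N) f l m = (cdiff ^^ N) (\<lambda>l m. g m l) l m" for l m
    proof -
      have "(zw_mult ^^ N) (\<lambda>l m. A l (B m c)) = (zw_mult ^^ N) (\<lambda>l m. B m (A l c))"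
        using N[of c] unfolding zw_mult_diff by (simp add: fun_eq_iff)
      then show ?thesis unfolding f_def g_def cdiff_cinner by simp
    qed
    have f0: "f l m = 0" if "m \<ge> M" for l m using that by (simp add: f_def M A0 cinner_0_left)
    have g0: "g m l = 0" if "l \<ge> M'" for l m using that by (simp add: g_def M' B0 cinner_0_left)
    define P where "P = (cdiff ^^ N) f"
    \<comment> \<open>For \<open>l < M'\<close>, \<open>m < M\<close> and \<open>l + m\<close> at
      least \<open>- R - N\<close>, each index is bounded below by means of the upper bound of the
      other.\<close>
    define S where "S = {- R - int N - M..M'} \<times> {- R - int N - M'..M}"
    have P0: "P l m = 0" if "(l, m) \<notin> S" for l m
    proof (cases "l \<ge> M' \<or> m \<ge> M")
      case True
      then show ?thesis
      proof
        assume "m \<ge> M" then show ?thesis unfolding P_def by (intro cdiff_vanish[of M] f0)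
      next
        assume "l \<ge> M'"
        then have "(cdiff ^^ N) g m l = 0" by (intro cdiff_vanish[of M'] g0)
        then show ?thesis unfolding P_def fg cdiff_swap[of N g] by simp
      qed
    next
      case False
      then have "R + int N < \<bar>l + m\<bar>" using that unfolding S_def by auto
      then show ?thesis unfolding P_def by (intro cdiff_support[of R]) (simp_all add: f_def R)
    qed
    have S: "finite S" by (simp add: S_def)
    define F where "F = (\<lambda>(l, m). (- l - 1, - m - 1 :: int)) ` S"
    define k where "k = (\<lambda>(i, j). P (- i - 1) (- j - 1))"
    define X where "X = (\<lambda>z w. (\<Sum>(i, j)\<in>F. k (i, j) * z powi i * w powi j) / (z - w) ^ N)"
    have inj: "inj_on (\<lambda>(l, m). (- l - 1, - m - 1 :: int)) S" by (auto simp: inj_on_def)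
    have X_eq: "X z w = (\<Sum>p\<in>S. monomial P z w p) / (z - w) ^ N" for z w
      unfolding X_def F_def sum.reindex[OF inj]
      by (simp add: k_def monomial_def case_prod_unfold o_def)
    have 0: "laurent_pole N X"
      unfolding laurent_pole_def X_def using S by (auto simp: F_def)
    have 1: "((\<lambda>(m, n). cinner (A m (B n c)) d * z powi (- m - 1) * w powi (- n - 1))
           has_sum X z w) UNIV" if "norm z > norm w" "w \<noteq> 0" for z w
    proof -
      have "(monomial f z w has_sum X z w) UNIV"
        unfolding X_eq P_def
        by (rule has_sum_rational[OF f0 S _ that]) (simp_all add: P0[unfolded P_def])
      then show ?thesis by (simp add: monomial_def f_def)
    qed
    have 2: "((\<lambda>(m, n). eps_sign 0 * cinner (B n (A m c)) d * z powi (- m - 1) * w powi (- n - 1))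
           has_sum X z w) UNIV" if zw: "norm w > norm z" "z \<noteq> 0" for z w
    proof -
      define S' where "S' = prod.swap ` S"
      have "(monomial g w z has_sum (\<Sum>p\<in>S'. monomial ((cdiff ^^ N) g) w z p) / (w - z) ^ N) UNIV"
      proof (rule has_sum_rational[OF g0 _ _ zw])
        show "finite S'" using S by (simp add: S'_def)
        fix m l assume "(m, l) \<notin> S'"
        then have "(l, m) \<notin> S" by (force simp: S'_def)
        then have "(- 1) ^ N * (cdiff ^^ N) g m l = 0"
          using P0[of l m] unfolding P_def fg cdiff_swap[of N g] by simp
        then show "(cdiff ^^ N) g m l = 0" by simp
      qed
      also have "(\<Sum>p\<in>S'. monomial ((cdiff ^^ N) g) w z p) = (- 1) ^ N * (\<Sum>p\<in>S. monomial P z w p)"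
      proof -
        have "(\<Sum>p\<in>S'. monomial ((cdiff ^^ N) g) w z p) = (\<Sum>p\<in>S. monomial ((cdiff ^^ N) g) w z (prod.swap p))"
          unfolding S'_def by (subst sum.reindex) (auto simp: o_def)
        also have "\<dots> = (\<Sum>p\<in>S. (- 1) ^ N * monomial P z w p)"
          by (rule sum.cong[OF refl])
            (auto simp: monomial_def P_def fg cdiff_swap[of N g] mult_ac simp flip: power_mult_distrib)
        finally show ?thesis by (simp add: sum_distrib_left)
      qed
      also have "(- 1) ^ N * (\<Sum>p\<in>S. monomial P z w p) / (w - z) ^ N = X z w"
      proof -
        \<comment> \<open>This sign cancels the one that \<open>cdiff_swap\<close> has put into the
          numerator.\<close>
        have "(w - z) ^ N = (- 1) ^ N * (z - w) ^ N" by (simp flip: power_mult_distrib)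
        then show ?thesis unfolding X_eq by simp
      qed
      finally have "(monomial g w z has_sum X z w) UNIV" .
      then have "((\<lambda>(l, m). monomial g w z (m, l)) has_sum X z w) UNIV"
        using has_sum_swap[where f = "monomial g w z" and S = "X z w" and A = UNIV and B = UNIV] by simp
      then show ?thesis
        by (simp add: monomial_def g_def eps_sign_def case_prod_unfold mult_ac)
    qed
    show "\<exists>X. laurent_pole N X \<and>
        (\<forall>z w. norm z > norm w \<and> w \<noteq> 0 \<longrightarrow>
          ((\<lambda>(m, n). cinner (A m (B n c)) d * z powi (- m - 1) * w powi (- n - 1)) has_sum X z w) UNIV) \<and>
        (\<forall>z w. norm w > norm z \<and> z \<noteq> 0 \<longrightarrow>
          ((\<lambda>(m, n). eps_sign 0 * cinner (B n (A m c)) d * z powi (- m - 1) * w powi (- n - 1))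
            has_sum X z w) UNIV)"
      by (intro exI[of _ X] conjI allI impI 0; elim conjE; rule 1 2; assumption)
  qed
qed

section \<open>The vacuum representation\<close>

lemma cinner_scaleC_right: "cinner (u::'h::prehilbert) (c *\<^sub>C v) = cnj c * cinner u v"
  by (subst (1 2) cinner_commute) (simp add: cinner_scaleC_left)

lemma cinner_add_right: "cinner (u::'h::prehilbert) (v + w) = cinner u v + cinner u w"
  by (subst (1 2 3) cinner_commute) (simp add: cinner_add_left)

lemma cinner_0_right: "cinner (u::'h::prehilbert) 0 = 0"
  by (subst cinner_commute) (simp add: cinner_0_left)

lemma cinner_sum_left: "cinner (\<Sum>i\<in>I. x i) (v::'h::prehilbert) = (\<Sum>i\<in>I. cinner (x i) v)"
  by (induction I rule: infinite_finite_induct) (simp_all add: cinner_0_left cinner_add_left)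

lemma cinner_sum_right: "cinner (v::'h::prehilbert) (\<Sum>i\<in>I. x i) = (\<Sum>i\<in>I. cinner v (x i))"
  by (induction I rule: infinite_finite_induct) (simp_all add: cinner_0_right cinner_add_right)

lemma cinner_eq_0: "cinner x (x::'h::prehilbert) = 0 \<Longrightarrow> x = 0"
  using cinner_pos[of x] by (metis less_irrefl zero_complex.sel(1))

text \<open>Of the Lie algebra, the antisymmetry and the contraction of its structure constants are
  retained. \<open>real\<close> makes \<open>Lop n\<close> adjoint to \<open>Lop (- n)\<close>, and
  \<open>nz\<close> permits the division in \<open>Lop\<close>.\<close>

locale vacuum_module =
  fixes \<Gamma> :: "'i::finite \<Rightarrow> 'i \<Rightarrow> 'i \<Rightarrow> real" and \<l> g :: complex
    and J :: "'i \<Rightarrow> int \<Rightarrow> 'h::prehilbert \<Rightarrow> 'h" and K :: "'h \<Rightarrow> 'h" and \<Omega> :: 'h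
  assumes rep: "vacuum_rep \<Gamma> \<l> J K \<Omega>"
    and anti: "\<Gamma> a b c = - \<Gamma> b a c" "\<Gamma> a b c = - \<Gamma> a c b"
    and casimir: "(\<Sum>a\<in>UNIV. \<Sum>c\<in>UNIV. complex_of_real (\<Gamma> b a c * \<Gamma> d a c)) =
      (if b = d then 2 * g else 0)"
    and real: "\<l> \<in> \<real>" "g \<in> \<real>" and nz: "\<l> + g \<noteq> 0"
begin

lemma J_linear: "clinear (J a n)"
  and adj: "cinner (J a n u) v = cinner u (J a (- n) v)"
  and irred: "acts_irreducibly (insert K {J a n | a n. True})"
  and lowest: "{v. \<forall>a n. n > 0 \<longrightarrow> J a n v = 0} = complex_vector.span {\<Omega>}"
  and J_zero_vac: "J a 0 \<Omega> = 0"
  and vac_norm: "cinner \<Omega> \<Omega> = 1"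
  and K_scalar: "K v = \<l> *\<^sub>C v"
  using rep unfolding vacuum_rep_def boson_rep_def by blast+

lemma J_comm: "J a m (J b n v) - J b n (J a m v) =
    \<i> *\<^sub>C (\<Sum>c\<in>UNIV. of_real (\<Gamma> a b c) *\<^sub>C J c (m + n) v)
    + (if a = b \<and> m + n = 0 then (of_int m * \<l>) *\<^sub>C v else 0)"
  using rep unfolding vacuum_rep_def boson_rep_def by (simp add: scaleC_scaleC)

lemmas J_add = clinear_add[OF J_linear]
lemmas J_scale = clinear_scale[OF J_linear]
lemmas J_0 = clinear_0[OF J_linear]
lemmas J_diff = clinear_diff[OF J_linear]
lemmas J_sum = clinear_sum[OF J_linear]

lemma J_vac: "n \<ge> 0 \<Longrightarrow> J a n \<Omega> = 0"
proof (cases "n = 0")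
  case False
  assume "n \<ge> 0"
  have "\<Omega> \<in> {v. \<forall>a n. n > 0 \<longrightarrow> J a n v = 0}"
    unfolding lowest by (rule complex_vector.span_base) simp
  then show ?thesis using False \<open>n \<ge> 0\<close> by simp
qed (simp add: J_zero_vac)

lemma vac_ne_0: "\<Omega> \<noteq> 0"
  using vac_norm cinner_0_left by (metis zero_neq_one)

text \<open>The number counts energy: it turns out to be the eigenvalue of
  \<open>Lop 0\<close>.\<close>

inductive is_monomial :: "nat \<Rightarrow> 'h \<Rightarrow> bool" where
  vac: "is_monomial 0 \<Omega>"
| step: "is_monomial k v \<Longrightarrow> n \<ge> 1 \<Longrightarrow> is_monomial (k + n) (J a (- int n) v)"

definition "monomials = {v. \<exists>k. is_monomial k v}"

lemma span_image:
  assumes "clinear f" "\<And>v. v \<in> S \<Longrightarrow> f v \<in> complex_vector.span S'" "v \<in> complex_vector.span S"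
  shows "f v \<in> complex_vector.span S'"
  using assms(3)
proof (induction v rule: complex_vector.span_induct_alt)
  case base
  then show ?case by (simp add: clinear_0[OF assms(1)] complex_vector.span_zero)
next
  case (step c x y)
  then show ?case
    by (simp add: clinear_add[OF assms(1)] clinear_scale[OF assms(1)] assms(2)
        complex_vector.span_add complex_vector.span_scale)
qed

lemma J_neg_span:
  assumes "v \<in> complex_vector.span monomials" "n < 0" shows "J a n v \<in> complex_vector.span monomials"
proof (rule span_image[OF J_linear _ assms(1)])
  fix v assume "v \<in> monomials"
  then obtain k where "is_monomial k v" by (auto simp: monomials_def)
  moreover have "1 \<le> nat (- n)" using assms(2) by linarith
  ultimately have "is_monomial (k + nat (- n)) (J a (- int (nat (- n))) v)" by (rule is_monomial.step)
  with assms(2)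
  have "J a n v \<in> monomials" by (auto simp: monomials_def)
  then show "J a n v \<in> complex_vector.span monomials" by (rule complex_vector.span_base)
qed

text \<open>\<open>J a n\<close> is commuted to the right through the creating modes. Each
  commutator is a combination of modes applied to a shorter monomial, and at \<open>\<Omega>\<close>
  the nonnegative modes vanish.\<close>

lemma J_span_mono: "is_monomial k v \<Longrightarrow> J a n v \<in> complex_vector.span monomials"
proof (induction arbitrary: a n rule: is_monomial.induct)
  case vac
  have "\<Omega> \<in> complex_vector.span monomials"
    by (rule complex_vector.span_base) (use is_monomial.vac in \<open>auto simp: monomials_def\<close>)
  then show ?case using J_neg_span J_vac by (cases "n < 0") (auto simp: complex_vector.span_zero)
next
  case (step k v n' b)
  have v: "v \<in> complex_vector.span monomials"
    using step.hyps(1) by (intro complex_vector.span_base) (auto simp: monomials_def)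
  have "J a n (J b (- int n') v) = J b (- int n') (J a n v) +
    (\<i> *\<^sub>C (\<Sum>c\<in>UNIV. of_real (\<Gamma> a b c) *\<^sub>C J c (n + - int n') v)
    + (if a = b \<and> n + - int n' = 0 then (of_int n * \<l>) *\<^sub>C v else 0))"
    using J_comm[of a n b "- int n'" v] by (simp add: algebra_simps)
  moreover have "J b (- int n') (J a n v) \<in> complex_vector.span monomials"
    using step.hyps(2) by (intro J_neg_span[OF step.IH]) simp
  ultimately show ?case
    using step.IH v by (simp add: complex_vector.span_add complex_vector.span_scale
        complex_vector.span_sum complex_vector.span_zero)
qed

text \<open>By \<open>J_span_mono\<close> the span is an invariant subspace, and it contains
  \<open>\<Omega>\<close>; irreducibility does the rest.\<close>

lemma span_monomials: "complex_vector.span monomials = UNIV"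
proof -
  have "complex_vector.span monomials = {0} \<or> complex_vector.span monomials = UNIV"
  proof -
    have "J a n v \<in> complex_vector.span monomials" if "v \<in> complex_vector.span monomials" for a n v
      by (rule span_image[OF J_linear _ that]) (auto simp: monomials_def J_span_mono[unfolded monomials_def])
    then have "\<forall>T\<in>insert K {J a n | a n. True}. T ` complex_vector.span monomials \<subseteq> complex_vector.span monomials"
      by (auto simp: K_scalar complex_vector.span_scale)
    then show ?thesis using irred unfolding acts_irreducibly_def by simp
  qed
  moreover have "\<Omega> \<in> complex_vector.span monomials"
    by (rule complex_vector.span_base) (use is_monomial.vac in \<open>auto simp: monomials_def\<close>)
  ultimately show ?thesis using vac_ne_0 by auto
qed

lemmas monomials_induct = span_UNIV_induct[OF span_monomials]

lemma J_mono_vanish: "is_monomial k v \<Longrightarrow> n > int k \<Longrightarrow> J a n v = 0"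
proof (induction arbitrary: a n rule: is_monomial.induct)
  case vac
  then show ?case by (simp add: J_vac)
next
  case (step k v n' b)
  then have "J a n (J b (- int n') v) = 0"
    using J_comm[of a n b "- int n'" v] by (simp add: J_0)
  then show ?case .
qed

lemma J_vanish: "\<exists>M. \<forall>m\<ge>M. \<forall>a. J a m v = 0"
proof (induction v rule: monomials_induct)
  case 1
  then show ?case by (simp add: J_0)
next
  case (2 c x y)
  then obtain k M where "is_monomial k x" "\<forall>m\<ge>M. \<forall>a. J a m y = 0" by (auto simp: monomials_def)
  then have "\<forall>m\<ge>max M (int k + 1). \<forall>a. J a m (c *\<^sub>C x + y) = 0"
    by (simp add: J_add J_scale J_mono_vanish)
  then show ?case by blast
qed

lemma is_field_J: "is_field (J a)"
  unfolding is_field_def using J_linear J_vanish by blast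

subsection \<open>The Sugawara operators\<close>

text \<open>The modes of the normally ordered sum of squares, indexed as modes of a field; the
  Virasoro index is smaller by one, hence \<open>n + 1\<close> in \<open>Lop\<close>.\<close>

definition sug :: "int \<Rightarrow> 'h \<Rightarrow> 'h" where
  "sug m v = (\<Sum>a\<in>UNIV. field_prod 0 (J a) (J a) (- 1) m v)"

lemma sum_below:
  fixes f :: "int \<Rightarrow> 'h"
  assumes "N \<le> k" shows "(\<Sum>p<nat (k - N). f (k - 1 - int p)) = (\<Sum>r\<in>{N..<k}. f r)"
  by (rule sum.reindex_bij_witness[where i = "\<lambda>r. nat (k - 1 - r)" and j = "\<lambda>p. k - 1 - int p"])
    (use assms in auto)

text \<open>Because both factors are equal, the two halves of the normally ordered product have the
  same summand and differ only in the ranges \<open>r < 0\<close> and \<open>r < m\<close>. Any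
  sufficiently low \<open>N\<close> is allowed, so that sums for different vectors can share a
  cutoff.\<close>

lemma sug_eq:
  assumes N: "\<And>a r. r < N \<Longrightarrow> J a (m - 1 - r) v = 0" "N \<le> 0" "N \<le> m"
  shows "sug m v = (\<Sum>a\<in>UNIV. (\<Sum>r\<in>{N..<0}. J a r (J a (m - 1 - r) v)) +
     (\<Sum>r\<in>{N..<m}. J a r (J a (m - 1 - r) v)))"
  unfolding sug_def
proof (rule sum.cong[OF refl])
  fix a
  have c: "pow_coeff (- 1) p = 1" for p by (simp add: pow_coeff_neg)
  have van: "J a k v = 0" if "k \<ge> m - N" for k
    using N(1)[of "m - 1 - k" a] that by simp
  have "zw_pow (- 1) (\<lambda>k j. J a k (J a j v)) 0 m =
      (\<Sum>p<nat (- N). pow_coeff (- 1) p *\<^sub>C J a (0 + - 1 - int p) (J a (m + int p) v))"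
    by (rule zw_pow_eq_sum[of "m - N"]) (use N in \<open>auto simp: van J_0\<close>)
  also have "\<dots> = (\<Sum>p<nat (0 - N). J a (0 - 1 - int p) (J a (m - 1 - (0 - 1 - int p)) v))"
    by (simp add: c scaleC_one algebra_simps)
  also have "\<dots> = (\<Sum>r\<in>{N..<0}. J a r (J a (m - 1 - r) v))"
    by (rule sum_below) (use N in simp)
  finally have 1: "zw_pow (- 1) (\<lambda>k j. J a k (J a j v)) 0 m = \<dots>" .
  have "zw_pow (- 1) (\<lambda>k j. J a k (J a j v)) m 0 =
      (\<Sum>p<nat (m - N). pow_coeff (- 1) p *\<^sub>C J a (m + - 1 - int p) (J a (0 + int p) v))"
    by (rule zw_pow_eq_sum[of "m - N"]) (use N in \<open>auto simp: van J_0\<close>)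
  also have "\<dots> = (\<Sum>p<nat (m - N). J a (m - 1 - int p) (J a (m - 1 - (m - 1 - int p)) v))"
    by (simp add: c scaleC_one algebra_simps)
  also have "\<dots> = (\<Sum>r\<in>{N..<m}. J a r (J a (m - 1 - r) v))"
    by (rule sum_below) (use N in simp)
  finally have 2: "zw_pow (- 1) (\<lambda>k j. J a k (J a j v)) m 0 = \<dots>" .
  show "field_prod 0 (J a) (J a) (- 1) m v = (\<Sum>r\<in>{N..<0}. J a r (J a (m - 1 - r) v)) +
     (\<Sum>r\<in>{N..<m}. J a r (J a (m - 1 - r) v))"
    unfolding field_prod_eq[OF is_field_J is_field_J] prod_kernel_def 1 2
    by (simp add: scaleC_one)
qed

lemma Gamma_cyclic: "\<Gamma> a c d = \<Gamma> d a c"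
  using anti(1)[of a d c] anti(2)[of a c d] by simp

lemma Gamma_diag': "\<Gamma> a a b = 0"
  using anti(1)[of a a b] by simp

lemma Gamma_diag: "\<Gamma> b a a = 0"
  using anti(2)[of b a a] by simp

lemma sum_if_eq: "(\<Sum>a\<in>UNIV. if b = a \<and> P a then f a else 0) = (if P b then f b else (0::'h))"
  for b :: 'i
proof -
  have "(\<Sum>a\<in>UNIV. if b = a \<and> P a then f a else 0) = (\<Sum>a\<in>UNIV. if b = a then if P a then f a else 0 else 0)"
    by (rule sum.cong) auto
  then show ?thesis by simp
qed

text \<open>The bilinear terms that arise when \<open>J b n\<close> is commuted past the squares in
  the Sugawara sum.\<close>

definition twist :: "'i \<Rightarrow> 'h \<Rightarrow> int \<Rightarrow> int \<Rightarrow> 'h" where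
  "twist b v s r = (\<Sum>a\<in>UNIV. \<Sum>c\<in>UNIV. of_real (\<Gamma> b a c) *\<^sub>C J a r (J c (s - r) v))"

text \<open>Antisymmetry turns the sum of the two terms into a commutator, whose contraction with
  the structure constants gives \<open>2 * g\<close>. The central term drops out because it pairs
  equal indices. This is where \<open>g\<close> joins the level.\<close>

lemma twist_reflect: "twist b v s r + twist b v s (s - r) = (2 * \<i> * g) *\<^sub>C J b s v"
proof -
  have "twist b v s (s - r) = (\<Sum>a\<in>UNIV. \<Sum>c\<in>UNIV. of_real (\<Gamma> b c a) *\<^sub>C J c (s - r) (J a r v))"
    unfolding twist_def by (subst sum.swap) simp
  also have "\<dots> = - (\<Sum>a\<in>UNIV. \<Sum>c\<in>UNIV. of_real (\<Gamma> b a c) *\<^sub>C J c (s - r) (J a r v))"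
  proof -
    have "of_real (\<Gamma> b c a) *\<^sub>C x = - (of_real (\<Gamma> b a c) *\<^sub>C x)" for a c and x :: 'h
      using anti(2)[of b c a] by simp
    then show ?thesis unfolding sum_negf[symmetric] by (intro sum.cong refl)
  qed
  finally have "twist b v s r + twist b v s (s - r) = (\<Sum>a\<in>UNIV. \<Sum>c\<in>UNIV. of_real (\<Gamma> b a c) *\<^sub>C
      (J a r (J c (s - r) v) - J c (s - r) (J a r v)))"
    by (simp add: twist_def scaleC_diff_right sum_subtractf)
  also have "\<dots> = (\<Sum>a\<in>UNIV. \<Sum>c\<in>UNIV. \<Sum>d\<in>UNIV. (\<i> * of_real (\<Gamma> b a c * \<Gamma> d a c)) *\<^sub>C J d s v)"
  proof (intro sum.cong refl)
    fix a c
    have "of_real (\<Gamma> b a c) *\<^sub>C (if a = c \<and> r + (s - r) = 0 then (of_int r * \<l>) *\<^sub>C v else 0) = 0"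
      by (simp add: Gamma_diag)
    then show "of_real (\<Gamma> b a c) *\<^sub>C (J a r (J c (s - r) v) - J c (s - r) (J a r v)) =
        (\<Sum>d\<in>UNIV. (\<i> * of_real (\<Gamma> b a c * \<Gamma> d a c)) *\<^sub>C J d s v)"
      unfolding J_comm
      by (simp only: complex_vector.scale_right_distrib)
        (simp add: scaleC_sum_right scaleC_scaleC Gamma_cyclic[of a c] mult_ac)
  qed
  also have "\<dots> = (\<Sum>d\<in>UNIV. \<Sum>a\<in>UNIV. \<Sum>c\<in>UNIV. (\<i> * of_real (\<Gamma> b a c * \<Gamma> d a c)) *\<^sub>C J d s v)"
    by (subst (2) sum.swap, subst sum.swap, rule refl)
  also have "\<dots> = (\<Sum>d\<in>UNIV. (\<i> * (if b = d then 2 * g else 0)) *\<^sub>C J d s v)"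
    unfolding casimir[symmetric]
    by (simp only: scaleC_sum_left[symmetric] sum_distrib_left)
  also have "\<dots> = (\<Sum>d\<in>UNIV. if b = d then (2 * \<i> * g) *\<^sub>C J d s v else 0)"
    by (rule sum.cong) auto
  finally show ?thesis by simp
qed

text \<open>Commuting \<open>J b n\<close> past either factor gives a bilinear sum; after renaming
  indices, antisymmetry makes them the same \<open>twist\<close> at \<open>r\<close> and
  \<open>r + n\<close>, with opposite signs. The central terms appear only at the two listed values
  of \<open>r\<close>.\<close>

lemma J_sug_term:
  "(\<Sum>a\<in>UNIV. J b n (J a r (J a (m - 1 - r) v)) - J a r (J a (m - 1 - r) (J b n v))) =
    \<i> *\<^sub>C (twist b v (n + m - 1) r - twist b v (n + m - 1) (r + n))
    + (of_int n * \<l> * (of_bool (r = - n) + of_bool (r = n + m - 1))) *\<^sub>C J b (n + m - 1) v"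
proof -
  have trm: "J b n (J a r (J a (m - 1 - r) v)) - J a r (J a (m - 1 - r) (J b n v)) =
     \<i> *\<^sub>C (\<Sum>c\<in>UNIV. of_real (\<Gamma> b a c) *\<^sub>C J c (n + r) (J a (m - 1 - r) v))
     + (if b = a \<and> n + r = 0 then (of_int n * \<l>) *\<^sub>C J a (m - 1 - r) v else 0)
     + (\<i> *\<^sub>C (\<Sum>c\<in>UNIV. of_real (\<Gamma> b a c) *\<^sub>C J a r (J c (n + m - 1 - r) v))
     + (if b = a \<and> n + (m - 1 - r) = 0 then (of_int n * \<l>) *\<^sub>C J a r v else 0))" for a
  proof -
    have "J b n (J a r (J a (m - 1 - r) v)) - J a r (J a (m - 1 - r) (J b n v)) =
      (J b n (J a r (J a (m - 1 - r) v)) - J a r (J b n (J a (m - 1 - r) v)))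
      + J a r (J b n (J a (m - 1 - r) v) - J a (m - 1 - r) (J b n v))"
      by (simp add: J_diff)
    then show ?thesis
      unfolding J_comm by (simp add: J_add J_scale J_sum J_0 algebra_simps if_distrib cong: if_cong)
  qed
  have "(\<Sum>a\<in>UNIV. \<i> *\<^sub>C (\<Sum>c\<in>UNIV. of_real (\<Gamma> b a c) *\<^sub>C J c (n + r) (J a (m - 1 - r) v))) =
      - \<i> *\<^sub>C twist b v (n + m - 1) (r + n)"
    unfolding twist_def scaleC_sum_right[symmetric]
    by (subst sum.swap, subst anti(2))
      (simp add: sum_negf scaleC_sum_right[symmetric] algebra_simps)
  moreover have "(\<Sum>a\<in>UNIV. \<i> *\<^sub>C (\<Sum>c\<in>UNIV. of_real (\<Gamma> b a c) *\<^sub>C J a r (J c (n + m - 1 - r) v))) =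
      \<i> *\<^sub>C twist b v (n + m - 1) r"
    unfolding twist_def scaleC_sum_right[symmetric] by simp
  ultimately show ?thesis
    unfolding trm sum.distrib sum_if_eq
    by (auto simp: scaleC_diff_right scaleC_add_left algebra_simps
        add_eq_0_iff of_bool_def)
qed

lemma sum_shift_int: "(\<Sum>r\<in>{a..<b}. f (r + n)) = (\<Sum>r\<in>{a + n..<b + n}. f r)"
  for f :: "int \<Rightarrow> 'h"
  by (rule sum.reindex_bij_witness[where i = "\<lambda>r. r - n" and j = "\<lambda>r. r + n"]) auto

lemma sum_extend_below:
  fixes f :: "int \<Rightarrow> 'h"
  assumes "\<And>r. r < N \<Longrightarrow> f r = 0" "a \<le> N" "b \<le> N"
  shows "(\<Sum>r\<in>{a..<k}. f r) = (\<Sum>r\<in>{b..<k}. f r)"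
proof -
  have "(\<Sum>r\<in>{a..<k}. f r) = (\<Sum>r\<in>{N..<k}. f r)" if "a \<le> N" for a
    by (rule sum.mono_neutral_right) (use that assms(1) in auto)
  from this[OF assms(2)] this[OF assms(3)] show ?thesis by (rule trans[OF _ sym])
qed

text \<open>Telescoping leaves, besides the central terms, the sums of \<open>twist\<close> over two intervals of
  length \<open>|n|\<close> that are exchanged by the reflection \<open>r \<mapsto> s - r\<close>.\<close>

lemma twist_telescope:
  assumes van: "\<And>r. r < N \<Longrightarrow> twist b v (n + m - 1) r = 0"
    and N: "N' \<le> N" "N' + n \<le> N" "N' \<le> 0" "N' \<le> m" "N' + n \<le> 0" "N' + n \<le> m"
  shows "(\<Sum>r\<in>{N'..<0}. twist b v (n + m - 1) r - twist b v (n + m - 1) (r + n)) +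
      (\<Sum>r\<in>{N'..<m}. twist b v (n + m - 1) r - twist b v (n + m - 1) (r + n)) =
    - (of_int n *\<^sub>C (2 * \<i> * g) *\<^sub>C J b (n + m - 1) v)"
proof -
  define T where "T = twist b v (n + m - 1)"
  define U where "U = (2 * \<i> * g) *\<^sub>C J b (n + m - 1) v"
  \<comment> \<open>All sums may start at this common point, because \<open>T\<close> vanishes below
    \<open>N\<close> and neither \<open>N'\<close> nor \<open>N' + n\<close> exceeds
    \<open>N\<close>.\<close>
  define M where "M = min N' (N' + n)"
  define S where "S k = (\<Sum>r\<in>{M..<k}. T r)" for k
  have refl: "T r + T (n + m - 1 - r) = U" for r
    unfolding T_def U_def by (rule twist_reflect)
  have diff: "(\<Sum>r\<in>{N'..<k}. T r - T (r + n)) = S k - S (k + n)" for k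
  proof -
    have "(\<Sum>r\<in>{N'..<k}. T r) = S k"
      unfolding S_def by (rule sum_extend_below[of N]) (use van N in \<open>auto simp: T_def M_def\<close>)
    moreover have "(\<Sum>r\<in>{N' + n..<k + n}. T r) = S (k + n)"
      unfolding S_def by (rule sum_extend_below[of N]) (use van N in \<open>auto simp: T_def M_def\<close>)
    ultimately show ?thesis by (simp add: sum_subtractf sum_shift_int)
  qed
  have split: "S k' - S k = (\<Sum>r\<in>{k..<k'}. T r)" if "M \<le> k" "k \<le> k'" for k k'
  proof -
    have "{M..<k'} = {M..<k} \<union> {k..<k'}" using that by auto
    then have "S k' = S k + (\<Sum>r\<in>{k..<k'}. T r)"
      unfolding S_def by (simp add: sum.union_disjoint)
    then show ?thesis by simp
  qed
  have reflect: "(\<Sum>r\<in>{m + a..<m + b}. T r) = (\<Sum>r\<in>{n - b..<n - a}. T (n + m - 1 - r))" for a b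
    by (rule sum.reindex_bij_witness[where i = "\<lambda>r. n + m - 1 - r" and j = "\<lambda>r. n + m - 1 - r"]) auto
  have const: "(\<Sum>r\<in>{a..<b}. T r) + (\<Sum>r\<in>{a..<b}. T (n + m - 1 - r)) = of_int (b - a) *\<^sub>C U"
    if "a \<le> b" for a b
    using that by (simp add: sum.distrib[symmetric] refl complex_vector.sum_constant_scale of_nat_nat)
  have M: "M \<le> 0" "M \<le> m" "M \<le> n" "M \<le> m + n" using N by (auto simp: M_def)
  have "(S 0 - S n) + (S m - S (m + n)) = - (of_int n *\<^sub>C U)"
  proof (cases "n \<ge> 0")
    case True
    have "S n - S 0 = (\<Sum>r\<in>{0..<n}. T r)" using M True by (intro split) auto
    moreover have "S (m + n) - S m = (\<Sum>r\<in>{m + 0..<m + n}. T r)" using split[of m "m + n"] M True by simp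
    ultimately have "(S n - S 0) + (S (m + n) - S m) = of_int n *\<^sub>C U"
      using const[of 0 n] True reflect[of 0 n] by simp
    then show ?thesis by (simp add: algebra_simps)
  next
    case False
    have "S 0 - S n = (\<Sum>r\<in>{n..<0}. T r)" using M False by (intro split) auto
    moreover have "S m - S (m + n) = (\<Sum>r\<in>{m + n..<m + 0}. T r)" using split[of "m + n" m] M False by simp
    ultimately show ?thesis
      using const[of n 0] False reflect[of n 0] by simp
  qed
  then show ?thesis
    unfolding T_def[symmetric] U_def[symmetric] diff by (simp add: algebra_simps)
qed

lemma twist_vanish:
  assumes "\<And>a k. k \<ge> M \<Longrightarrow> J a k v = 0" "r < s + 1 - M" shows "twist b v s r = 0"
  using assms by (simp add: twist_def J_0)

text \<open>The telescoped \<open>twist\<close> terms contribute \<open>2 * g * n\<close> and the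
  central terms \<open>2 * \<l> * n\<close>.\<close>

lemma J_sug_commutator:
  "J b n (sug m v) - sug m (J b n v) = (2 * (\<l> + g) * of_int n) *\<^sub>C J b (n + m - 1) v"
proof -
  obtain M1 where M1: "\<And>a k. k \<ge> M1 \<Longrightarrow> J a k v = 0" using J_vanish[of v] by blast
  obtain M2 where M2: "\<And>a k. k \<ge> M2 \<Longrightarrow> J a k (J b n v) = 0" using J_vanish[of "J b n v"] by blast
  define N where "N = - (\<bar>M1\<bar> + \<bar>M2\<bar> + 2 * \<bar>m\<bar> + 2 * \<bar>n\<bar> + 2)"
  define s where "s = n + m - 1"
  define X where "X r = (\<Sum>a\<in>UNIV. J b n (J a r (J a (m - 1 - r) v)) - J a r (J a (m - 1 - r) (J b n v)))" for r
  have 1: "sug m v = (\<Sum>a\<in>UNIV. (\<Sum>r\<in>{N..<0}. J a r (J a (m - 1 - r) v)) +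
     (\<Sum>r\<in>{N..<m}. J a r (J a (m - 1 - r) v)))"
    by (rule sug_eq) (auto intro!: M1 simp: N_def)
  have 2: "sug m (J b n v) = (\<Sum>a\<in>UNIV. (\<Sum>r\<in>{N..<0}. J a r (J a (m - 1 - r) (J b n v))) +
     (\<Sum>r\<in>{N..<m}. J a r (J a (m - 1 - r) (J b n v))))"
    by (rule sug_eq) (auto intro!: M2 simp: N_def)
  have "J b n (sug m v) - sug m (J b n v) = (\<Sum>r\<in>{N..<0}. X r) + (\<Sum>r\<in>{N..<m}. X r)"
  proof -
    have "(\<Sum>r\<in>A. X r) = (\<Sum>a\<in>UNIV. (\<Sum>r\<in>A. J b n (J a r (J a (m - 1 - r) v))) -
        (\<Sum>r\<in>A. J a r (J a (m - 1 - r) (J b n v))))" for A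
      unfolding X_def by (subst sum.swap) (simp add: sum_subtractf)
    then show ?thesis
      unfolding 1 2 J_sum J_add by (simp add: sum.distrib sum_subtractf)
  qed
  also have "\<dots> = \<i> *\<^sub>C ((\<Sum>r\<in>{N..<0}. twist b v s r - twist b v s (r + n)) +
      (\<Sum>r\<in>{N..<m}. twist b v s r - twist b v s (r + n)))
    + ((of_int n * \<l>) * ((\<Sum>r\<in>{N..<0}. of_bool (r = - n) + of_bool (r = s)) +
      (\<Sum>r\<in>{N..<m}. of_bool (r = - n) + of_bool (r = s)))) *\<^sub>C J b s v"
    unfolding X_def J_sug_term s_def[symmetric]
    by (simp only: sum.distrib scaleC_sum_right[symmetric] scaleC_sum_left[symmetric]
        sum_distrib_left[symmetric] distrib_left scaleC_add_left scaleC_add_right) (simp add: algebra_simps)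
  also have "(\<Sum>r\<in>{N..<0}. twist b v s r - twist b v s (r + n)) +
      (\<Sum>r\<in>{N..<m}. twist b v s r - twist b v s (r + n)) =
      - (of_int n *\<^sub>C (2 * \<i> * g) *\<^sub>C J b s v)"
    unfolding s_def
    by (rule twist_telescope[of "n + m - M1"])
      (auto intro!: twist_vanish[OF M1] simp: N_def)
  \<comment> \<open>Exactly two of the four indicators survive: \<open>- n < 0\<close> holds iff
    \<open>s < m\<close> fails, and \<open>- n < m\<close> holds iff \<open>s < 0\<close>
    fails.\<close>
  also have "(\<Sum>r\<in>{N..<0}. of_bool (r = - n) + of_bool (r = s)) +
      (\<Sum>r\<in>{N..<m}. of_bool (r = - n) + of_bool (r = s)) = (2 :: complex)"
  proof -
    have "(\<Sum>r\<in>{N..<k}. of_bool (r = j) :: complex) = of_bool (j < k)" if "N \<le> j" for j k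
      using that by (simp add: of_bool_def sum.delta' flip: of_bool_def)
    moreover have "N \<le> - n" "N \<le> s" by (auto simp: N_def s_def)
    ultimately show ?thesis by (auto simp: sum.distrib s_def)
  qed
  finally show ?thesis
    by (simp add: s_def scaleC_scaleC algebra_simps scaleC_add_left)
qed

definition Lop :: "int \<Rightarrow> 'h \<Rightarrow> 'h" where
  "Lop n v = (1 / (2 * (\<l> + g))) *\<^sub>C sug (n + 1) v"

lemma sug_linear: "clinear (sug m)"
proof -
  have "clinear (field_prod 0 (J a) (J a) (- 1) m)" for a
    by (intro is_field_linear is_field_prod is_field_J)
  then show ?thesis
    by (simp add: clinear_iff sug_def sum.distrib scaleC_sum_right)
qed

lemma L_linear: "clinear (Lop n)"
  using sug_linear[of "n + 1"]
  by (simp add: clinear_iff Lop_def scaleC_add_right scaleC_scaleC mult.commute)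

lemmas L_add = clinear_add[OF L_linear]
lemmas L_scale = clinear_scale[OF L_linear]
lemmas L_0 = clinear_0[OF L_linear]

lemma L_J: "Lop m (J b n v) - J b n (Lop m v) = of_int (- n) *\<^sub>C J b (m + n) v"
proof -
  have "Lop m (J b n v) - J b n (Lop m v) =
      - ((1 / (2 * (\<l> + g))) *\<^sub>C (J b n (sug (m + 1) v) - sug (m + 1) (J b n v)))"
    by (simp add: Lop_def J_scale scaleC_diff_right)
  also have "\<dots> = - (of_int n *\<^sub>C J b (m + n) v)"
  proof -
    have "1 / (2 * q) * (2 * q * y) = y" if "q \<noteq> 0" for q y :: complex using that by simp
    from this[OF nz] show ?thesis unfolding J_sug_commutator scaleC_scaleC by (simp add: add.commute)
  qed
  finally show ?thesis by simp
qed

lemma creative_J: "creative \<Omega> (J a)"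
  by (simp add: creative_def J_vac)

lemma L_vac: "n \<ge> - 1 \<Longrightarrow> Lop n \<Omega> = 0"
  using creative_prod(1)[OF is_field_J is_field_J creative_J creative_J, of _ _ "- 1"]
  by (simp add: Lop_def sug_def creative_def)

lemma L_minus2_vac: "Lop (- 2) \<Omega> = sugawara_vector \<l> g J \<Omega>"
  using creative_prod(2)[OF is_field_J is_field_J creative_J creative_J, of _ _ "- 1"]
  by (simp add: Lop_def sug_def sugawara_vector_def)

text \<open>Taking adjoints reverses each product and changes the ranges to \<open>r < - n\<close>
  and \<open>r < 1\<close>, instead of \<open>r < 0\<close> and \<open>r < 1 - n\<close>. The
  difference consists of the terms at 0 and at \<open>- n\<close>, which agree since
  \<open>J a 0\<close> and \<open>J a (- n)\<close> commute.\<close>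

lemma sug_adj: "cinner (sug (1 + n) u) v = cinner u (sug (1 - n) v)"
proof -
  obtain M1 where M1: "\<And>a k. k \<ge> M1 \<Longrightarrow> J a k u = 0" using J_vanish[of u] by blast
  obtain M2 where M2: "\<And>a k. k \<ge> M2 \<Longrightarrow> J a k v = 0" using J_vanish[of v] by blast
  define N where "N = - (\<bar>M1\<bar> + \<bar>M2\<bar> + 2 * \<bar>n\<bar> + 2)"
  define f where "f a r = J a r (J a (- n - r) v)" for a r
  have 1: "sug (1 + n) u = (\<Sum>a\<in>UNIV. (\<Sum>r\<in>{N..<0}. J a r (J a (n - r) u)) +
     (\<Sum>r\<in>{N..<1 + n}. J a r (J a (n - r) u)))"
    using sug_eq[of N "1 + n" u] M1 by (simp add: N_def)
  have 2: "sug (1 - n) v = (\<Sum>a\<in>UNIV. (\<Sum>r\<in>{N - n..<0}. f a r) + (\<Sum>r\<in>{N - n..<1 - n}. f a r))"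
    using sug_eq[of "N - n" "1 - n" v] M2 by (simp add: N_def f_def)
  have trm: "cinner (J a r (J a (n - r) u)) v = cinner u (f a (r + (- n)))" for a r
    by (simp add: adj f_def)
  have swap: "f a 0 = f a (- n)" for a
    using J_comm[of a 0 a "- n" v] by (simp add: f_def Gamma_diag' split: if_splits)
  have shift: "(\<Sum>r\<in>{N..<k}. cinner u (f a (r + (- n)))) = cinner u (\<Sum>r\<in>{N - n..<k - n}. f a r)" for a k
    unfolding cinner_sum_right
    by (rule sum.reindex_bij_witness[where i = "\<lambda>r. r + n" and j = "\<lambda>r. r - n"]) auto
  have split: "(\<Sum>r\<in>{N - n..<k + 1}. f a r) = (\<Sum>r\<in>{N - n..<k}. f a r) + f a k" if "N - n \<le> k" for a k
  proof -
    have "{N - n..<k + 1} = insert k {N - n..<k}" using that by auto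
    then show ?thesis by (simp add: add.commute)
  qed
  have eq: "(\<Sum>r\<in>{N - n..<0 - n}. f a r) + (\<Sum>r\<in>{N - n..<1}. f a r) =
      (\<Sum>r\<in>{N - n..<0}. f a r) + (\<Sum>r\<in>{N - n..<1 - n}. f a r)" for a
    using split[of 0 a] split[of "- n" a] swap[of a] by (simp add: N_def algebra_simps)
  have "cinner (sug (1 + n) u) v = (\<Sum>a\<in>UNIV. cinner u ((\<Sum>r\<in>{N - n..<0 - n}. f a r) +
      (\<Sum>r\<in>{N - n..<1 + n - n}. f a r)))"
    unfolding 1 cinner_sum_left cinner_add_left trm shift cinner_add_right ..
  also have "\<dots> = cinner u (sug (1 - n) v)"
    unfolding 2 cinner_sum_right using eq by simp
  finally show ?thesis .
qed

lemma L_adj: "cinner (Lop n u) v = cinner u (Lop (- n) v)"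
proof -
  have "1 / (2 * (\<l> + g)) \<in> \<real>" using real by simp
  then have "cnj (1 / (2 * (\<l> + g))) = 1 / (2 * (\<l> + g))" using Reals_cnj_iff by blast
  then show ?thesis
    using sug_adj[of n u v] unfolding Lop_def cinner_scaleC_left cinner_scaleC_right
    by (simp add: add.commute)
qed


subsection \<open>The Virasoro relations\<close>

text \<open>Such a \<open>D\<close> maps \<open>\<Omega>\<close> to a lowest energy vector, hence to
  a multiple of \<open>\<Omega>\<close>, and the monomials follow.\<close>

lemma commuting_scalar:
  assumes D: "clinear D" and comm: "\<And>a n v. D (J a n v) = J a n (D v)"
  shows "\<exists>c. \<forall>v. D v = c *\<^sub>C v"
proof -
  have "D \<Omega> \<in> {v. \<forall>a n. n > 0 \<longrightarrow> J a n v = 0}"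
    by (simp add: comm[symmetric] J_vac clinear_0[OF D])
  then obtain c where c: "D \<Omega> = c *\<^sub>C \<Omega>"
    unfolding lowest by (auto simp: complex_vector.span_singleton)
  have mon: "D v = c *\<^sub>C v" if "is_monomial k v" for k v
    using that by induction (simp_all add: c comm J_scale)
  have "D v = c *\<^sub>C v" for v
    by (induction v rule: monomials_induct)
      (auto simp: clinear_0[OF D] clinear_add[OF D] clinear_scale[OF D] monomials_def mon
        scaleC_add_right scaleC_scaleC mult.commute)
  then show ?thesis by blast
qed

text \<open>The vacuum expectation of the commutator of \<open>Lop m\<close> and
  \<open>Lop n\<close>, with the left operators moved to the other side by
  \<open>L_adj\<close>.\<close>

definition cent :: "int \<Rightarrow> int \<Rightarrow> complex" where
  "cent m n = cinner (Lop n \<Omega>) (Lop (- m) \<Omega>) - cinner (Lop m \<Omega>) (Lop (- n) \<Omega>)"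

lemma L_comm: "Lop m (Lop n v) - Lop n (Lop m v) = of_int (m - n) *\<^sub>C Lop (m + n) v + cent m n *\<^sub>C v"
proof -
  define D where "D v = Lop m (Lop n v) - Lop n (Lop m v) - of_int (m - n) *\<^sub>C Lop (m + n) v" for v
  have "clinear D"
    by (simp add: clinear_iff D_def L_add L_scale scaleC_add_right scaleC_diff_right
        scaleC_scaleC mult.commute)
  moreover have "D (J a k v) = J a k (D v)" for a k v
  proof -
    have L: "Lop m (J a k v) = J a k (Lop m v) + of_int (- k) *\<^sub>C J a (m + k) v" for m k v
      using L_J[of m a k v] by (simp add: algebra_simps)
    have "D (J a k v) = J a k (D v) + (of_int (- k) * of_int (- (n + k)) - of_int (- k) * of_int (- (m + k))
        - of_int (m - n) * of_int (- k)) *\<^sub>C J a (m + n + k) v"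
      unfolding D_def L L_add L_scale J_diff J_add J_scale
      by (simp only: scaleC_add_right scaleC_scaleC scaleC_diff_left add_ac)
        (simp add: algebra_simps)
    then show ?thesis by (simp add: algebra_simps)
  qed
  ultimately obtain c where c: "\<And>v. D v = c *\<^sub>C v" using commuting_scalar by blast
  \<comment> \<open>For \<open>k < - 1\<close> the operator is moved across, where
    \<open>Lop (- k)\<close> annihilates \<open>\<Omega>\<close>.\<close>
  have vac: "cinner (Lop k \<Omega>) \<Omega> = 0" for k
    using L_vac[of k] L_vac[of "- k"] L_adj[of k \<Omega> \<Omega>]
    by (cases "k \<ge> - 1") (simp_all add: cinner_0_left cinner_0_right)
  have "c = cinner (D \<Omega>) \<Omega>" by (simp add: c cinner_scaleC_left vac_norm)
  also have "\<dots> = cent m n"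
    unfolding D_def cinner_diff_left cinner_scaleC_left vac cent_def by (simp add: L_adj)
  finally show ?thesis using c[of v] by (simp add: D_def algebra_simps)
qed

lemma L0_L_vac: "Lop 0 (Lop n \<Omega>) = of_int (- n) *\<^sub>C Lop n \<Omega>"
proof -
  have "cent 0 n = 0" using L_vac[of 0] by (simp add: cent_def cinner_0_left cinner_0_right)
  then show ?thesis using L_comm[of 0 n \<Omega>] L_vac[of 0] by (simp add: L_0)
qed

lemma cinner_L_vac:
  assumes "n \<noteq> k" shows "cinner (Lop n \<Omega>) (Lop k \<Omega>) = 0"
proof -
  have "cinner (Lop 0 (Lop n \<Omega>)) (Lop k \<Omega>) = cinner (Lop n \<Omega>) (Lop 0 (Lop k \<Omega>))"
    using L_adj[of 0] by simp
  then have "of_int n * cinner (Lop n \<Omega>) (Lop k \<Omega>) = of_int k * cinner (Lop n \<Omega>) (Lop k \<Omega>)"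
    unfolding L0_L_vac cinner_scaleC_left cinner_scaleC_right by simp
  then show ?thesis using assms by simp
qed

lemma cent_off_diagonal: "m + n \<noteq> 0 \<Longrightarrow> cent m n = 0"
  unfolding cent_def by (subst (1 2) cinner_L_vac) auto

definition "vir_norm k = cinner (Lop (- int k) \<Omega>) (Lop (- int k) \<Omega>)"

text \<open>The norm of \<open>Lop (- 1) x\<close> with \<open>x = Lop (- int k) \<Omega>\<close> is
  computed directly and by commuting \<open>Lop 1\<close> with \<open>Lop (- 1)\<close>. For
  \<open>k\<close> at least 2 the commutators that evaluate \<open>Lop (- 1) x\<close> and
  \<open>Lop 1 x\<close> have no central term.\<close>

lemma vir_norm_rec:
  assumes k: "k \<ge> 2"
  shows "(of_nat k - 1)\<^sup>2 * vir_norm (Suc k) = 2 * of_nat k * vir_norm k + (of_nat k + 1)\<^sup>2 * vir_norm (k - 1)"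
proof -
  define x where "x = Lop (- int k) \<Omega>"
  have 1: "Lop (- 1) x = (of_nat k - 1) *\<^sub>C Lop (- int (Suc k)) \<Omega>"
    using L_comm[of "- 1" "- int k" \<Omega>] L_vac[of "- 1"] k by (simp add: x_def cent_off_diagonal L_0)
  have 2: "Lop 1 x = (of_nat k + 1) *\<^sub>C Lop (- int (k - 1)) \<Omega>"
    using L_comm[of 1 "- int k" \<Omega>] L_vac[of 1] k
    by (simp add: x_def cent_off_diagonal L_0 of_nat_diff add.commute)
  have xx: "cinner x x = vir_norm k" by (simp add: x_def vir_norm_def)
  have 0: "Lop 0 x = of_nat k *\<^sub>C x" unfolding x_def L0_L_vac by simp
  have "cent 1 (- 1) = 0" using L_vac[of 1] L_vac[of "- 1"] by (simp add: cent_def cinner_0_left)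
  then have 3: "Lop 1 (Lop (- 1) x) = Lop (- 1) (Lop 1 x) + (2 * of_nat k) *\<^sub>C x"
    using L_comm[of 1 "- 1" x] 0 by (simp add: scaleC_scaleC algebra_simps)
  have "cinner (Lop (- 1) x) (Lop (- 1) x) = cinner (Lop 1 (Lop (- 1) x)) x"
    using L_adj[of 1 "Lop (- 1) x" x] by simp
  also have "\<dots> = cinner (Lop 1 x) (Lop 1 x) + 2 * of_nat k * cinner x x"
    unfolding 3 cinner_add_left cinner_scaleC_left using L_adj[of "- 1" "Lop 1 x" x] by simp
  finally show ?thesis
    unfolding 1 2 cinner_scaleC_left cinner_scaleC_right vir_norm_def[symmetric] xx
    by (simp add: power2_eq_square algebra_simps)
qed

text \<open>The factor \<open>(k - 1)^2\<close> degenerates the recursion at \<open>k = 1\<close>,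
  so the value at 2 is free and determines the rest. The cubic solves the recursion, and the 6 is
  its value at 2.\<close>

lemma vir_norm: "vir_norm k = vir_norm 2 * (of_nat k * ((of_nat k)\<^sup>2 - 1)) / 6"
proof (induction k rule: less_induct)
  case (less k)
  consider "k = 0" | "k = 1" | "k = 2" | j where "k = Suc j" "j \<ge> 2"
    by (metis One_nat_def Suc_1 less_2_cases not_less old.nat.exhaust not_less_eq_eq le_antisym nat_le_linear)
  then show ?case
  proof cases
    case 4
    have ne: "(of_nat j - 1 :: complex)\<^sup>2 \<noteq> 0" using 4 by (auto simp: of_nat_eq_1_iff)
    have id: "2 * x * (c * (x * (x\<^sup>2 - 1)) / 6) + (x + 1)\<^sup>2 * (c * ((x - 1) * ((x - 1)\<^sup>2 - 1)) / 6) =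
        (x - 1)\<^sup>2 * (c * ((x + 1) * ((x + 1)\<^sup>2 - 1)) / 6)" for x c :: complex
      by (simp add: power2_eq_square field_simps)
    have "of_nat (j - 1) = (of_nat j - 1 :: complex)" using 4 by (simp add: of_nat_diff)
    then have a: "vir_norm (j - 1) = vir_norm 2 * ((of_nat j - 1) * ((of_nat j - 1)\<^sup>2 - 1)) / 6"
      using less.IH[of "j - 1"] 4 by simp
    have b: "vir_norm j = vir_norm 2 * (of_nat j * ((of_nat j)\<^sup>2 - 1)) / 6"
      using less.IH[of j] 4 by simp
    have k: "of_nat k = (of_nat j + 1 :: complex)" using 4 by simp
    have "(of_nat j - 1)\<^sup>2 * vir_norm k = 2 * of_nat j * vir_norm j + (of_nat j + 1)\<^sup>2 * vir_norm (j - 1)"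
      unfolding 4(1) by (rule vir_norm_rec[OF 4(2)])
    also have "\<dots> = (of_nat j - 1)\<^sup>2 * (vir_norm 2 * (of_nat k * ((of_nat k)\<^sup>2 - 1)) / 6)"
      unfolding a b k by (rule id)
    finally have "(of_nat j - 1)\<^sup>2 * vir_norm k = (of_nat j - 1)\<^sup>2 * (vir_norm 2 * (of_nat k * ((of_nat k)\<^sup>2 - 1)) / 6)" .
    then show ?thesis using ne by simp
  qed (simp_all add: vir_norm_def L_vac cinner_0_left)
qed

lemma L_virasoro:
  "Lop m (Lop n v) - Lop n (Lop m v) = of_int (m - n) *\<^sub>C Lop (m + n) v
    + (if m + n = 0 then (2 * vir_norm 2 / 12 * of_int (m * (m\<^sup>2 - 1))) *\<^sub>C v else 0)"
proof (cases "m + n = 0")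
  case False
  then show ?thesis using L_comm[of m n v] by (simp add: cent_off_diagonal)
next
  case True
  then have n: "n = - m" by simp
  have pos: "cent (int k) (- int k) = 2 * vir_norm 2 / 12 * of_int (int k * ((int k)\<^sup>2 - 1))" for k
  proof -
    have "cent (int k) (- int k) = vir_norm k"
      by (simp add: cent_def vir_norm_def L_vac cinner_0_left)
    then show ?thesis using vir_norm[of k] by simp
  qed
  have "cent m n = 2 * vir_norm 2 / 12 * of_int (m * (m\<^sup>2 - 1))"
  proof (cases "m \<ge> 0")
    case True
    then show ?thesis using pos[of "nat m"] n by simp
  next
    case False
    have "cent m (- m) = - cent (- m) m" by (simp add: cent_def)
    then show ?thesis using pos[of "nat (- m)"] False n by (simp add: algebra_simps)
  qed
  then show ?thesis using L_comm[of m n v] True by simp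
qed

end

section \<open>Linear spans of fields and the zero field\<close>

lemma field_span_zero: "zero_field \<in> field_span S"
  unfolding field_span_def zero_field_def by (auto intro!: exI[of _ "{}"])

lemma field_span_lincomb:
  assumes "A \<in> field_span S" "B \<in> field_span S" shows "lincomb c A B \<in> field_span S"
proof -
  obtain F k where A: "A = (\<lambda>n v. \<Sum>X\<in>F. k X *\<^sub>C X n v)" "finite F" "F \<subseteq> S"
    using assms(1) unfolding field_span_def by blast
  obtain F' k' where B: "B = (\<lambda>n v. \<Sum>X\<in>F'. k' X *\<^sub>C X n v)" "finite F'" "F' \<subseteq> S"
    using assms(2) unfolding field_span_def by blast
  define k'' where "k'' X = (if X \<in> F then c * k X else 0) + (if X \<in> F' then k' X else 0)" for X
  have "lincomb c A B n v = (\<Sum>X\<in>F \<union> F'. k'' X *\<^sub>C X n v)" for n v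
  proof -
    have "c *\<^sub>C A n v = (\<Sum>X\<in>F \<union> F'. (if X \<in> F then c * k X else 0) *\<^sub>C X n v)"
      unfolding A scaleC_sum_right scaleC_scaleC
      by (rule sum.mono_neutral_cong_left) (use A B in auto)
    moreover have "B n v = (\<Sum>X\<in>F \<union> F'. (if X \<in> F' then k' X else 0) *\<^sub>C X n v)"
      unfolding B by (rule sum.mono_neutral_cong_left) (use A B in auto)
    ultimately show ?thesis
      by (simp add: lincomb_def k''_def scaleC_add_left sum.distrib)
  qed
  then have "lincomb c A B = (\<lambda>n v. \<Sum>X\<in>F \<union> F'. k'' X *\<^sub>C X n v)" by (simp add: fun_eq_iff)
  moreover have "finite (F \<union> F')" "F \<union> F' \<subseteq> S" using A B by auto
  ultimately show ?thesis unfolding field_span_def by blast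
qed

lemma field_span_base: "A \<in> S \<Longrightarrow> A \<in> field_span S"
  unfolding field_span_def
  by (auto intro!: exI[of _ "{A}"] exI[of _ "\<lambda>_. 1"] simp: scaleC_one)

lemma field_span_induct [consumes 1, case_names zero step]:
  assumes "A \<in> field_span S" and zero: "P zero_field"
    and step: "\<And>c B A. B \<in> S \<Longrightarrow> A \<in> field_span S \<Longrightarrow> P A \<Longrightarrow> P (lincomb c B A)"
  shows "P A"
proof -
  obtain F k where A: "A = (\<lambda>n v. \<Sum>X\<in>F. k X *\<^sub>C X n v)" "finite F" "F \<subseteq> S"
    using assms(1) unfolding field_span_def by blast
  have "P (\<lambda>n v. \<Sum>X\<in>F. k X *\<^sub>C X n v)" using A(2,3)
  proof (induction F)
    case empty
    then show ?case using zero by (simp add: zero_field_def)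
  next
    case (insert X F)
    have "(\<lambda>n v. \<Sum>X\<in>F. k X *\<^sub>C X n v) \<in> field_span S"
      using insert by (auto simp: field_span_def)
    then have "P (lincomb (k X) X (\<lambda>n v. \<Sum>X\<in>F. k X *\<^sub>C X n v))"
      using insert by (intro step) auto
    then show ?case using insert(1,2) by (simp add: lincomb_def)
  qed
  then show ?thesis by (simp add: A)
qed

lemma field_span_sum:
  assumes "finite I" "\<And>i. i \<in> I \<Longrightarrow> A i \<in> field_span S"
  shows "(\<lambda>n v. \<Sum>i\<in>I. A i n v) \<in> field_span S"
  using assms
proof (induction I)
  case empty
  then show ?case using field_span_zero by (simp add: zero_field_def)
next
  case (insert i I)
  then have "lincomb 1 (A i) (\<lambda>n v. \<Sum>i\<in>I. A i n v) \<in> field_span S"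
    by (intro field_span_lincomb) auto
  then show ?case using insert(1,2) by (simp add: lincomb_def scaleC_one)
qed

lemma field_span_empty: "field_span {} = {zero_field}"
  by (auto simp: field_span_def zero_field_def)

lemma is_field_id: "is_field id_field"
  unfolding is_field_def
proof (intro conjI allI)
  show "clinear (id_field n :: 'a \<Rightarrow> 'a)" for n by (simp add: clinear_iff id_field_def)
  show "\<exists>M. \<forall>m\<ge>M. id_field m v = 0" for v :: 'a by (rule exI[of _ 0]) (simp add: id_field_def)
qed

lemma is_field_zero: "is_field zero_field"
  by (simp add: is_field_def zero_field_def clinear_iff)

lemma field_prod_zero:
  "is_field B \<Longrightarrow> field_prod \<epsilon> zero_field B n = zero_field"
  "is_field B \<Longrightarrow> field_prod \<epsilon> B zero_field n = zero_field"
  by (auto simp: field_prod_def zero_field_def fun_eq_iff clinear_0[OF is_field_linear])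

lemma mutually_local_zero: "is_field B \<Longrightarrow> mutually_local zero_field B"
  unfolding mutually_local_def
  by (rule exI[of _ 0]) (simp add: zero_field_def clinear_0 is_field_linear)

lemma deriv_lincomb: "deriv_field (lincomb c A B) = lincomb c (deriv_field A) (deriv_field B)"
  by (simp add: deriv_field_def lincomb_def fun_eq_iff scaleC_add_right scaleC_left_commute
      scaleC_diff_right algebra_simps)

lemma local_zero:
  assumes "is_field B" shows "local \<epsilon> zero_field B" "local \<epsilon> B zero_field"
proof -
  have "laurent_pole 0 (\<lambda>z w. 0)"
    unfolding laurent_pole_def by (intro exI[of _ "{}"]) simp
  then show "local \<epsilon> zero_field B" "local \<epsilon> B zero_field"
    unfolding local_def
    by (auto intro!: exI[of _ 0] exI[of _ "\<lambda>z w. 0"] simp: zero_field_def cinner_0_left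
        field_0[OF assms] case_prod_unfold)
qed

context vacuum_module
begin

subsection \<open>Energy spaces\<close>

lemma L0_monomial: "is_monomial k v \<Longrightarrow> Lop 0 v = of_nat k *\<^sub>C v"
proof (induction rule: is_monomial.induct)
  case vac
  then show ?case by (simp add: L_vac)
next
  case (step k v n a)
  then show ?case using L_J[of 0 a "- int n" v]
    by (simp add: J_scale scaleC_add_left eq_diff_eq diff_eq_eq add.commute)
qed

lemma L0_orthogonal:
  assumes "Lop 0 u = of_real p *\<^sub>C u" "Lop 0 v = of_real q *\<^sub>C v" "p \<noteq> q"
  shows "cinner u v = 0"
proof -
  have "cinner (Lop 0 u) v = cinner u (Lop 0 v)" using L_adj[of 0] by simp
  then have "of_real p * cinner u v = of_real q * cinner u v"
    unfolding assms(1,2) cinner_scaleC_left cinner_scaleC_right by simp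
  then show ?thesis using assms(3) by simp
qed

definition level :: "real \<Rightarrow> 'h set" where
  "level q = {v. \<exists>k. is_monomial k v \<and> real k = q}"

lemma L0_level: "v \<in> complex_vector.span (level q) \<Longrightarrow> Lop 0 v = of_real q *\<^sub>C v"
proof (induction v rule: complex_vector.span_induct_alt)
  case base
  then show ?case by (simp add: L_0)
next
  case (step c x y)
  then have "Lop 0 x = of_real q *\<^sub>C x" by (auto simp: level_def L0_monomial)
  with step show ?case
    by (simp add: L_add L_scale scaleC_add_right scaleC_scaleC mult.commute)
qed

text \<open>Split \<open>v\<close> into a part from level \<open>q\<close> and a part
  \<open>w\<close> from the other levels. Then \<open>w\<close> is also an eigenvector for
  \<open>q\<close>, so it is orthogonal to every other level, hence to itself.\<close>

lemma eigenspace_level: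
  assumes v: "Lop 0 v = of_real q *\<^sub>C v" shows "v \<in> complex_vector.span (level q)"
proof -
  define O' where "O' = {v. \<exists>k. is_monomial k v \<and> real k \<noteq> q}"
  have "\<exists>u\<in>complex_vector.span (level q). \<exists>w\<in>complex_vector.span O'. v = u + w" for v
  proof (induction v rule: monomials_induct)
    case 1
    have "(0::'h) = 0 + 0" by simp
    then show ?case using complex_vector.span_zero by blast
  next
    case (2 c x y)
    then obtain u w where uw: "u \<in> complex_vector.span (level q)" "w \<in> complex_vector.span O'" "y = u + w"
      by blast
    have "x \<in> level q \<or> x \<in> O'" using 2 by (auto simp: monomials_def level_def O'_def)
    then show ?case
    proof
      assume "x \<in> level q"
      then have "c *\<^sub>C x + u \<in> complex_vector.span (level q)"
        using uw by (simp add: complex_vector.span_add complex_vector.span_scale complex_vector.span_base)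
      then show ?thesis using uw by (metis add.assoc)
    next
      assume "x \<in> O'"
      then have "c *\<^sub>C x + w \<in> complex_vector.span O'"
        using uw by (simp add: complex_vector.span_add complex_vector.span_scale complex_vector.span_base)
      then show ?thesis using uw by (metis add.left_commute)
    qed
  qed
  then obtain u w where uw: "u \<in> complex_vector.span (level q)" "w \<in> complex_vector.span O'" "v = u + w"
    by blast
  have "Lop 0 w = of_real q *\<^sub>C w"
    using v L0_level[OF uw(1)] uw(3) by (simp add: L_add scaleC_add_right)
  then have O': "cinner w x = 0" if "x \<in> O'" for x
    using that L0_orthogonal[of w q x] by (force simp: O'_def L0_monomial)
  have "cinner w x = 0" if "x \<in> complex_vector.span O'" for x
    using that by (induction x rule: complex_vector.span_induct_alt)
      (simp_all add: cinner_0_right cinner_add_right cinner_scaleC_right O')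
  then have "w = 0" using uw(2) cinner_eq_0 by blast
  then show ?thesis using uw by simp
qed

lemma finite_monomials: "finite {v. is_monomial k v}"
proof (induction k rule: less_induct)
  case (less k)
  have "{v. is_monomial k v} \<subseteq> {\<Omega>} \<union> (\<Union>n\<in>{1..k}. \<Union>a. J a (- int n) ` {v. is_monomial (k - n) v})"
  proof
    fix v assume "v \<in> {v. is_monomial k v}"
    then have "is_monomial k v" by simp
    then show "v \<in> {\<Omega>} \<union> (\<Union>n\<in>{1..k}. \<Union>a. J a (- int n) ` {v. is_monomial (k - n) v})"
    proof cases
      case (step k' v' n a)
      then have "n \<in> {1..k}" "v \<in> J a (- int n) ` {v. is_monomial (k - n) v}" by auto
      then show ?thesis by blast
    qed simp
  qed
  moreover have "finite ({\<Omega>} \<union> (\<Union>n\<in>{1..k}. \<Union>a. J a (- int n) ` {v. is_monomial (k - n) v}))"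
    using less by (intro finite_UnI finite_UN_I finite_imageI) auto
  ultimately show ?case by (rule finite_subset)
qed

lemma finite_level: "finite (level q)"
proof (cases "\<exists>k. real k = q")
  case True
  then obtain k where k: "real k = q" by blast
  have "level q = {v. is_monomial k v}" unfolding level_def using k by auto
  then show ?thesis by (simp add: finite_monomials)
next
  case False
  then have "level q = {}" by (auto simp: level_def)
  then show ?thesis by simp
qed

text \<open>Vectors and fields in spans are not homogeneous, so an interval of energies is tracked
  instead of a single one.\<close>

definition band :: "int \<Rightarrow> int \<Rightarrow> 'h set" where
  "band i j = complex_vector.span {v. \<exists>e. i \<le> e \<and> e \<le> j \<and> Lop 0 v = of_int e *\<^sub>C v}"

lemma band_mono: "i' \<le> i \<Longrightarrow> j \<le> j' \<Longrightarrow> band i j \<subseteq> band i' j'"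
  unfolding band_def by (rule complex_vector.span_mono) (use order_trans in blast)

lemma band_orthogonal:
  assumes "u \<in> band i j" "v \<in> band i' j'" "j < i' \<or> j' < i" shows "cinner u v = 0"
proof -
  have 1: "cinner x y = 0" if "i \<le> e" "e \<le> j" "Lop 0 x = of_int e *\<^sub>C x"
      "i' \<le> e'" "e' \<le> j'" "Lop 0 y = of_int e' *\<^sub>C y" for x y e e'
    using L0_orthogonal[of x "of_int e" y "of_int e'"] that assms(3) by auto
  have 2: "cinner x v = 0" if "i \<le> e" "e \<le> j" "Lop 0 x = of_int e *\<^sub>C x" for x e
    using assms(2) unfolding band_def
    by (induction v rule: complex_vector.span_induct_alt)
      (auto simp: cinner_0_right cinner_add_right cinner_scaleC_right intro: 1[OF that])
  show ?thesis
    using assms(1) unfolding band_def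
    by (induction u rule: complex_vector.span_induct_alt)
      (auto simp: cinner_0_left cinner_add_left cinner_scaleC_left intro: 2)
qed

lemma in_band: "\<exists>i j. v \<in> band i j"
proof (induction v rule: monomials_induct)
  case 1
  then show ?case by (auto simp: band_def intro: complex_vector.span_zero)
next
  case (2 c x y)
  then obtain k i j where k: "is_monomial k x" and y: "y \<in> band i j" by (auto simp: monomials_def)
  have "x \<in> band (min i (int k)) (max j (int k))"
    unfolding band_def
    by (rule complex_vector.span_base) (use L0_monomial[OF k] in \<open>auto intro!: exI[of _ "int k"]\<close>)
  moreover have "y \<in> band (min i (int k)) (max j (int k))"
    using y band_mono[of "min i (int k)" i j "max j (int k)"] by auto
  ultimately show ?case
    unfolding band_def using complex_vector.span_add complex_vector.span_scale by blast
qed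

subsection \<open>The generated space of fields\<close>

abbreviation "gen \<equiv> generated (boson_fields J)"
definition "S = field_span {A. gen 0 A}"

text \<open>Parity belongs to the induction: products are formed with the sign
  \<open>\<epsilon>\<^sub>1 * \<epsilon>\<^sub>2\<close>, and the lemmas on products are for sign
  0.\<close>

lemma gen_props:
  "gen \<epsilon> A \<Longrightarrow> \<epsilon> = 0 \<and> is_field A \<and> translation_covariant (Lop (- 1)) A \<and> creative \<Omega> A \<and>
    (\<exists>\<alpha>. homogeneous (Lop 0) \<alpha> A)"
proof (induction rule: generated.induct)
  case (generator \<epsilon> A)
  then obtain a where A: "A = J a" "\<epsilon> = 0" by (auto simp: boson_fields_def)
  have "translation_covariant (Lop (- 1)) (J a)"
    unfolding translation_covariant_def using L_J[of "- 1" a] by (simp add: add.commute)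
  moreover have "homogeneous (Lop 0) 1 (J a)"
    unfolding homogeneous_def using L_J[of 0 a] by simp
  ultimately show ?case using A is_field_J creative_J by blast
next
  case identity
  have "is_field id_field" by (rule is_field_id)
  moreover have "translation_covariant (Lop (- 1)) id_field" "homogeneous (Lop 0) 0 id_field"
    "creative \<Omega> id_field"
    by (auto simp: translation_covariant_def homogeneous_def creative_def id_field_def L_0)
  ultimately show ?case by blast
next
  case (product \<epsilon>\<^sub>1 A \<epsilon>\<^sub>2 B n)
  then obtain \<alpha> \<beta> where "homogeneous (Lop 0) \<alpha> A" "homogeneous (Lop 0) \<beta> B" by blast
  with product.IH show ?case
    using is_field_prod[of A B n] translation_covariant_prod[OF _ _ L_linear, of A B "- 1" n]
      creative_prod(1)[of A B \<Omega> n] homogeneous_prod[OF _ _ L_linear, of A B 0 \<alpha> \<beta> n] by auto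
next
  case (derivative \<epsilon> A)
  then show ?case
    using is_field_deriv[of A] translation_covariant_deriv[OF L_linear, of "- 1" A]
      homogeneous_deriv[OF L_linear, of 0 _ A] creative_deriv[of \<Omega> A] by blast
qed

lemma gen_field: "gen \<epsilon> A \<Longrightarrow> is_field A" and gen_even: "gen \<epsilon> A \<Longrightarrow> \<epsilon> = 0"
  using gen_props by blast+

lemma J_J_kernel:
  "(\<lambda>l m. J a l (J b m v) - J b m (J a l v)) = (\<lambda>l m. \<i> *\<^sub>C (\<Sum>c\<in>UNIV. of_real (\<Gamma> a b c) *\<^sub>C J c (l + m) v)
     + (if a = b \<and> l + m = 0 then (of_int l * \<l>) *\<^sub>C v else 0))"
  by (simp only: J_comm)

text \<open>The bracket term depends only on \<open>l + m\<close> and cancels; the central term is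
  linear in \<open>l\<close> and leaves a constant on one antidiagonal, which a second factor
  \<open>z - w\<close> removes.\<close>

lemma zw_mult_J_J_kernel:
  "zw_mult (\<lambda>l m. J a l (J b m v) - J b m (J a l v)) =
    (\<lambda>l m. if a = b \<and> l + m + 1 = 0 then \<l> *\<^sub>C v else 0)"
  unfolding J_J_kernel zw_mult_def
  by (auto simp: fun_eq_iff algebra_simps scaleC_add_left)

lemma zw_mult_2_J_J_kernel:
  "(zw_mult ^^ 2) (\<lambda>l m. J a l (J b m v) - J b m (J a l v)) = (\<lambda>l m. 0)"
  unfolding numeral_2_eq_2 funpow.simps o_apply id_apply zw_mult_J_J_kernel
  by (auto simp: zw_mult_def fun_eq_iff algebra_simps)

text \<open>Dong's lemma needs the two factors to be local with respect to each other, so mutual locality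
  is shown for all pairs of fields generated in at most \<open>k\<close> steps, by induction on \<open>k\<close>.\<close>

primrec pool :: "nat \<Rightarrow> 'h modes set" where
  "pool 0 = insert id_field (range J)"
| "pool (Suc k) = pool k \<union> deriv_field ` pool k \<union> {field_prod 0 A B n | A B n. A \<in> pool k \<and> B \<in> pool k}"

lemma pool_mono: "k \<le> k' \<Longrightarrow> pool k \<subseteq> pool k'"
  by (rule lift_Suc_mono_le[of pool]) auto

lemma gen_pool: "gen \<epsilon> A \<Longrightarrow> \<exists>k. A \<in> pool k"
proof (induction rule: generated.induct)
  case (generator \<epsilon> A)
  then have "A \<in> pool 0" by (auto simp: boson_fields_def)
  then show ?case ..
next
  case identity
  have "id_field \<in> pool 0" by simp
  then show ?case ..
next
  case (product \<epsilon>\<^sub>1 A \<epsilon>\<^sub>2 B n)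
  then obtain k k' where "A \<in> pool k" "B \<in> pool k'" by blast
  then have "A \<in> pool (max k k')" "B \<in> pool (max k k')"
    using pool_mono[of k "max k k'"] pool_mono[of k' "max k k'"] by auto
  then have "field_prod 0 A B n \<in> pool (Suc (max k k'))" by auto
  moreover have "\<epsilon>\<^sub>1 * \<epsilon>\<^sub>2 = 0" using product.hyps gen_even by auto
  ultimately show ?case by metis
next
  case (derivative \<epsilon> A)
  then obtain k where "A \<in> pool k" by blast
  then have "deriv_field A \<in> pool (Suc k)" by auto
  then show ?case ..
qed

lemma pool_field: "A \<in> pool k \<Longrightarrow> is_field A"
proof (induction k arbitrary: A)
  case 0
  then show ?case using is_field_id is_field_J by auto
next
  case (Suc k)
  then show ?case by (auto intro!: is_field_deriv is_field_prod intro: Suc.IH)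
qed

lemma pool_local_extend:
  assumes pairwise: "\<And>A B. A \<in> pool k \<Longrightarrow> B \<in> pool k \<Longrightarrow> mutually_local A B"
    and C: "is_field C" "\<And>A. A \<in> pool k \<Longrightarrow> mutually_local A C" and A: "A \<in> pool (Suc k)"
  shows "mutually_local A C"
proof -
  consider "A \<in> pool k" | B where "A = deriv_field B" "B \<in> pool k"
    | B B' n where "A = field_prod 0 B B' n" "B \<in> pool k" "B' \<in> pool k"
    using A by auto
  then show ?thesis
  proof cases
    case 3
    then show ?thesis unfolding 3(1) by (intro dong pool_field[of _ k] C pairwise)
  qed (auto intro: C mutually_local_deriv)
qed

lemma pool_local: "A \<in> pool k \<Longrightarrow> B \<in> pool k \<Longrightarrow> mutually_local A B"
proof (induction k arbitrary: A B)
  case 0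
  have "mutually_local (J a) (J b)" for a b
    unfolding mutually_local_def using zw_mult_2_J_J_kernel by blast
  moreover have "mutually_local C id_field" "mutually_local id_field C" if "is_field C" for C :: "'h modes"
    using mutually_local_id[OF that] mutually_local_sym[OF mutually_local_id[OF that]] by auto
  ultimately show ?case using 0 is_field_J is_field_id[where 'a = 'h] by auto
next
  case (Suc k)
  \<comment> \<open>One factor is raised to the next stage here, the other one afterwards by
    symmetry; Dong's lemma is thus applied only to factors already known to be local to each
    other.\<close>
  have 1: "mutually_local A C" if "A \<in> pool (Suc k)" "C \<in> pool k" for A C
    by (rule pool_local_extend[OF Suc.IH pool_field[OF that(2)] Suc.IH[OF _ that(2)] that(1)])
  show ?case
    by (rule pool_local_extend[OF Suc.IH pool_field[OF Suc.prems(2)] mutually_local_sym[OF 1[OF Suc.prems(2)]]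
          Suc.prems(1)])
qed

lemma mutually_local_gen:
  assumes "gen \<epsilon> A" "gen \<epsilon>' B" shows "mutually_local A B"
proof -
  obtain k k' where "A \<in> pool k" "B \<in> pool k'" using gen_pool assms by blast
  then have "A \<in> pool (max k k')" "B \<in> pool (max k k')"
    using pool_mono[of k "max k k'"] pool_mono[of k' "max k k'"] by auto
  then show ?thesis by (rule pool_local)
qed

lemma S_props:
  assumes "A \<in> S"
  shows "is_field A \<and> translation_covariant (Lop (- 1)) A \<and> creative \<Omega> A \<and> (\<forall>B. gen 0 B \<longrightarrow> mutually_local A B)"
  using assms unfolding S_def
proof (induction rule: field_span_induct)
  case zero
  then show ?case
    by (auto simp: is_field_zero mutually_local_zero gen_field)
      (auto simp: zero_field_def translation_covariant_def creative_def L_0)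
next
  case (step c B A)
  then have B: "is_field B" "translation_covariant (Lop (- 1)) B" "creative \<Omega> B" using gen_props by blast+
  have "Lop (- 1) (lincomb c B A n v) - lincomb c B A n (Lop (- 1) v) = of_int (- n) *\<^sub>C lincomb c B A (n - 1) v" for n v
  proof -
    have "Lop (- 1) (lincomb c B A n v) - lincomb c B A n (Lop (- 1) v) =
        c *\<^sub>C (Lop (- 1) (B n v) - B n (Lop (- 1) v)) + (Lop (- 1) (A n v) - A n (Lop (- 1) v))"
      by (simp add: lincomb_def L_add L_scale scaleC_diff_right)
    also have "Lop (- 1) (B n v) - B n (Lop (- 1) v) = of_int (- n) *\<^sub>C B (n - 1) v"
      using B(2) unfolding translation_covariant_def by blast
    also have "Lop (- 1) (A n v) - A n (Lop (- 1) v) = of_int (- n) *\<^sub>C A (n - 1) v"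
      using step.IH unfolding translation_covariant_def by blast
    finally show ?thesis
      by (simp only: lincomb_def scaleC_add_right scaleC_left_commute)
  qed
  then have "translation_covariant (Lop (- 1)) (lincomb c B A)"
    unfolding translation_covariant_def by blast
  moreover have "creative \<Omega> (lincomb c B A)" using B step by (simp add: creative_def lincomb_def)
  moreover have "is_field (lincomb c B A)" using B(1) step.IH by (intro is_field_lincomb) auto
  moreover have "mutually_local (lincomb c B A) C" if "gen 0 C" for C
  proof -
    have "mutually_local B C" "mutually_local A C" "is_field C"
      using step that mutually_local_gen gen_field by blast+
    then show ?thesis by (rule mutually_local_lincomb)
  qed
  ultimately show ?case by blast
qed

lemma S_field: "A \<in> S \<Longrightarrow> is_field A"
  and S_translation: "A \<in> S \<Longrightarrow> translation_covariant (Lop (- 1)) A"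
  and S_creative: "A \<in> S \<Longrightarrow> creative \<Omega> A"
  using S_props by blast+

lemma S_base: "gen \<epsilon> A \<Longrightarrow> A \<in> S"
  unfolding S_def using gen_even by (intro field_span_base) blast

lemma S_lincomb: "A \<in> S \<Longrightarrow> B \<in> S \<Longrightarrow> lincomb c A B \<in> S"
  unfolding S_def by (rule field_span_lincomb)

lemma S_zero: "zero_field \<in> S"
  unfolding S_def by (rule field_span_zero)

lemma S_induct [consumes 1, case_names zero step]:
  assumes "A \<in> S" "P zero_field" "\<And>c B A. gen 0 B \<Longrightarrow> A \<in> S \<Longrightarrow> P A \<Longrightarrow> P (lincomb c B A)"
  shows "P A"
  using assms(1) unfolding S_def
  by (rule field_span_induct) (use assms(2,3) in \<open>auto simp: S_def\<close>)

lemma S_local: "A \<in> S \<Longrightarrow> B \<in> S \<Longrightarrow> mutually_local A B"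
proof (induction A rule: S_induct)
  case zero
  then show ?case using mutually_local_zero S_field by blast
next
  case (step c C A)
  have "mutually_local C B" using S_props[OF step.prems] step.hyps(1) mutually_local_sym by blast
  then show ?case using step mutually_local_lincomb S_field by blast
qed

lemma S_deriv: "A \<in> S \<Longrightarrow> deriv_field A \<in> S"
proof (induction A rule: S_induct)
  case zero
  have "deriv_field zero_field = (zero_field :: 'h modes)" by (simp add: deriv_field_def zero_field_def)
  then show ?case using S_zero by simp
next
  case (step c B A)
  then show ?case unfolding deriv_lincomb using S_base[OF generated.derivative] S_lincomb by blast
qed

lemma S_prod_gen: "A \<in> S \<Longrightarrow> gen 0 B \<Longrightarrow> field_prod 0 B A n \<in> S"
proof (induction A rule: S_induct)
  case zero
  then show ?case using field_prod_zero(2) gen_field S_zero by metis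
next
  case (step c C A)
  have "gen 0 (field_prod 0 B C n)" using generated.product[OF step.prems step.hyps(1), of n] by simp
  then show ?case
    using step by (simp add: field_prod_lincomb_right[OF gen_field gen_field S_field] S_lincomb S_base)
qed

lemma S_prod: "A \<in> S \<Longrightarrow> B \<in> S \<Longrightarrow> field_prod 0 A B n \<in> S"
proof (induction A rule: S_induct)
  case zero
  then show ?case using field_prod_zero(1) S_field S_zero by metis
next
  case (step c C A)
  then show ?case
    by (simp add: field_prod_lincomb_left[OF gen_field S_field S_field] S_lincomb S_prod_gen)
qed

lemma J_in_gen: "gen 0 (J a)"
  by (rule generated.generator) (simp add: boson_fields_def)

text \<open>By \<open>creative_prod\<close>, the product of \<open>J a\<close> and the field of
  \<open>v\<close> at index \<open>- n\<close> creates \<open>J a (- n) v\<close>, with weight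
  \<open>1 + k + n - 1\<close>.\<close>

lemma monomial_field:
  "is_monomial k v \<Longrightarrow> \<exists>A. gen 0 A \<and> homogeneous (Lop 0) (int k) A \<and> A (- 1) \<Omega> = v"
proof (induction rule: is_monomial.induct)
  case vac
  have "homogeneous (Lop 0) (int 0) id_field" by (auto simp: homogeneous_def id_field_def L_0)
  moreover have "id_field (- 1) \<Omega> = \<Omega>" by (simp add: id_field_def)
  ultimately show ?case using generated.identity by blast
next
  case (step k v n a)
  then obtain A where A: "gen 0 A" "homogeneous (Lop 0) (int k) A" "A (- 1) \<Omega> = v" by blast
  have "homogeneous (Lop 0) 1 (J a)" unfolding homogeneous_def using L_J[of 0 a] by simp
  from homogeneous_prod[OF is_field_J gen_field[OF A(1)] L_linear this A(2), of "- int n"]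
  have "homogeneous (Lop 0) (int (k + n)) (field_prod 0 (J a) A (- int n))" by (simp add: add.commute)
  moreover have "field_prod 0 (J a) A (- int n) (- 1) \<Omega> = J a (- int n) v"
    using creative_prod(2)[OF is_field_J gen_field[OF A(1)] creative_J] gen_props[OF A(1)] A(3) by simp
  moreover have "gen 0 (field_prod 0 (J a) A (- int n))"
    using generated.product[OF J_in_gen A(1)] by simp
  ultimately show ?case by blast
qed

lemma level_field:
  assumes "v \<in> complex_vector.span (level q)"
  shows "\<exists>A\<in>S. A (- 1) \<Omega> = v \<and>
    (\<forall>n w. Lop 0 (A n w) - A n (Lop 0 w) = (of_real q - of_int n - 1) *\<^sub>C A n w)"
  using assms
proof (induction v rule: complex_vector.span_induct_alt)
  case base
  then show ?case by (intro bexI[OF _ S_zero]) (simp add: zero_field_def L_0)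
next
  case (step c x y)
  then obtain B where B: "B \<in> S" "B (- 1) \<Omega> = y"
    "\<And>n w. Lop 0 (B n w) - B n (Lop 0 w) = (of_real q - of_int n - 1) *\<^sub>C B n w" by blast
  obtain k where k: "is_monomial k x" "real k = q" using step by (auto simp: level_def)
  obtain A where A: "gen 0 A" "homogeneous (Lop 0) (int k) A" "A (- 1) \<Omega> = x"
    using monomial_field[OF k(1)] by blast
  have A': "Lop 0 (A n w) - A n (Lop 0 w) = (of_real q - of_int n - 1) *\<^sub>C A n w" for n w
    using A(2) k(2) by (auto simp: homogeneous_def)
  have "Lop 0 (lincomb c A B n w) - lincomb c A B n (Lop 0 w) = (of_real q - of_int n - 1) *\<^sub>C lincomb c A B n w" for n w
  proof -
    have "Lop 0 (lincomb c A B n w) - lincomb c A B n (Lop 0 w) =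
      c *\<^sub>C (Lop 0 (A n w) - A n (Lop 0 w)) + (Lop 0 (B n w) - B n (Lop 0 w))"
      by (simp add: lincomb_def L_add L_scale scaleC_diff_right)
    then show ?thesis
      unfolding A' B(3) by (simp only: lincomb_def scaleC_add_right scaleC_left_commute)
  qed
  moreover have "lincomb c A B (- 1) \<Omega> = c *\<^sub>C x + y" using A B by (simp add: lincomb_def)
  ultimately show ?case using S_lincomb[OF S_base[OF A(1)] B(1)] by blast
qed

lemma state_surj: "\<exists>A\<in>S. A (- 1) \<Omega> = v"
proof (induction v rule: monomials_induct)
  case 1
  show ?case by (intro bexI[OF _ S_zero]) (simp add: zero_field_def)
next
  case (2 c x y)
  then obtain k where "is_monomial k x" by (auto simp: monomials_def)
  then obtain A where A: "gen 0 A" "A (- 1) \<Omega> = x" using monomial_field by blast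
  obtain B where B: "B \<in> S" "B (- 1) \<Omega> = y" using 2 by blast
  have "lincomb c A B (- 1) \<Omega> = c *\<^sub>C x + y" using A B by (simp add: lincomb_def)
  then show ?case using S_lincomb[OF S_base[OF A(1)] B(1)] by blast
qed

text \<open>Goddard's uniqueness argument: covariance turns \<open>A(-1)\<Omega> = 0\<close> into \<open>A(z)\<Omega> = 0\<close>, and locality
  moves \<open>A(z)\<close> past the fields \<open>B(w)\<close> that create all of \<open>H\<close> from \<open>\<Omega>\<close>.\<close>

lemma state_injective:
  assumes A: "A \<in> S" "A (- 1) \<Omega> = 0" shows "A = zero_field"
proof (intro ext)
  have neg: "A (- 1 - int k) \<Omega> = 0" for k
  proof (induction k)
    case (Suc k)
    have "Lop (- 1) (A (- 1 - int k) \<Omega>) - A (- 1 - int k) (Lop (- 1) \<Omega>) =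
        of_int (- (- 1 - int k)) *\<^sub>C A (- 1 - int k - 1) \<Omega>"
      using S_translation[OF A(1)] unfolding translation_covariant_def by blast
    then have "of_int (1 + int k) *\<^sub>C A (- 1 - int (Suc k)) \<Omega> = 0"
      using Suc by (simp add: L_vac L_0 field_0[OF S_field[OF A(1)]] algebra_simps)
    moreover have "(of_int (1 + int k) :: complex) \<noteq> 0"
      by (subst of_int_eq_0_iff) simp
    ultimately show ?case using complex_vector.scale_eq_0_iff by blast
  qed (simp add: A)
  have vac: "A m \<Omega> = 0" for m
  proof (cases "m \<ge> 0")
    case True
    then show ?thesis using S_creative[OF A(1)] by (simp add: creative_def)
  next
    case False
    then show ?thesis using neg[of "nat (- 1 - m)"] by simp
  qed
  fix n v
  obtain B where B: "B \<in> S" "B (- 1) \<Omega> = v" using state_surj by blast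
  obtain N where "\<And>v. (zw_mult ^^ N) (\<lambda>l m. A l (B m v) - B m (A l v)) = (\<lambda>l m. 0)"
    using S_local[OF A(1) B(1)] unfolding mutually_local_def by blast
  \<comment> \<open>\<open>A\<close> annihilates \<open>\<Omega>\<close>, so only the ordering with
    \<open>B\<close> to the right is left of the commutator.\<close>
  from this[of \<Omega>] have N: "(zw_mult ^^ N) (\<lambda>l m. A l (B m \<Omega>)) = (\<lambda>l m. 0)"
    by (simp add: vac field_0[OF S_field[OF B(1)]])
  \<comment> \<open>\<open>B m \<Omega>\<close> vanishes for large \<open>m\<close>, so the power of
    \<open>z - w\<close> can be cancelled; the coefficient at \<open>m = - 1\<close> is
    \<open>A l v\<close>.\<close>
  have "(\<lambda>l m. A l (B m \<Omega>)) = (\<lambda>l m. 0)"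
    by (rule zw_mult_cancel[OF _ N]) (intro right_bounded_prod S_field A B)
  then show "A n v = zero_field n v" using B(2) by (metis zero_field_def)
qed

lemma generated_space_eq: "generated_space (boson_fields J) = S"
proof -
  have "{A. \<exists>\<epsilon>. gen \<epsilon> A} = {A. gen 0 A}" using gen_even by blast
  then show ?thesis by (simp add: generated_space_def S_def)
qed

lemma state_bij: "bij_betw (state \<Omega>) S UNIV"
proof (rule bij_betw_imageI)
  show "inj_on (state \<Omega>) S"
  proof (rule inj_onI)
    fix A B assume AB: "A \<in> S" "B \<in> S" "state \<Omega> A = state \<Omega> B"
    have "lincomb (- 1) B A = zero_field"
    proof (rule state_injective)
      show "lincomb (- 1) B A \<in> S" using AB by (intro S_lincomb)
      show "lincomb (- 1) B A (- 1) \<Omega> = 0" using AB(3) by (simp add: lincomb_def state_def scaleC_one)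
    qed
    then have "lincomb (- 1) B A n v = 0" for n v by (simp add: zero_field_def)
    then show "A = B" by (simp add: lincomb_def scaleC_one fun_eq_iff)
  qed
  have "v \<in> state \<Omega> ` S" for v
  proof -
    obtain A where "A \<in> S" "v = state \<Omega> A" using state_surj[of v] unfolding state_def by metis
    then show ?thesis by blast
  qed
  then show "state \<Omega> ` S = UNIV" by blast
qed

section \<open>The state-field correspondence\<close>

abbreviation "vfield \<equiv> state_field (boson_fields J) \<Omega>"

lemma vfield_in_S: "vfield a \<in> S"
  and vfield_state: "vfield a (- 1) \<Omega> = a"
  and vfield_unique: "A \<in> S \<Longrightarrow> A (- 1) \<Omega> = a \<Longrightarrow> vfield a = A"
proof -
  have "a \<in> state \<Omega> ` S" using bij_betw_imp_surj_on[OF state_bij] by simp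
  then show "vfield a \<in> S" "vfield a (- 1) \<Omega> = a"
    unfolding state_field_def generated_space_eq
    using inv_into_into[of a "state \<Omega>" S] f_inv_into_f[of a "state \<Omega>" S]
    by (simp_all add: state_def)
  show "vfield a = A" if "A \<in> S" "A (- 1) \<Omega> = a"
    using inv_into_f_f[OF bij_betw_imp_inj_on[OF state_bij] that(1)] that(2)
    unfolding state_field_def generated_space_eq by (simp add: state_def)
qed

lemma vfield_image: "range vfield = S"
  using vfield_in_S vfield_unique by (auto simp: image_iff) metis

lemma vfield_zero: "vfield 0 = zero_field"
  by (rule vfield_unique[OF S_zero]) (simp add: zero_field_def)

lemma vfield_linear: "clinear (\<lambda>a. vfield a n v)"
proof -
  have "vfield (a + b) = lincomb 1 (vfield a) (vfield b)" for a b
    by (rule vfield_unique[OF S_lincomb[OF vfield_in_S vfield_in_S]]) (simp add: lincomb_def vfield_state scaleC_one)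
  moreover have "vfield (c *\<^sub>C a) = lincomb c (vfield a) zero_field" for c a
    by (rule vfield_unique[OF S_lincomb[OF vfield_in_S S_zero]]) (simp add: lincomb_def vfield_state zero_field_def)
  ultimately show ?thesis by (simp add: clinear_iff lincomb_def scaleC_one zero_field_def)
qed

lemma vfield_J: "vfield (J a (- 1) \<Omega>) = J a"
  by (rule vfield_unique) (simp_all add: S_base[OF J_in_gen])

lemma L_field_in_S: "(\<lambda>n. Lop (n - 1)) \<in> S"
proof -
  have "gen 0 (field_prod 0 (J a) (J a) (- 1))" for a
    using generated.product[OF J_in_gen J_in_gen] by simp
  then have "(\<lambda>n v. \<Sum>a\<in>UNIV. field_prod 0 (J a) (J a) (- 1) n v) \<in> S"
    unfolding S_def by (intro field_span_sum field_span_base) auto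
  then have "lincomb (1 / (2 * (\<l> + g))) (\<lambda>n v. \<Sum>a\<in>UNIV. field_prod 0 (J a) (J a) (- 1) n v) zero_field \<in> S"
    by (intro S_lincomb S_zero)
  moreover have "lincomb (1 / (2 * (\<l> + g))) (\<lambda>n v. \<Sum>a\<in>UNIV. field_prod 0 (J a) (J a) (- 1) n v) zero_field
      = (\<lambda>n. Lop (n - 1))"
    by (simp add: fun_eq_iff lincomb_def zero_field_def Lop_def sug_def)
  ultimately show ?thesis by simp
qed

abbreviation "\<omega> \<equiv> sugawara_vector \<l> g J \<Omega>"

lemma vfield_omega: "vfield \<omega> = (\<lambda>n. Lop (n - 1))"
  by (rule vfield_unique[OF L_field_in_S]) (simp add: L_minus2_vac)

lemma vir_mode_eq: "vir_mode vfield \<omega> n = Lop n"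
  by (simp add: vir_mode_def vfield_omega)

lemma energy_space_eq: "energy_space vfield \<omega> q = complex_vector.span (level q)"
  unfolding energy_space_def vir_mode_eq using L0_level eigenspace_level by blast

lemma homogeneous_band:
  assumes "gen 0 A" shows "\<exists>p. \<forall>i j m v. v \<in> band i j \<longrightarrow> A m v \<in> band (i + p - m) (j + p - m)"
proof -
  obtain \<alpha> where \<alpha>: "homogeneous (Lop 0) \<alpha> A" using gen_props[OF assms] by blast
  have "A m v \<in> band (i + (\<alpha> - 1) - m) (j + (\<alpha> - 1) - m)" if "v \<in> band i j" for i j m v
    unfolding band_def
  proof (rule span_image[OF is_field_linear[OF gen_field[OF assms]] _ that[unfolded band_def]])
    fix v assume "v \<in> {v. \<exists>e. i \<le> e \<and> e \<le> j \<and> Lop 0 v = of_int e *\<^sub>C v}"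
    then obtain e where e: "i \<le> e" "e \<le> j" "Lop 0 v = of_int e *\<^sub>C v" by blast
    have "Lop 0 (A m v) - A m (Lop 0 v) = of_int (\<alpha> - m - 1) *\<^sub>C A m v"
      using \<alpha> unfolding homogeneous_def by blast
    then have "Lop 0 (A m v) = of_int (\<alpha> - m - 1) *\<^sub>C A m v + of_int e *\<^sub>C A m v"
      unfolding e(3) field_scale[OF gen_field[OF assms]] diff_eq_eq .
    also have "\<dots> = of_int (\<alpha> - m - 1 + e) *\<^sub>C A m v"
      by (simp only: scaleC_add_left of_int_add)
    also have "\<alpha> - m - 1 + e = e + (\<alpha> - 1) - m" by simp
    finally show "A m v \<in> complex_vector.span {v. \<exists>e. i + (\<alpha> - 1) - m \<le> e \<and> e \<le> j + (\<alpha> - 1) - m \<and> Lop 0 v = of_int e *\<^sub>C v}"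
      using e(1,2)
      by (intro complex_vector.span_base CollectI exI[of _ "e + (\<alpha> - 1) - m"] conjI) simp_all
  qed
  then have "\<forall>i j m v. v \<in> band i j \<longrightarrow> A m v \<in> band (i + (\<alpha> - 1) - m) (j + (\<alpha> - 1) - m)" by simp
  then show ?thesis by (rule exI)
qed

lemma S_band:
  "A \<in> S \<Longrightarrow> \<exists>p q. \<forall>i j m v. v \<in> band i j \<longrightarrow> A m v \<in> band (i + p - m) (j + q - m)"
proof (induction A rule: S_induct)
  case zero
  then show ?case by (auto simp: zero_field_def band_def intro: complex_vector.span_zero)
next
  case (step c B A)
  obtain r where r: "\<And>i j m v. v \<in> band i j \<Longrightarrow> B m v \<in> band (i + r - m) (j + r - m)"
    using homogeneous_band[OF step.hyps(1)] by blast
  obtain p q where pq: "\<And>i j m v. v \<in> band i j \<Longrightarrow> A m v \<in> band (i + p - m) (j + q - m)"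
    using step.IH by blast
  have "lincomb c B A m v \<in> band (i + min r p - m) (j + max r q - m)" if v: "v \<in> band i j" for i j m v
  proof -
    have "B m v \<in> band (i + min r p - m) (j + max r q - m)"
      by (rule set_mp[OF band_mono r[OF v]]) auto
    moreover have "A m v \<in> band (i + min r p - m) (j + max r q - m)"
      by (rule set_mp[OF band_mono pq[OF v]]) auto
    ultimately show ?thesis
      unfolding lincomb_def band_def by (intro complex_vector.span_add complex_vector.span_scale)
  qed
  then have "\<forall>i j m v. v \<in> band i j \<longrightarrow> lincomb c B A m v \<in> band (i + min r p - m) (j + max r q - m)"
    by simp
  then show ?case by (intro exI)
qed

text \<open>Up to a bounded amount, \<open>A l\<close> and \<open>B m\<close> together lower energy
  by \<open>l + m\<close>. When this is large in absolute value, the result has no energy in common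
  with \<open>d\<close>.\<close>

lemma S_bounded:
  assumes "A \<in> S" "B \<in> S"
  shows "\<exists>R. \<forall>l m. R < \<bar>l + m\<bar> \<longrightarrow> cinner (A l (B m c)) d = 0"
proof -
  obtain p q where A: "\<And>i j m v. v \<in> band i j \<Longrightarrow> A m v \<in> band (i + p - m) (j + q - m)"
    using S_band[OF assms(1)] by blast
  obtain p' q' where B: "\<And>i j m v. v \<in> band i j \<Longrightarrow> B m v \<in> band (i + p' - m) (j + q' - m)"
    using S_band[OF assms(2)] by blast
  obtain i j where c: "c \<in> band i j" using in_band by blast
  obtain i' j' where d: "d \<in> band i' j'" using in_band by blast
  define R where "R = \<bar>i\<bar> + \<bar>j\<bar> + \<bar>i'\<bar> + \<bar>j'\<bar> + \<bar>p\<bar> + \<bar>q\<bar> + \<bar>p'\<bar> + \<bar>q'\<bar>"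
  have "cinner (A l (B m c)) d = 0" if "R < \<bar>l + m\<bar>" for l m
    by (rule band_orthogonal[OF A[OF B[OF c]] d]) (use that in \<open>auto simp: R_def\<close>)
  then show ?thesis by blast
qed

lemma S_analytically_local:
  assumes "A \<in> S" "B \<in> S" shows "local 0 A B"
proof (rule local_if_mutually_local)
  show "is_field A" "is_field B" "mutually_local A B" using assms S_field S_local by blast+
  fix c d
  obtain R where R: "\<And>l m. R < \<bar>l + m\<bar> \<Longrightarrow> cinner (A l (B m c)) d = 0"
    using S_bounded[OF assms] by blast
  obtain R' where R': "\<And>l m. R' < \<bar>l + m\<bar> \<Longrightarrow> cinner (B l (A m c)) d = 0"
    using S_bounded[OF assms(2,1)] by blast
  have "\<forall>l m. max R R' < \<bar>l + m\<bar> \<longrightarrow> cinner (A l (B m c)) d = 0 \<and> cinner (B m (A l c)) d = 0"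
    using R R' by (simp add: add.commute)
  then show "\<exists>R. \<forall>l m. R < \<bar>l + m\<bar> \<longrightarrow> cinner (A l (B m c)) d = 0 \<and> cinner (B m (A l c)) d = 0" by blast
qed

section \<open>The axioms of a vertex operator superalgebra\<close>

definition "Hs \<epsilon> = state \<Omega> ` field_span {A. gen \<epsilon> A}"

lemma Hs_even: "Hs 0 = UNIV"
  using bij_betw_imp_surj_on[OF state_bij] by (simp add: Hs_def S_def)

lemma Hs_odd: "Hs 1 = {0}"
proof -
  have *: "{A. gen 1 A} = {}" using gen_even[of 1] by auto
  show ?thesis unfolding Hs_def * field_span_empty by (simp add: state_def zero_field_def)
qed

lemma level_cases: "level q \<noteq> {} \<Longrightarrow> \<exists>k::nat. q = real k"
  by (auto simp: level_def)

text \<open>Energies of monomials are integers and all generated fields are even, so the half-odd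
  energy spaces and the odd part are both zero; odd cases of the axioms reduce to the zero
  field.\<close>

lemma vosa: "vertex_operator_superalgebra Hs vfield \<Omega> \<omega>"
proof (rule vertex_operator_superalgebra.intro)
  have bit: "\<epsilon> = 0 \<or> \<epsilon> = 1" for \<epsilon> :: bit using bit_not_zero_iff by blast
  have image: "vfield ` Hs 0 = S" "vfield ` Hs 1 = {zero_field}"
    by (simp_all add: Hs_even Hs_odd vfield_image vfield_zero)
  have in_S: "A \<in> S" if "A \<in> vfield ` Hs \<epsilon>" for A \<epsilon> using that vfield_in_S by blast
  show "complex_vector.subspace (Hs \<epsilon>)" for \<epsilon>
    using bit[of \<epsilon>] by (auto simp: Hs_even Hs_odd)
  show "Hs 0 \<inter> Hs 1 = {0}" "\<exists>a\<in>Hs 0. \<exists>b\<in>Hs 1. v = a + b" for v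
    by (auto simp: Hs_even Hs_odd)
  show "clinear (vfield a n)" for a n by (intro is_field_linear S_field vfield_in_S)
  show "clinear (\<lambda>a. vfield a n v)" for n v by (rule vfield_linear)
  show "vfield a n \<Omega> = 0" if "n \<ge> 0" for a n
    using S_creative[OF vfield_in_S[of a]] that by (simp add: creative_def)
  show "vfield a (- 1) \<Omega> = a" for a by (rule vfield_state)
  show "vfield \<Omega> = id_field"
    by (rule vfield_unique[OF S_base[OF generated.identity]]) (simp add: id_field_def)
  show "acts_irreducibly {vfield a n |a n. True}"
    unfolding acts_irreducibly_def
  proof (intro conjI allI impI)
    show "\<exists>v::'h. v \<noteq> 0" using vac_ne_0 by blast
    fix W assume W: "complex_vector.subspace W \<and> (\<forall>T\<in>{vfield a n |a n. True}. T ` W \<subseteq> W)"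
    \<comment> \<open>The currents are among the fields of states, so irreducibility is inherited
      from the boson algebra, whose central element acts by a scalar.\<close>
    have "J a n ` W \<subseteq> W" for a n
      using W vfield_J[of a] by (metis (mono_tags, lifting) mem_Collect_eq)
    moreover have "K ` W \<subseteq> W" using W by (auto simp: K_scalar complex_vector.subspace_scale)
    ultimately have "\<forall>T\<in>insert K {J a n | a n. True}. T ` W \<subseteq> W" by blast
    then show "W = {0} \<or> W = UNIV" using W irred unfolding acts_irreducibly_def by blast
  qed
  show "local (\<epsilon>\<^sub>1 * \<epsilon>\<^sub>2) A B" if "A \<in> vfield ` Hs \<epsilon>\<^sub>1" "B \<in> vfield ` Hs \<epsilon>\<^sub>2" for \<epsilon>\<^sub>1 \<epsilon>\<^sub>2 A B
  proof (cases "\<epsilon>\<^sub>1 = 1 \<or> \<epsilon>\<^sub>2 = 1")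
    case True
    then have "A = zero_field \<or> B = zero_field" using that image(2) by blast
    then show ?thesis using in_S[OF that(1)] in_S[OF that(2)] local_zero S_field by blast
  next
    case False
    then have "\<epsilon>\<^sub>1 = 0" "\<epsilon>\<^sub>2 = 0" using bit by blast+
    then show ?thesis using in_S[OF that(1)] in_S[OF that(2)] by (simp add: S_analytically_local)
  qed
  show "field_prod (\<epsilon>\<^sub>1 * \<epsilon>\<^sub>2) A B n \<in> vfield ` Hs (\<epsilon>\<^sub>1 + \<epsilon>\<^sub>2)"
    if "A \<in> vfield ` Hs \<epsilon>\<^sub>1" "B \<in> vfield ` Hs \<epsilon>\<^sub>2" for \<epsilon>\<^sub>1 \<epsilon>\<^sub>2 A B n
  proof (cases "\<epsilon>\<^sub>1 = 1 \<or> \<epsilon>\<^sub>2 = 1")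
    case True
    then have "A = zero_field \<or> B = zero_field" using that image(2) by blast
    then have "field_prod (\<epsilon>\<^sub>1 * \<epsilon>\<^sub>2) A B n = zero_field"
      using in_S[OF that(1)] in_S[OF that(2)] field_prod_zero S_field by blast
    then have "field_prod (\<epsilon>\<^sub>1 * \<epsilon>\<^sub>2) A B n = vfield 0" by (simp add: vfield_zero)
    moreover have "0 \<in> Hs \<epsilon>" for \<epsilon> using bit[of \<epsilon>] by (auto simp: Hs_even Hs_odd)
    ultimately show ?thesis by blast
  next
    case False
    then have "\<epsilon>\<^sub>1 = 0" "\<epsilon>\<^sub>2 = 0" using bit by blast+
    then show ?thesis using in_S[OF that(1)] in_S[OF that(2)] by (simp add: image(1) S_prod)
  qed
  show "vir_mode vfield \<omega> 0 \<Omega> = 0" "vir_mode vfield \<omega> (- 1) \<Omega> = 0" "\<omega> = vir_mode vfield \<omega> (- 2) \<Omega>"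
    by (simp_all add: vir_mode_eq L_vac L_minus2_vac)
  show "vir_mode vfield \<omega> m (vir_mode vfield \<omega> n v) - vir_mode vfield \<omega> n (vir_mode vfield \<omega> m v) =
      of_int (m - n) *\<^sub>C vir_mode vfield \<omega> (m + n) v
      + (if m + n = 0 then (2 * cinner \<omega> \<omega> / 12 * of_int (m * (m\<^sup>2 - 1))) *\<^sub>C v else 0)" for m n v
    using L_virasoro[of m n v] by (simp only: vir_mode_eq vir_norm_def of_nat_numeral L_minus2_vac)
  have level_half: "energy_space vfield \<omega> (real k) \<subseteq> (\<Union>k::nat. energy_space vfield \<omega> (real k / 2))" for k
  proof -
    have "real k = real (2 * k) / 2" by simp
    then show ?thesis by (metis UNIV_I UN_upper)
  qed
  have span_energy: "complex_vector.span (\<Union>k::nat. energy_space vfield \<omega> (real k)) = UNIV"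
  proof -
    have "monomials \<subseteq> (\<Union>k::nat. energy_space vfield \<omega> (real k))"
      unfolding monomials_def energy_space_eq by (auto simp: level_def intro!: complex_vector.span_base)
    then show ?thesis using complex_vector.span_mono span_monomials by blast
  qed
  then show "complex_vector.span (\<Union>k::nat. energy_space vfield \<omega> (real k / 2)) = UNIV"
    using complex_vector.span_mono[of "\<Union>k::nat. energy_space vfield \<omega> (real k)"] level_half by blast
  show "Hs 0 = complex_vector.span (\<Union>k::nat. energy_space vfield \<omega> (real k))"
    using span_energy by (simp add: Hs_even)
  show "cfinite_dim (energy_space vfield \<omega> (real k / 2))" for k :: nat
    unfolding cfinite_dim_def energy_space_eq using finite_level by blast
  show "cinner u v = 0" if "j \<noteq> k" "u \<in> energy_space vfield \<omega> (real j / 2)" "v \<in> energy_space vfield \<omega> (real k / 2)"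
    for j k :: nat and u v
    by (rule L0_orthogonal[of u "real j / 2" v "real k / 2"])
      (use that in \<open>simp_all add: energy_space_def vir_mode_eq\<close>)
  show "Hs 1 = complex_vector.span (\<Union>k::nat. energy_space vfield \<omega> (real k + 1 / 2))"
  proof -
    have "level (real k + 1 / 2) = {}" for k
    proof (rule ccontr)
      assume "level (real k + 1 / 2) \<noteq> {}"
      then obtain j :: nat where "real k + 1 / 2 = real j" using level_cases by blast
      then have "real (2 * k + 1) = real (2 * j)" by simp
      then have "2 * k + 1 = 2 * j" by (simp only: of_nat_eq_iff)
      then show False by presburger
    qed
    then show ?thesis by (simp add: energy_space_eq Hs_odd)
  qed
  show "\<Omega> \<in> energy_space vfield \<omega> 0" "\<omega> \<in> energy_space vfield \<omega> 2"
    using L0_L_vac[of "- 2"] by (simp_all add: energy_space_def vir_mode_eq L_vac L_minus2_vac)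
  show "vir_mode vfield \<omega> 0 (vfield a n v) - vfield a n (vir_mode vfield \<omega> 0 v) =
      deriv_field (vfield a) (n + 1) v + of_real (real k / 2) *\<^sub>C vfield a n v"
    if a: "a \<in> energy_space vfield \<omega> (real k / 2)" for k :: nat and a n v
  proof -
    obtain A where A: "A \<in> S" "A (- 1) \<Omega> = a"
      "\<And>n w. Lop 0 (A n w) - A n (Lop 0 w) = (of_real (real k / 2) - of_int n - 1) *\<^sub>C A n w"
      using level_field a unfolding energy_space_eq by blast
    have "vfield a = A" using A by (intro vfield_unique)
    have "of_int (- (n + 1)) + of_real (real k / 2) = (of_real (real k / 2) - of_int n - 1 :: complex)"
      by simp
    then have "deriv_field A (n + 1) v + of_real (real k / 2) *\<^sub>C A n v =
        (of_real (real k / 2) - of_int n - 1) *\<^sub>C A n v"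
      by (simp only: deriv_field_def add_diff_cancel_right' scaleC_add_left[symmetric])
    then show ?thesis unfolding vir_mode_eq \<open>vfield a = A\<close> A(3) by simp
  qed
  show "vir_mode vfield \<omega> (- 1) (vfield a n v) - vfield a n (vir_mode vfield \<omega> (- 1) v) = deriv_field (vfield a) n v" for a n v
    using S_translation[OF vfield_in_S[of a]] by (simp add: vir_mode_eq translation_covariant_def deriv_field_def)
  show "deriv_field (vfield a) = vfield (vir_mode vfield \<omega> (- 1) a)" for a
  proof (rule vfield_unique[symmetric])
    show "deriv_field (vfield a) \<in> S" by (intro S_deriv vfield_in_S)
    have "Lop (- 1) (vfield a (- 1) \<Omega>) - vfield a (- 1) (Lop (- 1) \<Omega>) = deriv_field (vfield a) (- 1) \<Omega>"
      using S_translation[OF vfield_in_S[of a]] by (simp add: translation_covariant_def deriv_field_def)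
    then show "deriv_field (vfield a) (- 1) \<Omega> = vir_mode vfield \<omega> (- 1) a"
      by (simp add: vir_mode_eq vfield_state L_vac field_0[OF S_field[OF vfield_in_S]])
  qed
qed

lemma generates: "generates_vosa (boson_fields J) \<Omega> \<omega>"
  unfolding generates_vosa_def generated_space_eq using state_bij vosa unfolding Hs_def[abs_def] ..

section \<open>Operator product expansions\<close>

lemma field_prod_kernel:
  assumes "is_field A" "is_field B"
  shows "field_prod 0 A B (int n) m v = (zw_mult ^^ n) (\<lambda>l m. A l (B m v) - B m (A l v)) 0 m"
  unfolding field_prod_eq[OF assms] prod_kernel_nonneg[OF assms] ..

lemma ope_two:
  assumes "field_prod \<epsilon> A B 0 = C" "field_prod \<epsilon> A B 1 = D"
    and "\<And>n. n \<ge> 2 \<Longrightarrow> field_prod \<epsilon> A B (int n) = zero_field"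
  shows "ope \<epsilon> A B [C, D]"
  unfolding ope_def
proof
  fix n :: nat
  consider "n = 0" | "n = 1" | "n \<ge> 2" by linarith
  then show "field_prod \<epsilon> A B (int n) = (if n < length [C, D] then [C, D] ! n else zero_field)"
    by cases (simp_all add: assms)
qed

lemma ope_J_J:
  "ope 0 (J a) (J b)
     [\<lambda>n v. \<i> *\<^sub>C (\<Sum>c\<in>UNIV. of_real (\<Gamma> a b c) *\<^sub>C J c n v),
      \<lambda>n v. (if a = b then \<l> else 0) *\<^sub>C id_field n v]"
proof (rule ope_two; intro ext)
  note kernel = field_prod_kernel[OF is_field_J is_field_J]
  fix m v
  show "field_prod 0 (J a) (J b) 0 m v = \<i> *\<^sub>C (\<Sum>c\<in>UNIV. of_real (\<Gamma> a b c) *\<^sub>C J c m v)"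
    using kernel[where n = 0] by (simp add: J_comm)
  show "field_prod 0 (J a) (J b) 1 m v = (if a = b then \<l> else 0) *\<^sub>C id_field m v"
    using kernel[where n = 1] by (simp add: zw_mult_J_J_kernel id_field_def eq_neg_iff_add_eq_0)
  show "field_prod 0 (J a) (J b) (int n) m v = zero_field m v" if "n \<ge> 2" for n
    unfolding kernel zw_mult_mono[OF zw_mult_2_J_J_kernel that] by (simp add: zero_field_def)
qed

text \<open>The commutator has coefficients \<open>l\<close> times a function of
  \<open>l + m\<close>. At \<open>l = 0\<close> they vanish, which gives the first entry; one factor
  \<open>z - w\<close> removes the factor \<open>l\<close>, and the next one annihilates.\<close>

lemma ope_J_L: "ope 0 (J a) (vfield \<omega>) [zero_field, J a]"
proof (rule ope_two; intro ext)
  note kernel = field_prod_kernel[OF is_field_J[of a] S_field[OF vfield_in_S[of \<omega>]]]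
  fix m v
  have G: "(\<lambda>l m. J a l (vfield \<omega> m v) - vfield \<omega> m (J a l v)) = (\<lambda>l m. of_int l *\<^sub>C J a (l + m - 1) v)"
  proof (intro ext)
    fix l m
    have "J a l (Lop (m - 1) v) - Lop (m - 1) (J a l v) = of_int l *\<^sub>C J a (l + m - 1) v"
      using L_J[of "m - 1" a l v] by (simp add: algebra_simps)
    then show "J a l (vfield \<omega> m v) - vfield \<omega> m (J a l v) = of_int l *\<^sub>C J a (l + m - 1) v"
      by (simp add: vfield_omega)
  qed
  have G1: "zw_mult (\<lambda>l m. of_int l *\<^sub>C J a (l + m - 1) v) = (\<lambda>l m. J a (l + m) v)"
    by (simp add: zw_mult_def fun_eq_iff scaleC_add_left scaleC_one algebra_simps)
  have G2: "(zw_mult ^^ 2) (\<lambda>l m. of_int l *\<^sub>C J a (l + m - 1) v) = (\<lambda>l m. 0)"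
    unfolding numeral_2_eq_2 funpow.simps o_apply id_apply G1
    by (simp add: zw_mult_def fun_eq_iff algebra_simps)
  show "field_prod 0 (J a) (vfield \<omega>) 0 m v = zero_field m v"
    using kernel[where n = 0 and m = m and v = v] unfolding G by (simp add: zero_field_def)
  show "field_prod 0 (J a) (vfield \<omega>) 1 m v = J a m v"
    using kernel[where n = 1 and m = m and v = v] unfolding G by (simp add: G1)
  show "field_prod 0 (J a) (vfield \<omega>) (int n) m v = zero_field m v" if "n \<ge> 2" for n
    unfolding kernel G zw_mult_mono[OF G2 that] by (simp add: zero_field_def)
qed

end

theorem corollary4p31:
  fixes lie :: "'g::complex_vector \<Rightarrow> 'g \<Rightarrow> 'g"
    and h :: "'g set" and P :: "('g \<Rightarrow> complex) set" and \<theta> :: "'g \<Rightarrow> complex"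
    and X :: "'i::finite \<Rightarrow> 'g" and \<Gamma> :: "'i \<Rightarrow> 'i \<Rightarrow> 'i \<Rightarrow> real"
    and g \<l> :: complex
    and J :: "'i \<Rightarrow> int \<Rightarrow> 'h::prehilbert \<Rightarrow> 'h" and K :: "'h \<Rightarrow> 'h" and \<Omega> \<omega> :: 'h
    and V :: "'h \<Rightarrow> 'h modes" and L :: "int \<Rightarrow> 'h \<Rightarrow> 'h"
  assumes "simple_lie_algebra lie"
    and "cartan_subalgebra lie h" and "positive_system lie h P" and "highest_root lie h P \<theta>"
    and "normalized_basis lie h \<theta> X \<Gamma>"
    and g: "g = dual_coxeter_number lie h P \<theta>"
    and level: "\<l> = g \<or> \<l> \<in> \<nat>"
    and "vacuum_rep \<Gamma> \<l> J K \<Omega>"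
    and \<omega>: "\<omega> = sugawara_vector \<l> g J \<Omega>"
    and V: "V = state_field (boson_fields J) \<Omega>"
    and L: "L = vir_mode V \<omega>"
  shows "generates_vosa (boson_fields J) \<Omega> \<omega>
    \<and> (\<forall>a b. ope 0 (J a) (J b)
         [\<lambda>n v. \<i> *\<^sub>C (\<Sum>c\<in>UNIV. of_real (\<Gamma> a b c) *\<^sub>C J c n v),
          \<lambda>n v. (if a = b then \<l> else 0) *\<^sub>C id_field n v])
    \<and> (\<forall>a. ope 0 (J a) (V \<omega>) [zero_field, J a])
    \<and> (\<forall>m a n v. L m (J a n v) - J a n (L m v) = - of_int n *\<^sub>C J a (m + n) v)"
proof -
  obtain q where q: "q > 0" "dual_coxeter_number lie h P \<theta> = complex_of_real q"
    using structure_constants_dual_coxeter(2)[OF assms(1-5)] by blast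
  \<comment> \<open>Under either assumption on the level, \<open>\<l>\<close> is real and
    nonnegative, so that \<open>\<l> + g\<close> is positive.\<close>
  obtain x where x: "x \<ge> 0" "\<l> = complex_of_real x"
  proof (cases "\<l> = g")
    case True
    then show thesis using that[of q] q g by simp
  next
    case False
    then obtain k where "\<l> = of_nat k" using level by (auto elim: Nats_cases)
    then show thesis using that[of "real k"] by simp
  qed
  have anti: "\<forall>a b c. \<Gamma> a b c = - \<Gamma> b a c \<and> \<Gamma> a b c = - \<Gamma> a c b"
    using assms(5)[unfolded normalized_basis_def] by (elim conjE)
  have "\<l> + g = complex_of_real (x + q)" using x q g by simp
  then have "\<l> + g \<noteq> 0" using x q by (simp only: of_real_eq_0_iff)
  then interpret vacuum_module \<Gamma> \<l> g J K \<Omega>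
  proof unfold_locales
    show "vacuum_rep \<Gamma> \<l> J K \<Omega>" by (rule assms(8))
    show "\<Gamma> a b c = - \<Gamma> b a c" "\<Gamma> a b c = - \<Gamma> a c b" for a b c using anti by blast+
    show "(\<Sum>a\<in>UNIV. \<Sum>c\<in>UNIV. complex_of_real (\<Gamma> b a c * \<Gamma> d a c)) = (if b = d then 2 * g else 0)"
      for b d unfolding g by (rule structure_constants_dual_coxeter(1)[OF assms(1-5)])
    show "\<l> \<in> \<real>" "g \<in> \<real>" using x q g by simp_all
  qed
  show ?thesis
    unfolding L V \<omega> vir_mode_eq
    using generates ope_J_J ope_J_L L_J by simp
qed

end
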